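(* There exists a map $h \colon \mathbb{R}^3 \to \mathbb{R}^3$ with all of the following properties. (1) The map $h$ is topologically monotone, proper, and surjective onto $\mathbb{R}^3$. (2) The map $h$ is locally Lipschitz, and $J_h$ is positive almost everywhere (hence $h$ is a mapping of finite distortion). (3) $K_h \in L^p_{\mathrm{loc}}(\mathbb{R}^3)$ for every $p < 1/2$, but $K_h \notin L^{1/2}_{\mathrm{loc}}(\mathbb{R}^3)$. (4) The fibers $h^{-1}\{0\}$ and $h^{-1}\{-e_x\}$ are bilipschitz equivalent with $\mathbb{S}^1$. The fibers $h^{-1}\{-te_x\}$ for $t \in (0,1)$ are bilipschitz equivalent with $\mathbb{S}^1 \vee \mathbb{S}^1$. The fibers $h^{-1}\{-te_x\}$ for $t \in (1,\infty)$ are bilipschitz equivalent with $[0,1]$. For all other values $y \in \mathbb{R}^3 \setminus \{-te_x : t \geq 0\}$, the fiber $h^{-1}\{y\}$ is a point.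
   Context: Here $e_x = (1,0,0)$. A map is (topologically) monotone if it is continuous and the preimage of every point is connected. A map is proper if preimages of compact sets are compact. A mapping $h \in W^{1,3}_{\mathrm{loc}}(\mathbb{R}^3,\mathbb{R}^3)$ has finite distortion if $|Dh(x)|^3 \le K(x) J_h(x)$ for a.e. $x$, for some measurable $K$ with $1 \le K(x) < \infty$; here $|Dh(x)|$ is the operator norm and $J_h = \det Dh$. The smallest such $K\ge 1$ is the distortion function $K_h$. $\mathbb{S}^1 \vee \mathbb{S}^1$ is a figure-eight, formed by two disjoint copies of the circle joined at a point. *)

theory Defs
  imports "HOL-Analysis.Analysis"
begin

definition topologically_monotone ::
    "('a::topological_space \<Rightarrow> 'b::topological_space) \<Rightarrow> bool" where
  "topologically_monotone f \<longleftrightarrow>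
     continuous_on UNIV f \<and> (\<forall>y. connected (f -` {y}))"

text \<open>Properness in the sense that preimages of compact sets are compact. The library's
  \<^const>\<open>proper_map\<close> is a closed map with compact fibers.\<close>

definition compact_preimages ::
    "('a::topological_space \<Rightarrow> 'b::topological_space) \<Rightarrow> bool" where
  "compact_preimages f \<longleftrightarrow> (\<forall>C. compact C \<longrightarrow> compact (f -` C))"

definition locally_lipschitz ::
    "('a::metric_space \<Rightarrow> 'b::metric_space) \<Rightarrow> bool" where
  "locally_lipschitz f \<longleftrightarrow> (\<forall>x. \<exists>r>0. \<exists>L. L-lipschitz_on (ball x r) f)"

definition bilipschitz_equivalent ::
    "'a::metric_space set \<Rightarrow> 'b::metric_space set \<Rightarrow> bool" where
  "bilipschitz_equivalent S T \<longleftrightarrow>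
     (\<exists>f L. L \<ge> 1 \<and> bij_betw f S T \<and>
        (\<forall>x\<in>S. \<forall>y\<in>S. dist x y / L \<le> dist (f x) (f y) \<and> dist (f x) (f y) \<le> L * dist x y))"

abbreviation unit_circle :: "complex set" where
  "unit_circle \<equiv> sphere 0 1"

text \<open>The wedge of two circles with base point \<open>1\<close>, realised inside the product. The product
  metric restricts to the round metric on each circle, and for points on different circles it
  is \<open>sqrt (a\<^sup>2 + b\<^sup>2)\<close>, where \<open>a\<close> and \<open>b\<close> are the distances to the common point; this is
  comparable to the wedge metric \<open>a + b\<close>. Two externally tangent circles in the plane would
  give a different bilipschitz class, because of the cusps at the point of tangency.\<close>

definition figure_eight :: "(complex \<times> complex) set" where
  "figure_eight = unit_circle \<times> {1} \<union> {1} \<times> unit_circle"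

definition Lp_loc ::
    "real \<Rightarrow> ('a::euclidean_space \<Rightarrow> 'b::{real_normed_vector, second_countable_topology}) \<Rightarrow> bool" where
  "Lp_loc p f \<longleftrightarrow> f \<in> borel_measurable lebesgue \<and>
     (\<forall>C. compact C \<longrightarrow> set_integrable lebesgue C (\<lambda>x. norm (f x) powr p))"

definition partial_deriv :: "'n::finite \<Rightarrow> (real^'n \<Rightarrow> real) \<Rightarrow> real^'n \<Rightarrow> real" where
  "partial_deriv j \<phi> x = frechet_derivative \<phi> (at x) (axis j 1)"

fun C_diff :: "nat \<Rightarrow> (real^'n::finite \<Rightarrow> real) \<Rightarrow> bool" where
  "C_diff 0 \<phi> \<longleftrightarrow> continuous_on UNIV \<phi>"
| "C_diff (Suc k) \<phi> \<longleftrightarrow>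
     \<phi> differentiable_on UNIV \<and> (\<forall>j. C_diff k (partial_deriv j \<phi>))"

definition test_function :: "(real^'n::finite \<Rightarrow> real) \<Rightarrow> bool" where
  "test_function \<phi> \<longleftrightarrow> (\<forall>k. C_diff k \<phi>) \<and> compact (closure {x. \<phi> x \<noteq> 0})"

text \<open>\<open>D x $ i $ j\<close> is the \<open>j\<close>-th weak partial derivative of the \<open>i\<close>-th component, so that
  \<open>D x *v v\<close> is the (weak) derivative in direction \<open>v\<close>. A weak derivative is unique up to null
  sets; it is therefore treated as a relation.\<close>

definition weak_derivative ::
    "(real^'n::finite \<Rightarrow> real^'m::finite) \<Rightarrow> (real^'n \<Rightarrow> real^'n^'m) \<Rightarrow> bool" where
  "weak_derivative h D \<longleftrightarrow> Lp_loc 1 h \<and> Lp_loc 1 D \<and>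
     (\<forall>\<phi>. test_function \<phi> \<longrightarrow>
        (\<forall>i j. (LINT x|lebesgue. h x $ i * partial_deriv j \<phi> x)
             = - (LINT x|lebesgue. D x $ i $ j * \<phi> x)))"

definition W1_loc ::
    "real \<Rightarrow> (real^'n::finite \<Rightarrow> real^'m::finite) \<Rightarrow> (real^'n \<Rightarrow> real^'n^'m) \<Rightarrow> bool" where
  "W1_loc p h D \<longleftrightarrow> weak_derivative h D \<and> Lp_loc p h \<and> Lp_loc p D"

abbreviation op_norm :: "real^'n::finite^'m::finite \<Rightarrow> real" where
  "op_norm A \<equiv> onorm (\<lambda>v. A *v v)"

definition distortion_bound :: "(real^3 \<Rightarrow> real^3^3) \<Rightarrow> (real^3 \<Rightarrow> real) \<Rightarrow> bool" where
  "distortion_bound D K \<longleftrightarrow> K \<in> borel_measurable lebesgue \<and> (\<forall>x. 1 \<le> K x) \<and>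
     (AE x in lebesgue. op_norm (D x) ^ 3 \<le> K x * det (D x))"

definition finite_distortion :: "(real^3 \<Rightarrow> real^3) \<Rightarrow> bool" where
  "finite_distortion h \<longleftrightarrow> (\<exists>D K. W1_loc 3 h D \<and> distortion_bound D K)"

text \<open>The distortion function is the smallest admissible bound, unique up to null sets.\<close>

definition distortion_function :: "(real^3 \<Rightarrow> real^3^3) \<Rightarrow> (real^3 \<Rightarrow> real) \<Rightarrow> bool" where
  "distortion_function D K \<longleftrightarrow> distortion_bound D K \<and>
     (\<forall>K'. distortion_bound D K' \<longrightarrow> (AE x in lebesgue. K x \<le> K' x))"

abbreviation e_x :: "real^3" where
  "e_x \<equiv> vector [1, 0, 0]"

end

theory Submission
  imports Defs
begin

text \<open>Write \<open>\<rho>\<close> for the distance of \<open>X = (x, y, z)\<close> to the \<open>z\<close>-axis, \<open>w = \<rho> + iz\<close> and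
  \<open>\<zeta> = w\<^sup>2 - 1\<close>. The map satisfies \<open>\<bar>h X\<bar> = \<bar>\<zeta>\<bar>\<close>; its level sets are tori (then a horn torus, then
  spheres) around the unit circle in the plane \<open>z = 0\<close>. Cutting them along the unit disc in that
  plane and along the half-plane \<open>y = 0, x \<le> 0\<close> leaves open squares, which are mapped
  diffeomorphically onto round spheres minus the point on the negative \<open>x\<close>-axis, while the cuts are
  collapsed to that point. On a torus the two cuts are a longitude and a meridian, so they form a
  figure eight; on the horn torus the longitude has shrunk to a point; on a sphere only an arc is
  left.

  In coordinates, \<open>u = tan (\<theta>/2) / \<rho>\<close> and \<open>v = tan (\<psi>/2)\<close> with \<open>\<theta> = arg (x + iy)\<close> and \<open>\<psi> = arg \<zeta>\<close>
  identify the complement of the cuts with \<open>R > 0\<close>, \<open>(u, v) \<in> \<real>\<^sup>2\<close> where \<open>R = \<bar>\<zeta>\<bar>\<close>, and \<open>h\<close> is inverse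
  stereographic projection on the sphere of radius \<open>R\<close>. Equivalently \<open>h + R e\<^sub>x\<close> is twice the
  inversion of \<open>Y = (1, u, v) / R\<close>. Its planar parts \<open>(1/R, -v/R)\<close> and \<open>(1/(R\<rho>), -u/R)\<close> are
  reciprocals of the Lipschitz functions \<open>(\<bar>\<zeta>\<bar> + \<zeta>) / 2\<close> and \<open>R (\<bar>\<xi>\<bar> + \<xi>) / 2\<close>, \<open>\<xi> = x + iy\<close>, which
  makes \<open>h\<close> Lipschitz on bounded sets. The Jacobian is explicit and locally bounded below by a multiple of
  \<open>(xyz)\<^sup>2\<close>, and near the disc it is of order \<open>z\<^sup>2\<close>; this gives the critical exponent \<open>1/2\<close>.\<close>

section \<open>Integration by parts for Lipschitz maps\<close>

text \<open>The factor 1/\<rho> in u serves Lipschitz continuity at the z-axis. Without it the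
  second planar part would be the reciprocal of R (1 + e^(i\<theta>)) / 2, which has no limit at the
  axis; with it R (|\<xi>| + \<xi>) / 2 appears, which is Lipschitz there as well. The price is that
  the two planar parts no longer share their first coordinate: 1/(R \<rho>) can be much larger than
  1/R. This does no harm because v blows up at the axis at least as fast as 1/\<rho>.

  The weak derivative is the classical one. The map is differentiable off the cuts, which form a
  closed null set, so integration by parts reduces to the fact that directional derivatives of a
  compactly supported Lipschitz function have integral zero, a consequence of translation
  invariance.

  The lower Jacobian bound by (xyz)^2 is crude, but it dominates K^p by a product of functions
  |s|^(-2p) of one variable each, and these are integrable at 0 exactly for p < 1/2. For the failure
  at p = 1/2 a box above the disc suffices, where K is at least of order 1/z^2.\<close>

lemma integral_directional_derivative_eq_0:
  fixes g d :: "'a::euclidean_space \<Rightarrow> real"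
  assumes lip: "\<And>x y. \<bar>g x - g y\<bar> \<le> L * norm (x - y)"
    and supp: "\<And>x. M < norm x \<Longrightarrow> g x = 0"
    and lim: "AE x in lborel. ((\<lambda>t. (g (x + t *\<^sub>R e) - g x) / t) \<longlongrightarrow> d x) (at_right 0)"
    and meas: "d \<in> borel_measurable borel"
  shows "(\<integral>x. d x \<partial>lborel) = 0"
proof -
  have "L-lipschitz_on UNIV g" if "L \<ge> 0"
    using lip that by (intro lipschitz_onI) (auto simp: dist_norm)
  moreover have L0: "L \<ge> 0"
  proof -
    obtain b :: 'a where "b \<in> Basis" by (meson SOME_Basis)
    then show ?thesis using lip[of b 0] by simp
  qed
  ultimately have cont: "continuous_on UNIV g"
    using lipschitz_on_continuous_on by blast
  then have gm[measurable]: "g \<in> borel_measurable borel"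
    by (rule borel_measurable_continuous_onI)
  have "set_integrable lborel (cball 0 M) g"
    unfolding set_integrable_def
    by (rule borel_integrable_compact) (auto intro: continuous_on_subset[OF cont])
  moreover have "(\<lambda>x. indicator (cball 0 M) x *\<^sub>R g x) = g"
    using supp by (auto simp: indicator_def fun_eq_iff not_le)
  ultimately have gi: "integrable lborel g"
    by (simp add: set_integrable_def)
  have shift_i: "integrable lborel (\<lambda>x. g (x + c))"
    and shift: "(\<integral>x. g (x + c) \<partial>lborel) = (\<integral>x. g x \<partial>lborel)" for c
  proof -
    have "integrable (distr lborel borel ((+) c)) g"
      using gi by (simp add: lborel_distr_plus)
    then show "integrable lborel (\<lambda>x. g (x + c))"
      by (subst (asm) integrable_distr_eq) (auto simp: add.commute)
    have "(\<integral>x. g x \<partial>lborel) = (\<integral>x. g x \<partial>(distr lborel borel ((+) c)))"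
      by (simp add: lborel_distr_plus)
    also have "\<dots> = (\<integral>x. g (c + x) \<partial>lborel)"
      by (subst integral_distr) auto
    finally show "(\<integral>x. g (x + c) \<partial>lborel) = (\<integral>x. g x \<partial>lborel)"
      by (simp add: add.commute)
  qed
  define t where "t n = inverse (real (Suc n))" for n
  have t0: "t n > 0" and t1: "t n \<le> 1" for n
    by (auto simp: t_def divide_simps)
  have "t \<longlonglongrightarrow> 0"
    unfolding t_def by (rule LIMSEQ_inverse_real_of_nat)
  with t0 have tlim: "filterlim t (at_right 0) sequentially"
    by (intro tendsto_imp_filterlim_at_right) auto
  define s where "s n x = (g (x + t n *\<^sub>R e) - g x) / t n" for n x
  \<comment> \<open>Translation invariance makes the integral of every difference quotient zero;
    only the passage to the limit remains.\<close>
  have s_int: "(\<integral>x. s n x \<partial>lborel) = 0" for n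
    unfolding s_def using shift_i[of "t n *\<^sub>R e"] gi
    by (simp add: Bochner_Integration.integral_diff shift)
  \<comment> \<open>The step sizes are at most 1, so all quotients vanish outside the ball of radius
    \<open>M + norm e\<close>, and the Lipschitz bound dominates them inside.\<close>
  have "(\<lambda>n. \<integral>x. s n x \<partial>lborel) \<longlonglongrightarrow> (\<integral>x. d x \<partial>lborel)"
  proof (rule integral_dominated_convergence
      [where w = "\<lambda>x. indicator (cball 0 (M + norm e)) x * (L * norm e)"])
    show "d \<in> borel_measurable lborel" using meas by simp
    show "s n \<in> borel_measurable lborel" for n
      unfolding s_def[abs_def] by measurable
    show "integrable lborel (\<lambda>x. indicator (cball (0::'a) (M + norm e)) x * (L * norm e))"
      by (intro integrable_mult_left integrable_real_indicator emeasure_bounded_finite) auto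
    show "AE x in lborel. (\<lambda>n. s n x) \<longlonglongrightarrow> d x"
      using lim unfolding s_def
      by eventually_elim (rule filterlim_compose[OF _ tlim])
    show "AE x in lborel. norm (s n x) \<le> indicator (cball 0 (M + norm e)) x * (L * norm e)" for n
    proof (rule AE_I2)
      fix x
      have "\<bar>g (x + t n *\<^sub>R e) - g x\<bar> \<le> L * norm e * t n"
        using lip[of "x + t n *\<^sub>R e" x] t0[of n] by (simp add: mult_ac)
      then have bd: "norm (s n x) \<le> L * norm e"
        using t0[of n] by (simp add: s_def divide_simps)
      have "s n x = 0" if "x \<notin> cball 0 (M + norm e)"
      proof -
        have n: "norm x > M + norm e" using that by simp
        have "norm x \<le> norm (x + t n *\<^sub>R e) + norm (t n *\<^sub>R e)"
          by (metis add_diff_cancel_right' norm_triangle_sub norm_triangle_ineq4)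
        moreover have "norm (t n *\<^sub>R e) \<le> norm e"
          using t0[of n] t1[of n] by (simp add: mult_left_le_one_le)
        ultimately have "M < norm (x + t n *\<^sub>R e)" using n by linarith
        moreover have "M < norm x" using n norm_ge_zero[of e] by linarith
        ultimately show ?thesis by (simp add: s_def supp)
      qed
      with bd show "norm (s n x) \<le> indicator (cball 0 (M + norm e)) x * (L * norm e)"
        by (auto simp: indicator_def)
    qed
  qed
  with s_int show ?thesis by (simp add: LIMSEQ_const_iff)
qed

text \<open>One constant for each ball about the origin, rather than for a neighbourhood of each
  point: products then cost only a bound on the ball, and every compact set lies in one
  ball.\<close>

definition boundedly_lipschitz ::
    "('a::real_normed_vector \<Rightarrow> 'b::metric_space) \<Rightarrow> bool" where
  "boundedly_lipschitz f \<longleftrightarrow> (\<forall>M. \<exists>L. L-lipschitz_on (cball 0 M) f)"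

lemma boundedly_lipschitz_imp_locally_lipschitz:
  assumes "boundedly_lipschitz f" shows "locally_lipschitz f"
  unfolding locally_lipschitz_def
proof
  fix x :: 'a
  obtain L where "L-lipschitz_on (cball 0 (norm x + 1)) f"
    using assms unfolding boundedly_lipschitz_def by blast
  moreover have "ball x 1 \<subseteq> cball 0 (norm x + 1)"
    by (auto simp: dist_norm) (smt (verit) norm_minus_commute norm_triangle_sub)
  ultimately show "\<exists>r>0. \<exists>L. L-lipschitz_on (ball x r) f"
    by (meson lipschitz_on_subset zero_less_one)
qed

lemma boundedly_lipschitz_imp_continuous:
  assumes "boundedly_lipschitz f" shows "continuous_on S f"
proof -
  have "continuous (at x) f" for x
  proof -
    obtain L where "L-lipschitz_on (cball 0 (norm x + 1)) f"
      using assms unfolding boundedly_lipschitz_def by blast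
    then have "continuous_on (ball 0 (norm x + 1)) f"
      by (meson lipschitz_on_continuous_on continuous_on_subset ball_subset_cball)
    then show ?thesis
      by (simp add: continuous_on_eq_continuous_at)
  qed
  then show ?thesis by (simp add: continuous_at_imp_continuous_on)
qed

lemma boundedly_lipschitz_bounded:
  fixes f :: "'a::real_normed_vector \<Rightarrow> 'b::real_normed_vector"
  assumes "boundedly_lipschitz f"
  shows "\<exists>c\<ge>0. \<forall>x. norm x \<le> M \<longrightarrow> norm (f x) \<le> c"
proof -
  obtain L where L: "L-lipschitz_on (cball 0 \<bar>M\<bar>) f"
    using assms unfolding boundedly_lipschitz_def by blast
  have "norm (f x) \<le> L * \<bar>M\<bar> + norm (f 0)" if "norm x \<le> M" for x
  proof -
    have "norm (f x - f 0) \<le> L * norm (x - 0)"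
      using that by (intro lipschitz_on_normD[OF L]) auto
    also have "\<dots> \<le> L * \<bar>M\<bar>"
      using that lipschitz_on_nonneg[OF L] by (intro mult_left_mono) auto
    finally show ?thesis by (smt (verit) norm_triangle_sub)
  qed
  moreover have "L * \<bar>M\<bar> + norm (f 0) \<ge> 0"
    using lipschitz_on_nonneg[OF L] by simp
  ultimately show ?thesis by blast
qed

lemma boundedly_lipschitz_const: "boundedly_lipschitz (\<lambda>x. c)"
  unfolding boundedly_lipschitz_def by (blast intro: lipschitz_on_constant)

lemma boundedly_lipschitz_linear:
  "bounded_linear f \<Longrightarrow> boundedly_lipschitz f"
  unfolding boundedly_lipschitz_def by (meson bounded_linear.lipschitz_boundE)

lemma boundedly_lipschitz_add:
  fixes f g :: "'a::real_normed_vector \<Rightarrow> 'b::real_normed_vector"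
  shows "boundedly_lipschitz f \<Longrightarrow> boundedly_lipschitz g \<Longrightarrow> boundedly_lipschitz (\<lambda>x. f x + g x)"
  unfolding boundedly_lipschitz_def by (blast intro: lipschitz_on_add)

lemma boundedly_lipschitz_compose_linear:
  assumes "bounded_linear g" "boundedly_lipschitz f"
  shows "boundedly_lipschitz (\<lambda>x. g (f x))"
  unfolding boundedly_lipschitz_def
proof
  fix M
  obtain L where "L-lipschitz_on (cball 0 M) f"
    using assms(2) unfolding boundedly_lipschitz_def by blast
  moreover obtain L' where "L'-lipschitz_on (f ` cball 0 M) g"
    using assms(1) by (meson bounded_linear.lipschitz_boundE)
  ultimately show "\<exists>L. L-lipschitz_on (cball 0 M) (\<lambda>x. g (f x))"
    by (blast dest: lipschitz_on_compose2)
qed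

lemma boundedly_lipschitz_diff:
  fixes f g :: "'a::real_normed_vector \<Rightarrow> 'b::real_normed_vector"
  shows "boundedly_lipschitz f \<Longrightarrow> boundedly_lipschitz g \<Longrightarrow> boundedly_lipschitz (\<lambda>x. f x - g x)"
  unfolding boundedly_lipschitz_def by (blast intro: lipschitz_on_diff)

lemma boundedly_lipschitz_norm:
  fixes f :: "'a::real_normed_vector \<Rightarrow> 'b::real_normed_vector"
  assumes "boundedly_lipschitz f"
  shows "boundedly_lipschitz (\<lambda>x. norm (f x))"
proof -
  have "L-lipschitz_on X (\<lambda>x. norm (f x))" if "L-lipschitz_on X f" for L X
    using that unfolding lipschitz_on_def dist_norm
    by (auto intro: order_trans[OF norm_triangle_ineq3])
  then show ?thesis using assms unfolding boundedly_lipschitz_def by blast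
qed

lemma boundedly_lipschitz_scaleR:
  fixes f :: "'a::real_normed_vector \<Rightarrow> real" and g :: "'a \<Rightarrow> 'b::real_normed_vector"
  assumes f: "boundedly_lipschitz f" and g: "boundedly_lipschitz g"
  shows "boundedly_lipschitz (\<lambda>x. f x *\<^sub>R g x)"
  unfolding boundedly_lipschitz_def
proof
  fix M
  obtain a b where ab: "a \<ge> 0" "b \<ge> 0"
    and a: "\<And>x. norm x \<le> M \<Longrightarrow> norm (f x) \<le> a" and b: "\<And>x. norm x \<le> M \<Longrightarrow> norm (g x) \<le> b"
    using boundedly_lipschitz_bounded[OF f, of M] boundedly_lipschitz_bounded[OF g, of M] by metis
  obtain K L where K: "K-lipschitz_on (cball 0 M) f" and L: "L-lipschitz_on (cball 0 M) g"
    using f g unfolding boundedly_lipschitz_def by metis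
  have "(a * L + b * K)-lipschitz_on (cball 0 M) (\<lambda>x. f x *\<^sub>R g x)"
  proof (rule lipschitz_onI)
    show "0 \<le> a * L + b * K"
      using ab lipschitz_on_nonneg[OF K] lipschitz_on_nonneg[OF L] by simp
    fix x y assume xy: "x \<in> cball (0::'a) M" "y \<in> cball (0::'a) M"
    have "f x *\<^sub>R g x - f y *\<^sub>R g y = f x *\<^sub>R (g x - g y) + (f x - f y) *\<^sub>R g y"
      by (simp add: algebra_simps)
    then have "norm (f x *\<^sub>R g x - f y *\<^sub>R g y) \<le> norm (f x) * norm (g x - g y) + norm (f x - f y) * norm (g y)"
      by (metis norm_scaleR norm_triangle_ineq real_norm_def)
    also have "\<dots> \<le> a * (L * norm (x - y)) + (K * norm (x - y)) * b"
      using xy ab by (intro add_mono mult_mono a b lipschitz_on_normD[OF K] lipschitz_on_normD[OF L])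
        (auto intro: mult_nonneg_nonneg lipschitz_on_nonneg[OF K])
    finally show "dist (f x *\<^sub>R g x) (f y *\<^sub>R g y) \<le> (a * L + b * K) * dist x y"
      by (simp add: dist_norm algebra_simps)
  qed
  then show "\<exists>L. L-lipschitz_on (cball 0 M) (\<lambda>x. f x *\<^sub>R g x)" by blast
qed

lemma boundedly_lipschitz_mult:
  fixes f g :: "'a::real_normed_vector \<Rightarrow> real"
  shows "boundedly_lipschitz f \<Longrightarrow> boundedly_lipschitz g \<Longrightarrow> boundedly_lipschitz (\<lambda>x. f x * g x)"
  using boundedly_lipschitz_scaleR[of f g] by simp

section \<open>Derivatives as limits of quotients, and integrability on balls\<close>

lemma has_derivative_imp_directional_limit:
  fixes f :: "'a::real_normed_vector \<Rightarrow> 'b::real_normed_vector"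
  assumes der: "(f has_derivative f') (at x)"
  shows "((\<lambda>t. (f (x + t *\<^sub>R v) - f x) /\<^sub>R t) \<longlongrightarrow> f' v) (at_right 0)"
proof -
  have "((\<lambda>t. f (x + t *\<^sub>R v)) has_derivative (\<lambda>t. f' (t *\<^sub>R v))) (at 0)"
    by (rule has_derivative_compose[where f = "\<lambda>t. x + t *\<^sub>R v" and g = f and g' = f'])
      (use der in \<open>auto intro!: derivative_eq_intros\<close>)
  moreover have "f' (t *\<^sub>R v) = t *\<^sub>R f' v" for t
    using has_derivative_bounded_linear[OF der] by (simp add: bounded_linear.linear linear_scale)
  ultimately have "((\<lambda>t. norm (f (x + t *\<^sub>R v) - f x - t *\<^sub>R f' v) / \<bar>t\<bar>) \<longlongrightarrow> 0) (at 0)"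
    by (simp add: has_derivative_iff_norm)
  moreover have "eventually (\<lambda>t. norm (f (x + t *\<^sub>R v) - f x - t *\<^sub>R f' v) / \<bar>t\<bar>
      = norm ((f (x + t *\<^sub>R v) - f x) /\<^sub>R t - f' v)) (at 0)"
    unfolding eventually_at_filter
  proof (intro always_eventually allI impI)
    fix t :: real assume t: "t \<noteq> 0"
    have "(f (x + t *\<^sub>R v) - f x) /\<^sub>R t - f' v = (f (x + t *\<^sub>R v) - f x - t *\<^sub>R f' v) /\<^sub>R t"
      using t by (simp add: algebra_simps)
    then show "norm (f (x + t *\<^sub>R v) - f x - t *\<^sub>R f' v) / \<bar>t\<bar>
      = norm ((f (x + t *\<^sub>R v) - f x) /\<^sub>R t - f' v)"
      by (simp only: norm_scaleR) (simp add: divide_inverse)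
  qed
  ultimately have "((\<lambda>t. norm ((f (x + t *\<^sub>R v) - f x) /\<^sub>R t - f' v)) \<longlongrightarrow> 0) (at 0)"
    by (simp cong: tendsto_cong)
  then have "((\<lambda>t. (f (x + t *\<^sub>R v) - f x) /\<^sub>R t) \<longlongrightarrow> f' v) (at 0)"
    by (simp add: tendsto_norm_zero_iff Lim_null[of _ "f' v"])
  then show ?thesis
    by (rule tendsto_mono[rotated]) (simp add: at_le)
qed

lemma norm_derivative_le_lipschitz:
  fixes f :: "'a::real_normed_vector \<Rightarrow> 'b::real_normed_vector"
  assumes der: "(f has_derivative f') (at x)" and lip: "L-lipschitz_on U f"
    and U: "open U" "x \<in> U"
  shows "norm (f' v) \<le> L * norm v"
proof -
  have "((\<lambda>t. norm ((f (x + t *\<^sub>R v) - f x) /\<^sub>R t)) \<longlongrightarrow> norm (f' v)) (at_right 0)"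
    by (intro tendsto_norm has_derivative_imp_directional_limit der)
  moreover have "eventually (\<lambda>t. norm ((f (x + t *\<^sub>R v) - f x) /\<^sub>R t) \<le> L * norm v) (at_right 0)"
  proof -
    have "((\<lambda>t. x + t *\<^sub>R v) \<longlongrightarrow> x + 0 *\<^sub>R v) (at_right 0)"
      by (intro tendsto_intros)
    then have "eventually (\<lambda>t. x + t *\<^sub>R v \<in> U) (at_right 0)"
      using U by (intro topological_tendstoD) auto
    moreover have "eventually (\<lambda>t::real. t > 0) (at_right 0)"
      by (simp add: eventually_at_right_less)
    ultimately show ?thesis
    proof eventually_elim
      case (elim t)
      have "norm (f (x + t *\<^sub>R v) - f x) \<le> L * norm v * t"
        using lipschitz_on_normD[OF lip elim(1) U(2)] elim(2) by (simp add: mult_ac)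
      with elim(2) show ?case by (simp add: divide_simps mult_ac)
    qed
  qed
  ultimately show ?thesis
    by (rule tendsto_upperbound) simp
qed

lemma integrable_bounded_on_cball:
  fixes f :: "'a::euclidean_space \<Rightarrow> real"
  assumes "f \<in> borel_measurable lebesgue" and "\<And>x. norm x \<le> M \<Longrightarrow> \<bar>f x\<bar> \<le> c"
    and "\<And>x. M < norm x \<Longrightarrow> f x = 0"
  shows "integrable lebesgue f"
proof (rule Bochner_Integration.integrable_bound)
  show "integrable lebesgue (\<lambda>x. indicator (cball (0::'a) M) x * c)"
    by (intro integrable_mult_left integrable_real_indicator) (use emeasure_bounded_finite[OF bounded_cball, of 0 M] in simp_all)
  show "AE x in lebesgue. norm (f x) \<le> norm (indicator (cball 0 M) x * c)"
  proof (rule AE_I2)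
    fix x
    show "norm (f x) \<le> norm (indicator (cball 0 M) x * c)"
      using assms(2,3)[of x] by (cases "norm x \<le> M") (auto simp: indicator_def)
  qed
qed (use assms in auto)

lemma borel_measurable_imp_lebesgue:
  "f \<in> borel_measurable borel \<Longrightarrow> f \<in> borel_measurable lebesgue"
  by (simp add: measurable_completion)

lemma Lp_loc_boundedI:
  assumes meas: "f \<in> borel_measurable lebesgue" and "p > 0"
    and bd: "\<And>M. \<exists>c. \<forall>x. norm x \<le> M \<longrightarrow> norm (f x) \<le> c"
  shows "Lp_loc p f"
  unfolding Lp_loc_def
proof (intro conjI allI impI meas)
  fix C :: "'a set" assume C: "compact C"
  then obtain M where M: "\<And>x. x \<in> C \<Longrightarrow> norm x \<le> M"
    using compact_imp_bounded[OF C] unfolding bounded_iff by blast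
  obtain c where c: "\<And>x. norm x \<le> M \<Longrightarrow> norm (f x) \<le> c" using bd by blast
  have Cm: "C \<in> sets lebesgue" using C by (simp add: compact_imp_closed)
  show "set_integrable lebesgue C (\<lambda>x. norm (f x) powr p)"
    unfolding set_integrable_def
  proof (rule integrable_bounded_on_cball)
    show "(\<lambda>x. indicat_real C x *\<^sub>R norm (f x) powr p) \<in> borel_measurable lebesgue"
      using meas Cm by measurable
    show "\<bar>indicat_real C x *\<^sub>R norm (f x) powr p\<bar> \<le> c powr p" if "norm x \<le> M" for x
      using c[OF that] \<open>p > 0\<close> by (auto simp: indicator_def intro!: powr_mono2)
    show "indicat_real C x *\<^sub>R norm (f x) powr p = 0" if "M < norm x" for x
      using M[of x] that by (auto simp: indicator_def)
  qed
qed

lemma norm_matrix_le_sum: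
  fixes A :: "real^'n^'m"
  shows "norm A \<le> (\<Sum>i\<in>UNIV. \<Sum>j\<in>UNIV. \<bar>A $ i $ j\<bar>)"
proof -
  have "norm A \<le> (\<Sum>i\<in>UNIV. norm (A $ i))"
    unfolding norm_vec_def[of A] by (rule L2_set_le_sum) simp
  also have "\<dots> \<le> (\<Sum>i\<in>UNIV. \<Sum>j\<in>UNIV. \<bar>A $ i $ j\<bar>)"
    by (intro sum_mono norm_le_l1_cart)
  finally show ?thesis .
qed

lemma borel_measurable_vec_componentsI:
  fixes f :: "'a \<Rightarrow> real^'n^'m"
  assumes "\<And>i j. (\<lambda>x. f x $ i $ j) \<in> borel_measurable M"
  shows "f \<in> borel_measurable M"
  using assms unfolding borel_measurable_euclidean_space[of f]
  by (auto simp: Basis_vec_def inner_axis)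

lemma matrix_vector_mult_axis_nth: "((A::real^'n^'m) *v axis j 1) $ i = A $ i $ j"
  by (simp add: matrix_vector_mult_basis column_def)

text \<open>The exceptional set is part of the data, so differentiability almost everywhere is read
  off rather than derived from the Lipschitz property. Closedness makes \<open>S\<close> Borel, and
  fixing \<open>D\<close> on \<open>S\<close> makes \<open>D\<close> a Borel function that is
  bounded on balls.\<close>

locale boundedly_lipschitz_ae_differentiable =
  fixes h :: "real^'n \<Rightarrow> real^'m" and D :: "real^'n \<Rightarrow> real^'n^'m" and S :: "(real^'n) set"
  assumes lip: "boundedly_lipschitz h"
    and S: "closed S" "negligible S"
    and der: "\<And>x. x \<notin> S \<Longrightarrow> (h has_derivative (\<lambda>v. D x *v v)) (at x)"
    and D0: "\<And>x. x \<in> S \<Longrightarrow> D x = 0"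
begin

lemma AE_not_S: "AE x in lborel. x \<notin> S"
proof (rule AE_I'[of S])
  have "S \<in> null_sets lebesgue" using S(2) negligible_iff_null_sets by blast
  then show "S \<in> null_sets lborel"
    using S(1) by (auto simp: null_sets_def)
qed auto

lemma h_measurable: "h \<in> borel_measurable borel"
  using boundedly_lipschitz_imp_continuous[OF lip] by (rule borel_measurable_continuous_onI)

text \<open>\<open>D\<close> is at every point the limit of difference quotients cut off by the
  indicator of the complement of \<open>S\<close>; on \<open>S\<close> the limit is right because of
  \<open>D0\<close>.\<close>

lemma D_measurable: "D \<in> borel_measurable borel"
proof (rule borel_measurable_vec_componentsI)
  fix i j
  let ?e = "axis j 1 :: real^'n"
  define t where "t n = inverse (real (Suc n))" for n
  have t0: "t n > 0" for n by (auto simp: t_def divide_simps)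
  have "t \<longlonglongrightarrow> 0"
    unfolding t_def by (rule LIMSEQ_inverse_real_of_nat)
  with t0 have tlim: "filterlim t (at_right 0) sequentially"
    by (intro tendsto_imp_filterlim_at_right) auto
  show "(\<lambda>x. D x $ i $ j) \<in> borel_measurable borel"
  proof (rule borel_measurable_LIMSEQ_real)
    show "(\<lambda>n. indicator (-S) x * ((h (x + t n *\<^sub>R ?e) - h x) /\<^sub>R t n) $ i) \<longlonglongrightarrow> D x $ i $ j" for x
    proof (cases "x \<in> S")
      case False
      have "(\<lambda>n. ((h (x + t n *\<^sub>R ?e) - h x) /\<^sub>R t n) $ i) \<longlonglongrightarrow> (D x *v ?e) $ i"
        by (intro tendsto_vec_nth filterlim_compose[OF has_derivative_imp_directional_limit tlim] der False)
      with False show ?thesis by (simp add: matrix_vector_mult_axis_nth)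
    qed (simp add: D0)
    have [measurable]: "S \<in> sets borel" using S by simp
    have cont: "continuous_on UNIV (\<lambda>x. ((h (x + t n *\<^sub>R ?e) - h x) /\<^sub>R t n) $ i)" for n
    proof -
      have "continuous_on UNIV (\<lambda>x. h (x + t n *\<^sub>R ?e))"
        by (rule continuous_on_compose2[OF boundedly_lipschitz_imp_continuous[OF lip, of UNIV]])
          (auto intro!: continuous_intros)
      then show ?thesis
        by (intro continuous_intros boundedly_lipschitz_imp_continuous[OF lip])
    qed
    show "(\<lambda>x. indicator (-S) x * ((h (x + t n *\<^sub>R ?e) - h x) /\<^sub>R t n) $ i) \<in> borel_measurable borel" for n
      by (intro borel_measurable_times borel_measurable_continuous_onI[OF cont]) measurable
  qed
qed

lemma D_bounded:
  obtains L where "L \<ge> 0" "\<And>x v. norm x < M \<Longrightarrow> norm (D x *v v) \<le> L * norm v"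
proof -
  obtain L where "L-lipschitz_on (cball 0 M) h"
    using lip unfolding boundedly_lipschitz_def by blast
  then have L: "L-lipschitz_on (ball 0 M) h"
    by (rule lipschitz_on_subset) auto
  have "norm (D x *v v) \<le> L * norm v" if "norm x < M" for x v
  proof (cases "x \<in> S")
    case False
    show ?thesis
      by (rule norm_derivative_le_lipschitz[OF der[OF False] L]) (use that in auto)
  qed (use lipschitz_on_nonneg[OF L] in \<open>simp add: D0\<close>)
  with lipschitz_on_nonneg[OF L] show thesis using that by blast
qed

lemma norm_D_bounded: "\<exists>c. \<forall>x. norm x \<le> M \<longrightarrow> norm (D x) \<le> c"
proof -
  \<comment> \<open>A Lipschitz constant on a ball bounds the derivative only at interior points,
    hence the radius \<open>M + 1\<close>.\<close>
  obtain L where L: "L \<ge> 0" "\<And>x v. norm x < M + 1 \<Longrightarrow> norm (D x *v v) \<le> L * norm v"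
    using D_bounded by blast
  have "norm (D x) \<le> (\<Sum>i\<in>(UNIV::'m set). \<Sum>j\<in>(UNIV::'n set). L)" if "norm x \<le> M" for x
  proof -
    have "\<bar>D x $ i $ j\<bar> \<le> L" for i j
      using component_le_norm_cart[of "D x *v axis j 1" i] L(2)[of x "axis j 1"] that
      by (simp add: matrix_vector_mult_axis_nth)
    then show ?thesis
      by (intro order_trans[OF norm_matrix_le_sum] sum_mono) auto
  qed
  then show ?thesis by blast
qed

lemma h_Lp_loc: assumes "p > 0" shows "Lp_loc p h"
proof (rule Lp_loc_boundedI[OF borel_measurable_imp_lebesgue[OF h_measurable] assms])
  fix M
  show "\<exists>c. \<forall>x. norm x \<le> M \<longrightarrow> norm (h x) \<le> c"
    using boundedly_lipschitz_bounded[OF lip] by blast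
qed

lemma D_Lp_loc: "p > 0 \<Longrightarrow> Lp_loc p D"
  by (rule Lp_loc_boundedI[OF borel_measurable_imp_lebesgue[OF D_measurable] _ norm_D_bounded])

text \<open>A component of \<open>h\<close> times \<phi> is Lipschitz with compact support, so its
  directional derivative integrates to zero; off \<open>S\<close> the product rule writes this
  derivative as the sum of the two integrands.\<close>

lemma integration_by_parts:
  assumes "test_function \<phi>"
  shows "(LINT x|lebesgue. h x $ i * partial_deriv j \<phi> x) = - (LINT x|lebesgue. D x $ i $ j * \<phi> x)"
proof -
  have "C_diff (Suc 0) \<phi>" using assms unfolding test_function_def by blast
  then have dif: "\<phi> differentiable (at x)" and pc: "continuous_on UNIV (partial_deriv k \<phi>)" for x k
    by (auto simp: differentiable_on_def)
  then have der\<phi>: "(\<phi> has_derivative frechet_derivative \<phi> (at x)) (at x)" for x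
    using frechet_derivative_works by blast
  have "bounded (closure {x. \<phi> x \<noteq> 0})"
    using assms compact_imp_bounded unfolding test_function_def by blast
  then obtain M where "\<And>x. x \<in> closure {x. \<phi> x \<noteq> 0} \<Longrightarrow> norm x \<le> M"
    unfolding bounded_iff by blast
  then have supp: "\<phi> x = 0" if "M < norm x" for x
    using that closure_subset[of "{x. \<phi> x \<noteq> 0}"] by fastforce
  have psupp: "partial_deriv k \<phi> x = 0" if "M < norm x" for x k
  proof -
    have "open {x::real^'n. M < norm x}" by (intro open_Collect_less continuous_intros)
    then have "(\<phi> has_derivative (\<lambda>_. 0)) (at x)"
      by (rule has_derivative_transform_within_open[OF has_derivative_const])
        (simp_all add: that supp)
    then have "frechet_derivative \<phi> (at x) = (\<lambda>_. 0)" by (rule frechet_derivative_at[symmetric])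
    then show ?thesis by (simp add: partial_deriv_def)
  qed
  have \<phi>_bl: "boundedly_lipschitz \<phi>"
    unfolding boundedly_lipschitz_def
  proof
    fix r :: real
    have "\<exists>c. \<forall>x\<in>cball 0 r. \<bar>partial_deriv k \<phi> x\<bar> \<le> c" for k
    proof -
      have "compact (partial_deriv k \<phi> ` cball 0 r)"
        by (intro compact_continuous_image continuous_on_subset[OF pc]) auto
      then show ?thesis using compact_imp_bounded by (force simp: bounded_iff)
    qed
    then obtain c where c: "\<And>k x. norm x \<le> r \<Longrightarrow> \<bar>partial_deriv k \<phi> x\<bar> \<le> c k"
      unfolding mem_cball_0[symmetric] by metis
    have "\<bar>frechet_derivative \<phi> (at x) v\<bar> \<le> (\<Sum>k\<in>UNIV. \<bar>c k\<bar>) * norm v" if "norm x \<le> r" for x v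
    proof -
      have lin: "linear (frechet_derivative \<phi> (at x))"
        using dif linear_frechet_derivative by blast
      have "frechet_derivative \<phi> (at x) v = frechet_derivative \<phi> (at x) (\<Sum>k\<in>UNIV. v $ k *\<^sub>R axis k 1)"
        by (simp add: basis_expansion scalar_mult_eq_scaleR[symmetric])
      also have "\<dots> = (\<Sum>k\<in>UNIV. v $ k * partial_deriv k \<phi> x)"
        using lin by (simp add: linear_sum linear_scale partial_deriv_def)
      finally have "\<bar>frechet_derivative \<phi> (at x) v\<bar> \<le> (\<Sum>k\<in>UNIV. \<bar>v $ k * partial_deriv k \<phi> x\<bar>)"
        by simp
      also have "\<dots> \<le> (\<Sum>k\<in>UNIV. \<bar>c k\<bar> * norm v)"
      proof (rule sum_mono)
        fix k
        have "\<bar>v $ k\<bar> \<le> norm v" by (rule component_le_norm_cart)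
        moreover have "\<bar>partial_deriv k \<phi> x\<bar> \<le> \<bar>c k\<bar>" using c[OF that, of k] by linarith
        ultimately show "\<bar>v $ k * partial_deriv k \<phi> x\<bar> \<le> \<bar>c k\<bar> * norm v"
          by (simp add: abs_mult mult.commute[of "\<bar>c k\<bar>"] mult_mono)
      qed
      finally show ?thesis by (simp add: sum_distrib_right)
    qed
    then have "(\<Sum>k\<in>UNIV. \<bar>c k\<bar>)-lipschitz_on (cball 0 r) \<phi>"
      by (intro bounded_derivative_imp_lipschitz[where f' = "\<lambda>x. frechet_derivative \<phi> (at x)"])
        (auto intro!: has_derivative_at_withinI[OF der\<phi>] onorm_le sum_nonneg)
    then show "\<exists>L. L-lipschitz_on (cball 0 r) \<phi>" by blast
  qed
  let ?g = "\<lambda>x. h x $ i * \<phi> x"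
  have g_bl: "boundedly_lipschitz ?g"
    by (intro boundedly_lipschitz_mult \<phi>_bl
        boundedly_lipschitz_compose_linear[OF bounded_linear_vec_nth lip])
  obtain L where L: "L-lipschitz_on (cball 0 (M + 1)) ?g"
    using g_bl unfolding boundedly_lipschitz_def by blast
  obtain c where c: "c \<ge> 0" "\<And>x. norm x \<le> M + 1 \<Longrightarrow> \<bar>?g x\<bar> \<le> c"
    using boundedly_lipschitz_bounded[OF g_bl, of "M + 1"] unfolding real_norm_def by blast
  \<comment> \<open>The product vanishes outside the ball of radius \<open>M\<close>. A point
    \<open>y\<close> beyond radius \<open>M + 1\<close> has distance at least 1 from
    \<open>x\<close>, so there the bound \<open>c\<close> on the values serves as a Lipschitz
    bound.\<close>
  have glip1: "\<bar>?g x - ?g y\<bar> \<le> (L + c) * norm (x - y)" if "norm x \<le> M" for x y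
  proof (cases "norm y \<le> M + 1")
    case True
    then have "\<bar>?g x - ?g y\<bar> \<le> L * norm (x - y)"
      using lipschitz_on_normD[OF L, of x y] that by simp
    with c show ?thesis by (simp add: distrib_right add_increasing2)
  next
    case False
    then have "1 \<le> norm (x - y)" using that norm_triangle_ineq2[of y x] by (simp add: norm_minus_commute)
    then have "c * 1 \<le> (L + c) * norm (x - y)"
      using c lipschitz_on_nonneg[OF L] by (intro mult_mono) auto
    then show ?thesis using c(2)[of x] that False supp[of y] by auto
  qed
  have glip: "\<bar>?g x - ?g y\<bar> \<le> (L + c) * norm (x - y)" for x y
  proof -
    have "0 \<le> (L + c) * norm (x - y)" using c lipschitz_on_nonneg[OF L] by simp
    then show ?thesis
      using glip1[of x y] glip1[of y x] supp[of x] supp[of y]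
      by (cases "norm x \<le> M"; cases "norm y \<le> M") (auto simp: norm_minus_commute abs_minus_commute not_le)
  qed
  let ?d = "\<lambda>x. D x $ i $ j * \<phi> x + h x $ i * partial_deriv j \<phi> x"
  have \<phi>m[measurable]: "\<phi> \<in> borel_measurable borel"
    using boundedly_lipschitz_imp_continuous[OF \<phi>_bl] by (rule borel_measurable_continuous_onI)
  have pm[measurable]: "partial_deriv j \<phi> \<in> borel_measurable borel"
    using pc by (rule borel_measurable_continuous_onI)
  have hm[measurable]: "(\<lambda>x. h x $ i) \<in> borel_measurable borel"
    using boundedly_lipschitz_imp_continuous[OF lip]
    by (intro borel_measurable_continuous_onI continuous_intros)
  have Dm[measurable]: "(\<lambda>x. D x $ i $ j) \<in> borel_measurable borel"
  proof -
    have "(\<lambda>x. D x \<bullet> axis i (axis j 1)) \<in> borel_measurable borel"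
      using D_measurable by measurable
    then show ?thesis by (simp add: inner_axis)
  qed
  have "(\<integral>x. ?d x \<partial>lborel) = 0"
  proof (rule integral_directional_derivative_eq_0[OF glip])
    show "?g x = 0" if "M < norm x" for x using supp that by simp
    show "?d \<in> borel_measurable borel" by measurable
    show "AE x in lborel. ((\<lambda>t. (?g (x + t *\<^sub>R axis j 1) - ?g x) / t) \<longlongrightarrow> ?d x) (at_right 0)"
      using AE_not_S
    proof eventually_elim
      case (elim x)
      have "((\<lambda>x. h x $ i) has_derivative (\<lambda>v. (D x *v v) $ i)) (at x)"
        using bounded_linear.has_derivative[OF bounded_linear_vec_nth der[OF elim]] .
      then have "(?g has_derivative (\<lambda>v. h x $ i * frechet_derivative \<phi> (at x) v + (D x *v v) $ i * \<phi> x)) (at x)"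
        by (rule has_derivative_mult[OF _ der\<phi>])
      from has_derivative_imp_directional_limit[OF this, of "axis j 1"]
      show ?case
        by (simp add: partial_deriv_def matrix_vector_mult_axis_nth divide_inverse mult.commute add.commute)
    qed
  qed
  then have "(LINT x|lebesgue. ?d x) = 0"
    by (subst integral_completion) (auto intro!: borel_measurable_add borel_measurable_times)
  moreover have "integrable lebesgue (\<lambda>x. D x $ i $ j * \<phi> x)"
  proof -
    obtain a where a: "\<And>x. norm x \<le> M \<Longrightarrow> norm (D x) \<le> a" using norm_D_bounded by blast
    obtain b where b: "b \<ge> 0" "\<And>x. norm x \<le> M \<Longrightarrow> \<bar>\<phi> x\<bar> \<le> b"
      using boundedly_lipschitz_bounded[OF \<phi>_bl, of M] unfolding real_norm_def by blast
    show ?thesis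
    proof (rule integrable_bounded_on_cball[of _ M "a * b"])
      show "(\<lambda>x. D x $ i $ j * \<phi> x) \<in> borel_measurable lebesgue"
        by (rule borel_measurable_imp_lebesgue) measurable
      show "\<bar>D x $ i $ j * \<phi> x\<bar> \<le> a * b" if "norm x \<le> M" for x
      proof -
        have "\<bar>D x $ i $ j\<bar> \<le> a"
          using component_le_norm_cart[of "D x $ i" j] Finite_Cartesian_Product.norm_nth_le[of "D x" i] a[OF that] by linarith
        then show ?thesis using b(2)[OF that] by (simp add: abs_mult mult_mono')
      qed
    qed (simp add: supp)
  qed
  moreover have "integrable lebesgue (\<lambda>x. h x $ i * partial_deriv j \<phi> x)"
  proof -
    obtain a where a: "a \<ge> 0" "\<And>x. norm x \<le> M \<Longrightarrow> norm (h x) \<le> a"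
      using boundedly_lipschitz_bounded[OF lip, of M] by blast
    have "compact (partial_deriv j \<phi> ` cball 0 M)"
      by (intro compact_continuous_image continuous_on_subset[OF pc]) auto
    then obtain b where b: "\<And>x. norm x \<le> M \<Longrightarrow> \<bar>partial_deriv j \<phi> x\<bar> \<le> b"
      using compact_imp_bounded by (force simp: bounded_iff)
    show ?thesis
    proof (rule integrable_bounded_on_cball[of _ M "a * b"])
      show "(\<lambda>x. h x $ i * partial_deriv j \<phi> x) \<in> borel_measurable lebesgue"
        by (rule borel_measurable_imp_lebesgue) measurable
      show "\<bar>h x $ i * partial_deriv j \<phi> x\<bar> \<le> a * b" if "norm x \<le> M" for x
        using component_le_norm_cart[of "h x" i] a(2)[OF that] b[OF that]
        by (simp add: abs_mult mult_mono')
    qed (simp add: psupp)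
  qed
  ultimately show ?thesis by simp
qed

lemma W1_loc: "p > 0 \<Longrightarrow> W1_loc p h D"
  unfolding W1_loc_def weak_derivative_def
  using integration_by_parts h_Lp_loc D_Lp_loc zero_less_one by blast

end

section \<open>The map\<close>

lemma norm_real3_sq: "(norm (X :: real^3))\<^sup>2 = (X$1)\<^sup>2 + (X$2)\<^sup>2 + (X$3)\<^sup>2"
  by (simp add: norm_vec_def L2_set_def sum_3)

text \<open>The value at 0 is 0, so the inversion is an involution of the whole space.\<close>

definition inversion :: "'a::real_inner \<Rightarrow> 'a" where
  "inversion Y = Y /\<^sub>R (norm Y)\<^sup>2"

lemma norm_inversion: "norm (inversion Y) = inverse (norm Y)"
  by (simp add: inversion_def power2_eq_square field_simps)

lemma inversion_inversion [simp]: "inversion (inversion Y) = Y"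
proof (cases "Y = 0")
  case False
  then show ?thesis
    unfolding inversion_def[of "inversion Y"] norm_inversion
    by (simp add: inversion_def power_inverse)
qed (simp add: inversion_def)

lemma norm_inversion_diff:
  assumes "Y \<noteq> 0" "Z \<noteq> 0"
  shows "norm (inversion Y - inversion Z) = norm (Y - Z) / (norm Y * norm Z)"
proof (rule power2_eq_imp_eq)
  define a b c where "a = Y \<bullet> Y" and "b = Z \<bullet> Z" and "c = Y \<bullet> Z"
  have ab: "a > 0" "b > 0" using assms by (auto simp: a_def b_def)
  have "(norm (inversion Y - inversion Z))\<^sup>2 = (a / a\<^sup>2 - 2 * c / (a * b) + b / b\<^sup>2)"
    unfolding inversion_def power2_norm_eq_inner a_def b_def c_def
    by (simp add: inner_diff inner_commute power2_eq_square divide_inverse)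
  also have "\<dots> = (a - 2 * c + b) / (a * b)"
    using ab by (simp add: field_simps power2_eq_square)
  also have "\<dots> = (norm (Y - Z) / (norm Y * norm Z))\<^sup>2"
    unfolding power_divide power_mult_distrib power2_norm_eq_inner a_def b_def c_def
    by (simp add: inner_diff inner_commute)
  finally show "(norm (inversion Y - inversion Z))\<^sup>2 = (norm (Y - Z) / (norm Y * norm Z))\<^sup>2" .
qed auto

text \<open>Here \<open>zre + i zim\<close> is \<open>\<zeta>\<close> and \<open>zabs\<close> is \<open>R\<close>. Since \<open>tan (\<alpha>/2) = Im a / (\<bar>a\<bar> + Re a)\<close> for
  \<open>\<alpha> = arg a\<close>, the denominators of \<open>u\<close> and \<open>v\<close> are \<open>hslit\<close>, which vanishes on the half-plane, and
  \<open>dslit\<close>, which vanishes on the disc and on the \<open>z\<close>-axis.\<close>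

definition rad :: "real^3 \<Rightarrow> real" where "rad X = sqrt ((X$1)\<^sup>2 + (X$2)\<^sup>2)"
definition zre :: "real^3 \<Rightarrow> real" where "zre X = (X$1)\<^sup>2 + (X$2)\<^sup>2 - (X$3)\<^sup>2 - 1"
definition zim :: "real^3 \<Rightarrow> real" where "zim X = 2 * rad X * X$3"
definition zabs :: "real^3 \<Rightarrow> real" where "zabs X = sqrt ((zre X)\<^sup>2 + (zim X)\<^sup>2)"
definition hslit :: "real^3 \<Rightarrow> real" where "hslit X = rad X + X$1"
definition dslit :: "real^3 \<Rightarrow> real" where "dslit X = zabs X + zre X"
definition ucoord :: "real^3 \<Rightarrow> real" where "ucoord X = X$2 / (hslit X * rad X)"
definition vcoord :: "real^3 \<Rightarrow> real" where "vcoord X = zim X / dslit X"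
definition slits :: "(real^3) set" where "slits = {X. hslit X = 0 \<or> dslit X = 0}"

definition sphmap :: "real \<Rightarrow> real \<Rightarrow> real \<Rightarrow> real^3" where
  "sphmap R u v = (R / (1 + u\<^sup>2 + v\<^sup>2)) *\<^sub>R vector [1 - u\<^sup>2 - v\<^sup>2, 2 * u, 2 * v]"

definition hmap :: "real^3 \<Rightarrow> real^3" where
  "hmap X = (if X \<in> slits then - (zabs X *\<^sub>R e_x) else sphmap (zabs X) (ucoord X) (vcoord X))"

lemma rad_nonneg [simp]: "0 \<le> rad X" by (simp add: rad_def)
lemma rad_sq: "(rad X)\<^sup>2 = (X$1)\<^sup>2 + (X$2)\<^sup>2" by (simp add: rad_def)
lemma zabs_nonneg [simp]: "0 \<le> zabs X" by (simp add: zabs_def)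
lemma zabs_sq: "(zabs X)\<^sup>2 = (zre X)\<^sup>2 + (zim X)\<^sup>2" by (simp add: zabs_def)
lemma zre_rad: "zre X = (rad X)\<^sup>2 - (X$3)\<^sup>2 - 1" by (simp add: zre_def rad_sq)

lemma abs_le_rad: "\<bar>X$1\<bar> \<le> rad X" "\<bar>X$2\<bar> \<le> rad X"
  unfolding rad_def by (rule real_le_rsqrt; simp)+

lemma abs_le_zabs: "\<bar>zre X\<bar> \<le> zabs X" "\<bar>zim X\<bar> \<le> zabs X"
  unfolding zabs_def by (rule real_le_rsqrt; simp)+

lemma hslit_nonneg [simp]: "0 \<le> hslit X" using abs_le_rad(1)[of X] by (simp add: hslit_def)
lemma dslit_nonneg [simp]: "0 \<le> dslit X" using abs_le_zabs(1)[of X] by (simp add: dslit_def)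

text \<open>Difference of squares. For negative x the sum \<open>rad X + X$1\<close> suffers
  cancellation, and its size and its zeros are read off from y^2 instead. \<open>dslit_conj\<close>
  does the same for \<zeta>.\<close>

lemma hslit_conj: "hslit X * (rad X - X$1) = (X$2)\<^sup>2"
  using rad_sq[of X] by (simp add: hslit_def algebra_simps power2_eq_square)

lemma dslit_conj: "dslit X * (zabs X - zre X) = (zim X)\<^sup>2"
  using zabs_sq[of X] by (simp add: dslit_def algebra_simps power2_eq_square)

lemma hslit_le: "hslit X \<le> 2 * rad X" using abs_le_rad(1)[of X] by (simp add: hslit_def)
lemma dslit_le: "dslit X \<le> 2 * zabs X" using abs_le_zabs(1)[of X] by (simp add: dslit_def)

lemma off_slits:
  assumes "X \<notin> slits"
  shows "0 < hslit X" "0 < dslit X" "0 < rad X" "0 < zabs X"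
proof -
  show "0 < hslit X" "0 < dslit X"
    using assms hslit_nonneg[of X] dslit_nonneg[of X] by (auto simp: slits_def less_le)
  then show "0 < rad X" "0 < zabs X" using hslit_le[of X] dslit_le[of X] by linarith+
qed

text \<open>This is |w^2 - 1|^2 expanded, where |w| = \<open>norm X\<close> and Re(w^2) is the
  bracket.\<close>

lemma zabs_sq_norm: "(zabs X)\<^sup>2 = (norm X)^4 - 2 * ((rad X)\<^sup>2 - (X$3)\<^sup>2) + 1"
proof -
  have "(norm X)\<^sup>2 = (rad X)\<^sup>2 + (X$3)\<^sup>2" by (simp add: norm_real3_sq rad_sq)
  then have "(norm X)^4 = ((rad X)\<^sup>2 + (X$3)\<^sup>2)\<^sup>2"
    by (metis power_even_eq mult_2 numeral_Bit0)
  then show ?thesis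
    unfolding zabs_sq zim_def zre_rad by (simp add: power2_eq_square algebra_simps)
qed

text \<open>The triangle inequality |w^2| - 1 \<le> |w^2 - 1|. Since \<open>zabs X\<close> is the
  norm of the image, it keeps preimages of bounded sets bounded.\<close>

lemma zabs_ge: "(norm X)\<^sup>2 - 1 \<le> zabs X"
proof (rule power2_le_imp_le[OF _ zabs_nonneg])
  have "(norm X)\<^sup>2 = (rad X)\<^sup>2 + (X$3)\<^sup>2" by (simp add: norm_real3_sq rad_sq)
  moreover have "((norm X)\<^sup>2 - 1)\<^sup>2 = (norm X)^4 - 2 * (norm X)\<^sup>2 + 1"
    by (simp add: power2_diff)
  ultimately show "((norm X)\<^sup>2 - 1)\<^sup>2 \<le> (zabs X)\<^sup>2"
    unfolding zabs_sq_norm by simp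
qed

text \<open>\<open>zabs\<close> vanishes only on the unit circle in the plane z = 0, so it can
  dominate |z|. This trades a factor 1/R for 1/|z| in the bound for the inverse Jacobian.\<close>

lemma zabs_ge_third: "2 * (X$3)\<^sup>2 \<le> (zabs X)\<^sup>2"
proof -
  have "(zabs X)\<^sup>2 = ((rad X)\<^sup>2 - 1)\<^sup>2 + 2 * (rad X * X$3)\<^sup>2 + ((X$3)\<^sup>2)\<^sup>2 + 2 * (X$3)\<^sup>2"
    unfolding zabs_sq zim_def zre_rad by (simp add: power2_eq_square algebra_simps)
  then show ?thesis using zero_le_power2 by (smt (verit))
qed

text \<open>Says that 1/\<rho>^2 \<le> 4 (1 + v^2), that is, v grows at least like 1/\<rho> at the
  z-axis. This compares the unequal first coordinates of the two planar parts. For \<rho> \<ge> 1/2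
  the factor 8 makes the trivial bound \<open>dslit_le\<close> sufficient.\<close>

lemma dslit_le_rad: "dslit X \<le> 8 * zabs X * (rad X)\<^sup>2"
proof (cases "rad X \<ge> 1/2")
  case True
  then have "(1/2)\<^sup>2 \<le> (rad X)\<^sup>2" by (intro power_mono) auto
  then have "2 * zabs X \<le> 8 * zabs X * (rad X)\<^sup>2"
    using mult_left_mono[of 2 "8 * (rad X)\<^sup>2" "zabs X"] by (simp add: power2_eq_square mult_ac)
  then show ?thesis using dslit_le[of X] by linarith
next
  case False
  then have "(rad X)\<^sup>2 \<le> (1/2)\<^sup>2" by (intro power_mono) auto
  \<comment> \<open>Close to the axis Re \<zeta> is negative, so \<open>zabs X - zre X\<close> is
    bounded away from 0, and \<open>dslit_conj\<close> shows that \<open>dslit X\<close> is of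
    second order in \<rho>.\<close>
  then have q: "(X$3)\<^sup>2 + 3/4 \<le> - zre X" by (simp add: zre_rad power2_eq_square)
  then have R: "(X$3)\<^sup>2 + 3/4 \<le> zabs X" using abs_le_zabs(1)[of X] by linarith
  have z: "0 \<le> (X$3)\<^sup>2" by simp
  have pos: "zabs X - zre X > 0" using q R z by linarith
  have "(X$3)\<^sup>2 \<le> 2 * (((X$3)\<^sup>2 + 3/4) * ((X$3)\<^sup>2 + 3/4))"
    using z by (simp add: algebra_simps)
  also have "\<dots> \<le> 2 * (zabs X * (zabs X - zre X))"
    using q R z by (intro mult_left_mono mult_mono; linarith)
  finally have "4 * (rad X)\<^sup>2 * (X$3)\<^sup>2 \<le> 4 * (rad X)\<^sup>2 * (2 * (zabs X * (zabs X - zre X)))"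
    by (intro mult_left_mono) auto
  then have "dslit X * (zabs X - zre X) \<le> (8 * zabs X * (rad X)\<^sup>2) * (zabs X - zre X)"
    unfolding dslit_conj zim_def by (simp add: algebra_simps power_mult_distrib)
  then show ?thesis using pos by simp
qed

text \<open>\<open>dfold X\<close> is (|\<zeta>| + \<zeta>) / 2, \<open>hfold X\<close> is R
  (|\<xi>| + \<xi>) / 2 and \<open>invmap X\<close> is Y. The first carries the circle |\<zeta>| = R
  to the circle with diameter from 0 to R, and \<zeta> = -R, the cut, to 0; the second treats \<xi>
  likewise.\<close>

definition dfold :: "real^3 \<Rightarrow> complex" where
  "dfold X = Complex (dslit X / 2) (zim X / 2)"
definition hfold :: "real^3 \<Rightarrow> complex" where
  "hfold X = Complex (zabs X * hslit X / 2) (zabs X * X$2 / 2)"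
definition invmap :: "real^3 \<Rightarrow> real^3" where
  "invmap X = (1 / zabs X) *\<^sub>R vector [1, ucoord X, vcoord X]"

text \<open>The half-angle identity 1 + tan^2(\<psi>/2) = 2 / (1 + cos \<psi>) with cos \<psi> =
  \<open>zre X / zabs X\<close>. The next lemma is the same for \<theta>, where tan(\<theta>/2) is
  \<open>rad X * ucoord X\<close>.\<close>

lemma one_plus_vcoord_sq:
  assumes "X \<notin> slits" shows "1 + (vcoord X)\<^sup>2 = 2 * zabs X / dslit X"
proof -
  have "(zim X)\<^sup>2 / (dslit X)\<^sup>2 = (zabs X - zre X) / dslit X"
    using off_slits[OF assms] unfolding dslit_conj[symmetric] by (simp add: power2_eq_square)
  moreover have "1 + (zabs X - zre X) / dslit X = 2 * zabs X / dslit X"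
    using off_slits[OF assms] by (simp add: field_simps) (simp add: dslit_def)
  ultimately show ?thesis by (simp add: vcoord_def power_divide)
qed

lemma one_plus_ucoord_sq:
  assumes "X \<notin> slits" shows "1 + (rad X * ucoord X)\<^sup>2 = 2 * rad X / hslit X"
proof -
  have "rad X * ucoord X = X$2 / hslit X" using off_slits[OF assms] by (simp add: ucoord_def)
  then have "(rad X * ucoord X)\<^sup>2 = (X$2)\<^sup>2 / (hslit X)\<^sup>2" by (simp add: power_divide)
  then have "(rad X * ucoord X)\<^sup>2 = (rad X - X$1) / hslit X"
    using off_slits[OF assms] unfolding hslit_conj[symmetric] by (simp add: power2_eq_square)
  moreover have "1 + (rad X - X$1) / hslit X = 2 * rad X / hslit X"
    using off_slits[OF assms] by (simp add: field_simps) (simp add: hslit_def)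
  ultimately show ?thesis by simp
qed

text \<open>In polar form \<open>dfold X\<close> is R cos(\<psi>/2) e^(i\<psi>/2), so its reciprocal
  is (1 - i tan(\<psi>/2)) / R.\<close>

lemma inverse_dfold:
  assumes "X \<notin> slits"
  shows "inverse (dfold X) = Complex (1 / zabs X) (- vcoord X / zabs X)"
proof (rule inverse_unique)
  note pos = off_slits[OF assms]
  have v: "dslit X * vcoord X = zim X" using pos by (simp add: vcoord_def)
  have "dslit X * (1 + (vcoord X)\<^sup>2) = 2 * zabs X"
    using pos by (simp add: one_plus_vcoord_sq[OF assms])
  then have "dslit X + zim X * vcoord X = 2 * zabs X"
    by (simp add: distrib_left power2_eq_square mult.assoc[symmetric] v)
  then show "dfold X * Complex (1 / zabs X) (- vcoord X / zabs X) = 1"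
    using pos v by (simp add: dfold_def complex_eq_iff field_simps)
qed

lemma inverse_hfold:
  assumes "X \<notin> slits"
  shows "inverse (hfold X) = Complex (1 / (zabs X * rad X)) (- ucoord X / zabs X)"
proof (rule inverse_unique)
  note pos = off_slits[OF assms]
  have u: "hslit X * rad X * ucoord X = X$2" using pos by (simp add: ucoord_def)
  have "hslit X * (1 + (rad X * ucoord X)\<^sup>2) = 2 * rad X"
    using pos by (simp add: one_plus_ucoord_sq[OF assms])
  then have "hslit X + (hslit X * rad X * ucoord X) * (rad X * ucoord X) = 2 * rad X"
    by (simp add: distrib_left power2_eq_square mult_ac)
  then have "hslit X + X$2 * (rad X * ucoord X) = 2 * rad X" by (simp only: u)
  then have 1: "hslit X / (2 * rad X) + X$2 * ucoord X / 2 = 1"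
    using pos by (simp add: field_simps)
  have 2: "hslit X * ucoord X = X$2 / rad X" using u pos by (simp add: field_simps)
  show "hfold X * Complex (1 / (zabs X * rad X)) (- ucoord X / zabs X) = 1"
    using pos 1 2 by (simp add: hfold_def complex_eq_iff)
qed

lemma invmap_nz: "X \<notin> slits \<Longrightarrow> invmap X \<noteq> 0"
  using off_slits[of X] by (simp add: invmap_def vec_eq_iff forall_3)

lemma norm_invmap_sq:
  assumes "X \<notin> slits"
  shows "(norm (invmap X))\<^sup>2 = (1 + (ucoord X)\<^sup>2 + (vcoord X)\<^sup>2) / (zabs X)\<^sup>2"
  by (simp add: norm_real3_sq invmap_def power_divide add_divide_distrib)

lemma inverse_norm_dfold_le:
  assumes "X \<notin> slits" shows "inverse (norm (dfold X)) \<le> norm (invmap X)"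
proof (rule power2_le_imp_le)
  have "(inverse (norm (dfold X)))\<^sup>2 = (1 + (vcoord X)\<^sup>2) / (zabs X)\<^sup>2"
    by (simp add: norm_inverse[symmetric] inverse_dfold[OF assms] cmod_power2 power_divide add_divide_distrib
        del: norm_inverse)
  also have "\<dots> \<le> (norm (invmap X))\<^sup>2"
    unfolding norm_invmap_sq[OF assms] by (intro divide_right_mono) auto
  finally show "(inverse (norm (dfold X)))\<^sup>2 \<le> (norm (invmap X))\<^sup>2" .
qed simp

lemma inverse_norm_hfold_le:
  assumes "X \<notin> slits" shows "inverse (norm (hfold X)) \<le> 2 * norm (invmap X)"
proof (rule power2_le_imp_le)
  note pos = off_slits[OF assms]
  \<comment> \<open>Since 1 + v^2 = 2 R / \<open>dslit X\<close>, this is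
    \<open>dslit_le_rad\<close> rewritten. The square root of 4 is the factor 2 of the
    lemma.\<close>
  have "1 / (rad X)\<^sup>2 \<le> 4 * (1 + (vcoord X)\<^sup>2)"
    using dslit_le_rad[of X] pos by (simp add: one_plus_vcoord_sq[OF assms] field_simps)
  then have "1 / (rad X)\<^sup>2 + (ucoord X)\<^sup>2 \<le> 4 * (1 + (ucoord X)\<^sup>2 + (vcoord X)\<^sup>2)"
    by (smt (verit) zero_le_power2)
  then have le: "(1 / (rad X)\<^sup>2 + (ucoord X)\<^sup>2) / (zabs X)\<^sup>2
      \<le> (4 * (1 + (ucoord X)\<^sup>2 + (vcoord X)\<^sup>2)) / (zabs X)\<^sup>2"
    by (intro divide_right_mono) auto
  have "(inverse (norm (hfold X)))\<^sup>2 = (1 / (rad X)\<^sup>2 + (ucoord X)\<^sup>2) / (zabs X)\<^sup>2"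
    by (simp add: norm_inverse[symmetric] inverse_hfold[OF assms] cmod_power2 power_divide
        power_mult_distrib add_divide_distrib mult.commute del: norm_inverse)
  also have "\<dots> \<le> (2 * norm (invmap X))\<^sup>2"
    using le by (simp add: power_mult_distrib norm_invmap_sq[OF assms])
  finally show "(inverse (norm (hfold X)))\<^sup>2 \<le> (2 * norm (invmap X))\<^sup>2" .
qed simp

lemma dslit_zero_imp: "dslit X = 0 \<Longrightarrow> dfold X = 0"
  using dslit_conj[of X] by (simp add: dfold_def complex_eq_iff)

lemma hslit_zero_imp: "hslit X = 0 \<Longrightarrow> hfold X = 0"
  using hslit_conj[of X] by (simp add: hfold_def complex_eq_iff)

lemma folds_nz: "X \<notin> slits \<Longrightarrow> dfold X \<noteq> 0 \<and> hfold X \<noteq> 0"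
  using off_slits[of X] by (simp add: dfold_def hfold_def complex_eq_iff)

text \<open>For fixed R the points Y fill the plane with first coordinate 1/R. Inversion maps it to
  the sphere with diameter from 0 to \<open>R *\<^sub>R e_x\<close>, without 0; doubled, this is the
  sphere of radius R about the origin, shifted by \<open>R *\<^sub>R e_x\<close>.\<close>

lemma hmap_plus:
  assumes "X \<notin> slits"
  shows "hmap X + zabs X *\<^sub>R e_x = 2 *\<^sub>R inversion (invmap X)"
proof -
  define n where "n = 1 + (ucoord X)\<^sup>2 + (vcoord X)\<^sup>2"
  note pos = off_slits[OF assms]
  have n: "n > 0" unfolding n_def by (simp add: add_pos_nonneg)
  have "zabs X / n * (1 - (ucoord X)\<^sup>2 - (vcoord X)\<^sup>2) + zabs X = 2 * zabs X / n"
    using n by (simp add: field_simps n_def)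
  moreover have "inversion (invmap X) = (zabs X / n) *\<^sub>R vector [1, ucoord X, vcoord X]"
    unfolding inversion_def norm_invmap_sq[OF assms] n_def[symmetric]
    using pos n by (simp add: invmap_def power2_eq_square)
  ultimately show ?thesis
    using assms by (simp add: hmap_def sphmap_def n_def[symmetric] vec_eq_iff forall_3)
qed

text \<open>Up to signs, the first and third coordinates of \<open>invmap X\<close> are the parts of
  \<open>inverse (dfold X)\<close>, and the second is the imaginary part of
  \<open>inverse (hfold X)\<close>.\<close>

lemma norm_invmap_diff_le:
  assumes "X \<notin> slits" "X' \<notin> slits"
  shows "norm (invmap X - invmap X') \<le> norm (inverse (dfold X) - inverse (dfold X'))
     + norm (inverse (hfold X) - inverse (hfold X'))"
proof (rule power2_le_imp_le)
  let ?a = "norm (inverse (dfold X) - inverse (dfold X'))"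
  let ?b = "norm (inverse (hfold X) - inverse (hfold X'))"
  have "(norm (invmap X - invmap X'))\<^sup>2 \<le> ?a\<^sup>2 + ?b\<^sup>2"
    unfolding inverse_dfold[OF assms(1)] inverse_dfold[OF assms(2)] inverse_hfold[OF assms(1)]
      inverse_hfold[OF assms(2)] norm_real3_sq invmap_def cmod_power2
    by (simp add: power2_commute)
  also have "\<dots> \<le> (?a + ?b)\<^sup>2" by (simp add: power2_sum)
  finally show "(norm (invmap X - invmap X'))\<^sup>2 \<le> (?a + ?b)\<^sup>2" .
qed simp

text \<open>The shift moves the collapsed point of every sphere to 0, so continuity across the cuts
  becomes smallness of \<open>norm (offmap X)\<close>.\<close>

definition offmap :: "real^3 \<Rightarrow> real^3" where "offmap X = hmap X + zabs X *\<^sub>R e_x"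

lemma offmap_slits: "X \<in> slits \<Longrightarrow> offmap X = 0"
  by (simp add: offmap_def hmap_def)

lemma offmap_inversion: "X \<notin> slits \<Longrightarrow> offmap X = 2 *\<^sub>R inversion (invmap X)"
  by (simp add: offmap_def hmap_plus)

lemma norm_offmap_le:
  assumes "X \<notin> slits" shows "norm (offmap X) \<le> 2 * norm (dfold X)" "norm (offmap X) \<le> 4 * norm (hfold X)"
proof -
  have nz: "norm (invmap X) > 0" using invmap_nz[OF assms] by simp
  have nz2: "norm (dfold X) > 0" "norm (hfold X) > 0" using folds_nz[OF assms] by auto
  have n: "norm (offmap X) = 2 / norm (invmap X)"
    by (simp add: offmap_inversion[OF assms] norm_inversion divide_inverse)
  show "norm (offmap X) \<le> 2 * norm (dfold X)"
    using inverse_norm_dfold_le[OF assms] nz nz2 unfolding n by (simp add: field_simps)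
  show "norm (offmap X) \<le> 4 * norm (hfold X)"
    using inverse_norm_hfold_le[OF assms] nz nz2 unfolding n by (simp add: field_simps)
qed

lemma norm_inverse_diff_complex:
  fixes a b :: complex assumes "a \<noteq> 0" "b \<noteq> 0"
  shows "norm (inverse a - inverse b) = norm (a - b) * (inverse (norm a) * inverse (norm b))"
  using assms by (simp add: inverse_diff_inverse norm_mult norm_inverse norm_minus_commute mult_ac)

text \<open>Off the cuts both inversions, of Y and of the folds, multiply distances by reciprocals
  of norms. The reciprocals of the fold norms are at most 1 or 2 times
  \<open>norm (invmap X)\<close>, so the products of norms cancel, and the constants are 2 and 2 * 2
  * 2. At a point on a cut one of the folds is 0, and the bounds for \<open>norm (offmap X)\<close>
  apply.\<close>

lemma norm_offmap_diff_le:
  "norm (offmap X - offmap X') \<le> 2 * norm (dfold X - dfold X') + 8 * norm (hfold X - hfold X')"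
proof -
  have one: "norm (offmap X) \<le> 2 * norm (dfold X - dfold X') + 8 * norm (hfold X - hfold X')"
    if "X' \<in> slits" "X \<notin> slits" for X X'
  proof -
    have "dfold X' = 0 \<or> hfold X' = 0"
      using that(1) dslit_zero_imp hslit_zero_imp by (auto simp: slits_def)
    then show ?thesis
    proof
      assume "dfold X' = 0"
      then have "norm (offmap X) \<le> 2 * norm (dfold X - dfold X')" using norm_offmap_le[OF that(2)] by simp
      then show ?thesis by (simp add: add_increasing2)
    next
      assume "hfold X' = 0"
      then have "norm (offmap X) \<le> 4 * norm (hfold X - hfold X')" using norm_offmap_le[OF that(2)] by simp
      then show ?thesis using norm_ge_zero[of "dfold X - dfold X'"] norm_ge_zero[of "hfold X - hfold X'"] by linarith
    qed
  qed
  consider "X \<in> slits" "X' \<in> slits" | "X \<in> slits" "X' \<notin> slits" | "X \<notin> slits" "X' \<in> slits"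
    | "X \<notin> slits" "X' \<notin> slits" by blast
  then show ?thesis
  proof cases
    case 4
    let ?n = "norm (invmap X)" and ?n' = "norm (invmap X')"
    have nz: "?n > 0" "?n' > 0" using invmap_nz 4 by auto
    have "norm (offmap X - offmap X') = 2 * (norm (invmap X - invmap X') / (?n * ?n'))"
      unfolding offmap_inversion[OF 4(1)] offmap_inversion[OF 4(2)] scaleR_diff_right[symmetric]
      by (simp add: norm_inversion_diff[OF invmap_nz[OF 4(1)] invmap_nz[OF 4(2)]])
    also have "\<dots> \<le> 2 * ((norm (dfold X - dfold X') * (?n * ?n')
        + norm (hfold X - hfold X') * ((2 * ?n) * (2 * ?n'))) / (?n * ?n'))"
    proof (intro mult_left_mono divide_right_mono order_trans[OF norm_invmap_diff_le[OF 4]] add_mono)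
      show "norm (inverse (dfold X) - inverse (dfold X')) \<le> norm (dfold X - dfold X') * (?n * ?n')"
        using folds_nz 4 by (subst norm_inverse_diff_complex)
          ((intro mult_left_mono mult_mono inverse_norm_dfold_le 4)?; simp)+
      show "norm (inverse (hfold X) - inverse (hfold X')) \<le> norm (hfold X - hfold X') * ((2 * ?n) * (2 * ?n'))"
        using folds_nz 4 by (subst norm_inverse_diff_complex)
          ((intro mult_left_mono mult_mono inverse_norm_hfold_le 4)?; simp)+
    qed (use nz in auto)
    also have "\<dots> = 2 * norm (dfold X - dfold X') + 8 * norm (hfold X - hfold X')"
      using nz by (simp add: field_simps)
    finally show ?thesis .
  qed (use one[of X' X] one[of X X'] offmap_slits in \<open>auto simp: norm_minus_commute\<close>)
qed

section \<open>Lipschitz bounds on balls for the coordinates, the folds and the map\<close>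

lemma boundedly_lipschitz_nth: "boundedly_lipschitz (\<lambda>X::real^'n. X $ i)"
  by (intro boundedly_lipschitz_linear bounded_linear_vec_nth)

lemma boundedly_lipschitz_Complex:
  assumes f: "boundedly_lipschitz f" and g: "boundedly_lipschitz g"
  shows "boundedly_lipschitz (\<lambda>x. Complex (f x) (g x))"
proof -
  have "boundedly_lipschitz (\<lambda>x. f x *\<^sub>R 1 + g x *\<^sub>R \<i>)"
    by (intro boundedly_lipschitz_add boundedly_lipschitz_scaleR f g boundedly_lipschitz_const)
  moreover have "f x *\<^sub>R 1 + g x *\<^sub>R \<i> = Complex (f x) (g x)" for x
    by (simp add: complex_eq_iff)
  ultimately show ?thesis by simp
qed

lemma boundedly_lipschitz_sqrt_sum_squares:
  assumes "boundedly_lipschitz f" "boundedly_lipschitz g"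
  shows "boundedly_lipschitz (\<lambda>x. sqrt ((f x)\<^sup>2 + (g x)\<^sup>2))"
  using boundedly_lipschitz_norm[OF boundedly_lipschitz_Complex[OF assms]]
  by (simp add: cmod_def)

lemma boundedly_lipschitz_rad: "boundedly_lipschitz rad"
  unfolding rad_def[abs_def] by (intro boundedly_lipschitz_sqrt_sum_squares boundedly_lipschitz_nth)

lemma boundedly_lipschitz_zre: "boundedly_lipschitz zre"
  unfolding zre_def[abs_def] power2_eq_square
  by (intro boundedly_lipschitz_diff boundedly_lipschitz_add boundedly_lipschitz_mult
      boundedly_lipschitz_nth boundedly_lipschitz_const)

lemma boundedly_lipschitz_zim: "boundedly_lipschitz zim"
  unfolding zim_def[abs_def]
  by (intro boundedly_lipschitz_mult boundedly_lipschitz_nth boundedly_lipschitz_const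
      boundedly_lipschitz_rad)

lemma boundedly_lipschitz_zabs: "boundedly_lipschitz zabs"
  unfolding zabs_def[abs_def]
  by (intro boundedly_lipschitz_sqrt_sum_squares boundedly_lipschitz_zre boundedly_lipschitz_zim)

lemma boundedly_lipschitz_hslit: "boundedly_lipschitz hslit"
  unfolding hslit_def[abs_def]
  by (intro boundedly_lipschitz_add boundedly_lipschitz_rad boundedly_lipschitz_nth)

lemma boundedly_lipschitz_dslit: "boundedly_lipschitz dslit"
  unfolding dslit_def[abs_def]
  by (intro boundedly_lipschitz_add boundedly_lipschitz_zabs boundedly_lipschitz_zre)

lemma boundedly_lipschitz_dfold: "boundedly_lipschitz dfold"
  unfolding dfold_def[abs_def] divide_inverse
  by (intro boundedly_lipschitz_Complex boundedly_lipschitz_mult boundedly_lipschitz_const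
      boundedly_lipschitz_dslit boundedly_lipschitz_zim)

lemma boundedly_lipschitz_hfold: "boundedly_lipschitz hfold"
  unfolding hfold_def[abs_def] divide_inverse
  by (intro boundedly_lipschitz_Complex boundedly_lipschitz_mult boundedly_lipschitz_const
      boundedly_lipschitz_hslit boundedly_lipschitz_zabs boundedly_lipschitz_nth)

lemma boundedly_lipschitz_offmap: "boundedly_lipschitz offmap"
  unfolding boundedly_lipschitz_def
proof
  fix M
  obtain K L where K: "K-lipschitz_on (cball 0 M) dfold" and L: "L-lipschitz_on (cball 0 M) hfold"
    using boundedly_lipschitz_dfold boundedly_lipschitz_hfold unfolding boundedly_lipschitz_def by metis
  have "(2 * K + 8 * L)-lipschitz_on (cball 0 M) offmap"
  proof (rule lipschitz_onI)
    fix X X' :: "real^3" assume X: "X \<in> cball 0 M" "X' \<in> cball 0 M"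
    show "dist (offmap X) (offmap X') \<le> (2 * K + 8 * L) * dist X X'"
      using norm_offmap_diff_le[of X X'] lipschitz_on_normD[OF K X] lipschitz_on_normD[OF L X]
      by (simp add: dist_norm algebra_simps)
  qed (use lipschitz_on_nonneg[OF K] lipschitz_on_nonneg[OF L] in simp)
  then show "\<exists>L. L-lipschitz_on (cball 0 M) offmap" by blast
qed

lemma boundedly_lipschitz_hmap: "boundedly_lipschitz hmap"
proof -
  have "boundedly_lipschitz (\<lambda>X. offmap X - zabs X *\<^sub>R e_x)"
    by (intro boundedly_lipschitz_diff boundedly_lipschitz_scaleR boundedly_lipschitz_offmap
        boundedly_lipschitz_zabs boundedly_lipschitz_const)
  then show ?thesis by (simp add: offmap_def)
qed

section \<open>The derivative of the map\<close>

lemma closed_slits: "closed slits"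
proof -
  have "slits = {X. hslit X = 0} \<union> {X. dslit X = 0}" by (auto simp: slits_def)
  moreover have "closed {X. hslit X = 0}" "closed {X. dslit X = 0}"
    by (intro closed_Collect_eq boundedly_lipschitz_imp_continuous boundedly_lipschitz_hslit
        boundedly_lipschitz_dslit continuous_on_const)+
  ultimately show ?thesis by (metis closed_Un)
qed

lemma slits_subset: "slits \<subseteq> {X. X$2 = 0} \<union> {X. X$3 = 0}"
proof
  fix X :: "real^3" assume X: "X \<in> slits"
  have "X$2 = 0 \<or> X$3 = 0"
  proof (cases "hslit X = 0")
    case True
    then show ?thesis using hslit_conj[of X] by simp
  next
    case False
    then have "zim X = 0" using X dslit_conj[of X] by (simp add: slits_def)
    moreover have "rad X \<noteq> 0" using False hslit_le[of X] hslit_nonneg[of X] by linarith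
    ultimately show ?thesis by (simp add: zim_def)
  qed
  then show "X \<in> {X. X$2 = 0} \<union> {X. X$3 = 0}" by simp
qed

lemma negligible_slits: "negligible slits"
  by (rule negligible_subset[OF negligible_Un slits_subset])
    (rule negligible_standard_hyperplane_cart)+

section \<open>Gradients of R, u and v\<close>

lemma GDERIV_DERIV_compose': "GDERIV f x :> df \<Longrightarrow> (g has_field_derivative dg) (at (f x)) \<Longrightarrow>
   d = dg *\<^sub>R df \<Longrightarrow> GDERIV (\<lambda>x. g (f x)) x :> d"
  by (simp add: GDERIV_DERIV_compose)

lemma GDERIV_nth: "GDERIV (\<lambda>X::real^'n. X $ i) X :> axis i 1"
  unfolding gderiv_def
  using bounded_linear_imp_has_derivative[OF bounded_linear_vec_nth[of i]] by (simp add: inner_axis)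

lemma GDERIV_power2: "GDERIV f x :> df \<Longrightarrow> GDERIV (\<lambda>x. (f x)\<^sup>2) x :> (2 * f x) *\<^sub>R df"
  by (rule GDERIV_DERIV_compose'[where g = "\<lambda>y. y\<^sup>2"]) (auto intro!: derivative_eq_intros)

lemma GDERIV_sqrt: "GDERIV f x :> df \<Longrightarrow> f x > 0 \<Longrightarrow> GDERIV (\<lambda>x. sqrt (f x)) x :> (1 / (2 * sqrt (f x))) *\<^sub>R df"
  by (rule GDERIV_DERIV_compose'[where g = sqrt]) (auto intro!: derivative_eq_intros simp: divide_simps)

lemma GDERIV_divide:
  assumes "GDERIV f x :> df" "GDERIV g x :> dg" "g x \<noteq> 0"
  shows "GDERIV (\<lambda>x. f x / g x) x :> (1 / (g x)\<^sup>2) *\<^sub>R (g x *\<^sub>R df - f x *\<^sub>R dg)"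
proof -
  have "GDERIV (\<lambda>x. f x * inverse (g x)) x
     :> f x *\<^sub>R (- (inverse (g x))\<^sup>2 *\<^sub>R dg) + inverse (g x) *\<^sub>R df"
    by (intro GDERIV_mult GDERIV_inverse assms)
  moreover have "f x *\<^sub>R (- (inverse (g x))\<^sup>2 *\<^sub>R dg) + inverse (g x) *\<^sub>R df
     = (1 / (g x)\<^sup>2) *\<^sub>R (g x *\<^sub>R df - f x *\<^sub>R dg)"
    using assms(3) by (simp add: scaleR_diff_right power2_eq_square divide_inverse mult.commute)
  ultimately show ?thesis by (simp add: divide_inverse)
qed

lemma GDERIV_rad:
  assumes "rad X > 0"
  shows "GDERIV rad X :> vector [X$1 / rad X, X$2 / rad X, 0]"
proof -
  have "(X$1)\<^sup>2 + (X$2)\<^sup>2 > 0" using assms by (simp add: rad_def)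
  then have "GDERIV (\<lambda>X. sqrt ((X$1)\<^sup>2 + (X$2)\<^sup>2)) X :>
     (1 / (2 * sqrt ((X$1)\<^sup>2 + (X$2)\<^sup>2))) *\<^sub>R ((2 * X$1) *\<^sub>R axis 1 1 + (2 * X$2) *\<^sub>R axis 2 1)"
    by (intro GDERIV_sqrt GDERIV_add GDERIV_power2 GDERIV_nth)
  then show ?thesis
    unfolding rad_def[abs_def, symmetric]
    by (rule GDERIV_subst) (auto simp: vec_eq_iff forall_3 rad_def[symmetric] axis_def)
qed

text \<open>Off the z-axis this vector and \<open>axis 3 1\<close> form an orthonormal basis of the
  plane through the axis and the point. Gradients of functions of w alone lie in that plane.\<close>

abbreviation grad_rad :: "real^3 \<Rightarrow> real^3" where
  "grad_rad X \<equiv> vector [X$1 / rad X, X$2 / rad X, 0]"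

lemma GDERIV_zre:
  assumes "rad X > 0"
  shows "GDERIV zre X :> (2 * rad X) *\<^sub>R grad_rad X - (2 * X$3) *\<^sub>R axis 3 1"
proof -
  have e: "zre = (\<lambda>X. (rad X)\<^sup>2 - (X$3)\<^sup>2 - 1)" by (simp add: fun_eq_iff zre_rad)
  show ?thesis unfolding e
    by (rule GDERIV_subst[OF GDERIV_diff[OF GDERIV_diff[OF GDERIV_power2[OF GDERIV_rad[OF assms]]
       GDERIV_power2[OF GDERIV_nth]] GDERIV_const]]) simp
qed

lemma GDERIV_zim:
  assumes "rad X > 0"
  shows "GDERIV zim X :> (2 * X$3) *\<^sub>R grad_rad X + (2 * rad X) *\<^sub>R axis 3 1"
  unfolding zim_def[abs_def]
  by (rule GDERIV_subst[OF GDERIV_mult[OF GDERIV_mult[OF GDERIV_const GDERIV_rad[OF assms]] GDERIV_nth]])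
    (simp add: algebra_simps)

lemma GDERIV_zabs:
  assumes "X \<notin> slits"
  shows "GDERIV zabs X :> (2 * rad X * ((norm X)\<^sup>2 - 1) / zabs X) *\<^sub>R grad_rad X
     + (2 * X$3 * ((norm X)\<^sup>2 + 1) / zabs X) *\<^sub>R axis 3 1"
proof -
  note pos = off_slits[OF assms]
  have n: "(norm X)\<^sup>2 = (rad X)\<^sup>2 + (X$3)\<^sup>2" by (simp add: norm_real3_sq rad_sq)
  have p: "(zre X)\<^sup>2 + (zim X)\<^sup>2 > 0" using pos(4) unfolding zabs_def by simp
  have "GDERIV zabs X :> (1 / (2 * zabs X)) *\<^sub>R
      ((2 * zre X) *\<^sub>R ((2 * rad X) *\<^sub>R grad_rad X - (2 * X$3) *\<^sub>R axis 3 1)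
     + (2 * zim X) *\<^sub>R ((2 * X$3) *\<^sub>R grad_rad X + (2 * rad X) *\<^sub>R axis 3 1))"
    using GDERIV_sqrt[OF GDERIV_add[OF GDERIV_power2[OF GDERIV_zre[OF pos(3)]]
       GDERIV_power2[OF GDERIV_zim[OF pos(3)]]] p]
    by (simp add: zabs_def[abs_def])
  moreover have "(2 * zre X) *\<^sub>R ((2 * rad X) *\<^sub>R g - (2 * X$3) *\<^sub>R k)
     + (2 * zim X) *\<^sub>R ((2 * X$3) *\<^sub>R g + (2 * rad X) *\<^sub>R k)
     = (4 * rad X * ((norm X)\<^sup>2 - 1)) *\<^sub>R g + (4 * X$3 * ((norm X)\<^sup>2 + 1)) *\<^sub>R k" for g k :: "real^3"
  proof -
    have "4 * rad X * ((norm X)\<^sup>2 - 1) = 2 * zre X * (2 * rad X) + 2 * zim X * (2 * X$3)"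
      "4 * X$3 * ((norm X)\<^sup>2 + 1) = 2 * zim X * (2 * rad X) - 2 * zre X * (2 * X$3)"
      unfolding n zim_def zre_rad by (simp_all add: power2_eq_square algebra_simps)
    then show ?thesis by (simp only:) (simp add: scaleR_add_left scaleR_diff_left scaleR_add_right scaleR_diff_right)
  qed
  ultimately have "GDERIV zabs X :> (1 / (2 * zabs X)) *\<^sub>R
     ((4 * rad X * ((norm X)\<^sup>2 - 1)) *\<^sub>R grad_rad X + (4 * X$3 * ((norm X)\<^sup>2 + 1)) *\<^sub>R axis 3 1)"
    by (simp only:)
  then show ?thesis by (rule GDERIV_subst) (simp add: scaleR_add_right mult.assoc)
qed

lemma GDERIV_ucoord:
  assumes "X \<notin> slits"
  shows "GDERIV ucoord X :> vector [- X$2 / (rad X)^3,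
     ((hslit X)\<^sup>2 - rad X * hslit X - (rad X)\<^sup>2) / (hslit X * (rad X)^3), 0]"
proof -
  note pos = off_slits[OF assms]
  \<comment> \<open>All is expressed by r, A and y: x = A - r, and y^2 = A (2 r - A) is
    \<open>hslit_conj\<close>.\<close>
  define r A y where "r = rad X" and "A = hslit X" and "y = X$2"
  have x: "X$1 = A - r" by (simp add: A_def hslit_def r_def)
  have y2: "y * y = A * (2 * r - A)" using hslit_conj[of X] by (simp add: x power2_eq_square flip: r_def A_def y_def)
  have rA: "r > 0" "A > 0" using pos by (auto simp: r_def A_def)
  have 1: "GDERIV hslit X :> grad_rad X + axis 1 1"
    unfolding hslit_def[abs_def] by (intro GDERIV_add GDERIV_rad GDERIV_nth pos)
  have "GDERIV ucoord X :> (1 / (A * r)\<^sup>2) *\<^sub>R ((A * r) *\<^sub>R axis 2 1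
      - y *\<^sub>R (A *\<^sub>R grad_rad X + r *\<^sub>R (grad_rad X + axis 1 1)))"
    unfolding ucoord_def[abs_def] A_def r_def y_def
    by (intro GDERIV_divide GDERIV_mult 1 GDERIV_nth GDERIV_rad pos) (use pos in auto)
  moreover have "(1 / (A * r)\<^sup>2) * (- (y * (A * ((A - r) / r) + r * ((A - r) / r + 1)))) = - y / r^3"
    using rA by (simp add: divide_simps power2_eq_square power3_eq_cube) (simp add: algebra_simps)
  moreover have "(1 / (A * r)\<^sup>2) * (A * r - y * (A * (y / r) + r * (y / r))) = (A\<^sup>2 - r * A - r\<^sup>2) / (A * r^3)"
  proof -
    have "y * (A * (y / r) + r * (y / r)) = (y * y) * (A + r) / r" by (simp add: algebra_simps add_divide_distrib)
    then show ?thesis using rA unfolding y2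
      by (simp add: divide_simps power2_eq_square power3_eq_cube) (simp add: algebra_simps)
  qed
  ultimately show ?thesis
    unfolding x r_def[symmetric] A_def[symmetric] y_def[symmetric]
    by (elim GDERIV_subst) (simp add: vec_eq_iff forall_3 axis_def)
qed

text \<open>Only the minor of the gradients of R and v in the w-plane matters for the Jacobian. Its
  value: passing from \<zeta> to (R, \<psi>) contributes 1/R, from \<psi> to v contributes (1 +
  v^2)/2 = R / \<open>dslit X\<close>, and \<zeta> = w^2 - 1 is conformal with area factor
  |2w|^2.\<close>

lemma GDERIV_vcoord:
  assumes "X \<notin> slits"
  shows "\<exists>b1 b3. GDERIV vcoord X :> b1 *\<^sub>R grad_rad X + b3 *\<^sub>R axis 3 1 \<and>
    (2 * rad X * ((norm X)\<^sup>2 - 1) / zabs X) * b3 - (2 * X$3 * ((norm X)\<^sup>2 + 1) / zabs X) * b1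
      = 4 * (norm X)\<^sup>2 / dslit X"
proof -
  note pos = off_slits[OF assms]
  define r z n R q s B where "r = rad X" and "z = X$3" and "n = (norm X)\<^sup>2" and "R = zabs X"
    and "q = zre X" and "s = zim X" and "B = dslit X"
  define a1 a3 where "a1 = 2 * r * (n - 1) / R" and "a3 = 2 * z * (n + 1) / R"
  define b1 b3 where "b1 = (1 / B\<^sup>2) * (B * (2 * z) - s * (a1 + 2 * r))"
    and "b3 = (1 / B\<^sup>2) * (B * (2 * r) - s * (a3 - 2 * z))"
  have n: "n = r\<^sup>2 + z\<^sup>2" by (simp add: n_def r_def z_def norm_real3_sq rad_sq)
  have BR: "B > 0" "R > 0" using pos by (auto simp: B_def R_def)
  have "GDERIV dslit X :> (a1 *\<^sub>R grad_rad X + a3 *\<^sub>R axis 3 1) + ((2 * r) *\<^sub>R grad_rad X - (2 * z) *\<^sub>R axis 3 1)"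
    unfolding dslit_def[abs_def] r_def z_def n_def a1_def a3_def R_def
    by (intro GDERIV_add GDERIV_zabs GDERIV_zre assms pos)
  then have "GDERIV vcoord X :> (1 / B\<^sup>2) *\<^sub>R (B *\<^sub>R ((2 * z) *\<^sub>R grad_rad X + (2 * r) *\<^sub>R axis 3 1)
     - s *\<^sub>R ((a1 *\<^sub>R grad_rad X + a3 *\<^sub>R axis 3 1) + ((2 * r) *\<^sub>R grad_rad X - (2 * z) *\<^sub>R axis 3 1)))"
    unfolding vcoord_def[abs_def] r_def z_def B_def s_def
    by (intro GDERIV_divide GDERIV_zim) (use pos in auto)
  then have 1: "GDERIV vcoord X :> b1 *\<^sub>R grad_rad X + b3 *\<^sub>R axis 3 1"
    by (rule GDERIV_subst) (simp add: b1_def b3_def algebra_simps)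
  have a: "R * a1 = 2 * r * (n - 1)" "R * a3 = 2 * z * (n + 1)"
    using BR by (simp_all add: a1_def a3_def)
  have s: "s = 2 * r * z" and q: "q = r\<^sup>2 - z\<^sup>2 - 1"
    by (simp_all add: s_def q_def zim_def zre_rad r_def z_def)
  \<comment> \<open>Read a1 + i a3 as the gradient of |\<zeta>| in the w-plane. It equals \<zeta>
    times the conjugate of 2w, divided by |\<zeta>|; multiplied by 2w it gives 4 |w|^2 \<zeta> /
    |\<zeta>|, whose real and imaginary parts are \<open>i1\<close> and \<open>i2\<close>.\<close>
  have "R * (2 * r * a1 - 2 * z * a3) = 2 * r * (R * a1) - 2 * z * (R * a3)" by (simp add: algebra_simps)
  also have "\<dots> = 4 * n * q" unfolding a q n by (simp add: algebra_simps power2_eq_square)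
  finally have i1: "R * (2 * r * a1 - 2 * z * a3) = 4 * n * q" .
  have "R * (2 * z * a1 + 2 * r * a3) = 2 * z * (R * a1) + 2 * r * (R * a3)" by (simp add: algebra_simps)
  also have "\<dots> = 4 * n * s" unfolding a s n by (simp add: algebra_simps power2_eq_square)
  finally have i2: "R * (2 * z * a1 + 2 * r * a3) = 4 * n * s" .
  have i3: "B * q + s * s = R * B"
    using zabs_sq[of X] by (simp add: B_def dslit_def q_def s_def R_def power2_eq_square algebra_simps)
  have "R * (B * (2 * r * a1 - 2 * z * a3) + s * (2 * z * a1 + 2 * r * a3))
     = B * (R * (2 * r * a1 - 2 * z * a3)) + s * (R * (2 * z * a1 + 2 * r * a3))"
    by (simp add: algebra_simps)
  also have "\<dots> = 4 * n * (B * q + s * s)" unfolding i1 i2 by (simp add: algebra_simps)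
  also have "\<dots> = R * (4 * n * B)" unfolding i3 by simp
  finally have "B * (2 * r * a1 - 2 * z * a3) + s * (2 * z * a1 + 2 * r * a3) = 4 * n * B"
    using BR by simp
  moreover have "B\<^sup>2 * (a1 * b3 - a3 * b1) = B * (2 * r * a1 - 2 * z * a3) + s * (2 * z * a1 + 2 * r * a3)"
    using BR by (simp add: b1_def b3_def field_simps)
  ultimately have "B * (B * (a1 * b3 - a3 * b1)) = B * (4 * n)" by (simp add: power2_eq_square)
  then have "B * (a1 * b3 - a3 * b1) = 4 * n" using BR by simp
  then have "a1 * b3 - a3 * b1 = 4 * n / B" using BR by (simp add: eq_divide_eq mult.commute)
  with 1 show ?thesis unfolding a1_def a3_def r_def z_def n_def R_def B_def by blast
qed

definition sphjac :: "real \<Rightarrow> real \<Rightarrow> real \<Rightarrow> real^3^3" where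
  "sphjac R u v = (let N = 1 + u\<^sup>2 + v\<^sup>2 in vector
    [vector [(2 - N) / N, - 4 * R * u / N\<^sup>2, - 4 * R * v / N\<^sup>2],
     vector [2 * u / N, 2 * R * (N - 2 * u\<^sup>2) / N\<^sup>2, - 4 * R * u * v / N\<^sup>2],
     vector [2 * v / N, - 4 * R * u * v / N\<^sup>2, 2 * R * (N - 2 * v\<^sup>2) / N\<^sup>2]])"

text \<open>The columns are orthogonal: the derivative in R is a unit radial vector, and
  stereographic projection is conformal, so the derivatives in u and v both have length 2 R / (1 +
  u^2 + v^2).\<close>

lemma det_sphjac: "det (sphjac R u v) = 4 * R\<^sup>2 / (1 + u\<^sup>2 + v\<^sup>2)\<^sup>2"
proof -
  define N where "N = 1 + u\<^sup>2 + v\<^sup>2"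
  have N: "N > 0" unfolding N_def by (simp add: add_pos_nonneg)
  define i where "i = 1 / N"
  have iN: "i * N = 1" using N by (simp add: i_def)
  have "sphjac R u v = vector
    [vector [(2 - N) * i, - 4 * R * u * i\<^sup>2, - 4 * R * v * i\<^sup>2],
     vector [2 * u * i, 2 * R * (N - 2 * u\<^sup>2) * i\<^sup>2, - 4 * R * u * v * i\<^sup>2],
     vector [2 * v * i, - 4 * R * u * v * i\<^sup>2, 2 * R * (N - 2 * v\<^sup>2) * i\<^sup>2]]"
    by (simp add: sphjac_def Let_def N_def[symmetric] i_def power_divide)
  then have "det (sphjac R u v) = 4 * R\<^sup>2 * i^5 *
      ((2 - N) * (N\<^sup>2 - 2 * N * (u\<^sup>2 + v\<^sup>2)) + 4 * N * (u\<^sup>2 + v\<^sup>2))"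
    by (simp add: det_3 algebra_simps eval_nat_numeral)
  also have "(2 - N) * (N\<^sup>2 - 2 * N * (u\<^sup>2 + v\<^sup>2)) + 4 * N * (u\<^sup>2 + v\<^sup>2) = N^3"
  proof -
    have "u\<^sup>2 + v\<^sup>2 = N - 1" by (simp add: N_def)
    then show ?thesis by (simp only:) (simp add: algebra_simps eval_nat_numeral)
  qed
  also have "4 * R\<^sup>2 * i^5 * N^3 = 4 * R\<^sup>2 * i\<^sup>2 * (i * N)^3"
    by (simp add: power_mult_distrib eval_nat_numeral mult_ac)
  finally show ?thesis by (simp add: iN) (simp add: i_def N_def power_divide)
qed

lemma has_derivative_sphmap:
  fixes f g k :: "real^3 \<Rightarrow> real"
  assumes "GDERIV f X :> a" "GDERIV g X :> b" "GDERIV k X :> c"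
  shows "((\<lambda>X. sphmap (f X) (g X) (k X)) has_derivative
     (\<lambda>V. (sphjac (f X) (g X) (k X) ** vector [a, b, c]) *v V)) (at X)"
proof -
  define N where "N = 1 + (g X)\<^sup>2 + (k X)\<^sup>2"
  have N: "N \<noteq> 0" "N > 0" unfolding N_def by (smt (verit) zero_le_power2)+
  have fN: "GDERIV (\<lambda>X. f X / (1 + (g X)\<^sup>2 + (k X)\<^sup>2)) X
     :> (1 / N\<^sup>2) *\<^sub>R (N *\<^sub>R a - f X *\<^sub>R (0 + (2 * g X) *\<^sub>R b + (2 * k X) *\<^sub>R c))"
    unfolding N_def using N(1) unfolding N_def
    by (intro GDERIV_divide GDERIV_add GDERIV_power2 GDERIV_const assms)
  let ?q = "(1 / N\<^sup>2) *\<^sub>R (N *\<^sub>R a - f X *\<^sub>R (0 + (2 * g X) *\<^sub>R b + (2 * k X) *\<^sub>R c))"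
  have N2: "1 - (g X)\<^sup>2 - (k X)\<^sup>2 = 2 - N" by (simp add: N_def)
  have 1: "GDERIV (\<lambda>X. sphmap (f X) (g X) (k X) $ 1) X
     :> (f X / N) *\<^sub>R (0 - (2 * g X) *\<^sub>R b - (2 * k X) *\<^sub>R c) + (2 - N) *\<^sub>R ?q"
    unfolding sphmap_def N2[symmetric] using GDERIV_mult[OF fN GDERIV_diff[OF GDERIV_diff[OF GDERIV_const
      GDERIV_power2[OF assms(2)]] GDERIV_power2[OF assms(3)]], of 1] by (simp add: N_def)
  have 2: "GDERIV (\<lambda>X. sphmap (f X) (g X) (k X) $ 2) X
     :> (f X / N) *\<^sub>R (2 *\<^sub>R b + g X *\<^sub>R 0) + (2 * g X) *\<^sub>R ?q"
    unfolding sphmap_def using GDERIV_mult[OF fN GDERIV_mult[OF GDERIV_const assms(2)], of 2] by (simp add: N_def)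
  have 3: "GDERIV (\<lambda>X. sphmap (f X) (g X) (k X) $ 3) X
     :> (f X / N) *\<^sub>R (2 *\<^sub>R c + k X *\<^sub>R 0) + (2 * k X) *\<^sub>R ?q"
    unfolding sphmap_def using GDERIV_mult[OF fN GDERIV_mult[OF GDERIV_const assms(3)], of 2] by (simp add: N_def)
  have cols: "(A ** vector [a, b, c]) $ i = A $ i $ 1 *\<^sub>R a + A $ i $ 2 *\<^sub>R b + A $ i $ 3 *\<^sub>R c"
    for A :: "real^3^3" and i
    by (simp add: vec_eq_iff matrix_matrix_mult_def sum_3)
  have sj: "sphjac (f X) (g X) (k X) = vector
    [vector [(2 - N) / N, - 4 * f X * g X / N\<^sup>2, - 4 * f X * k X / N\<^sup>2],
     vector [2 * g X / N, 2 * f X * (N - 2 * (g X)\<^sup>2) / N\<^sup>2, - 4 * f X * g X * k X / N\<^sup>2],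
     vector [2 * k X / N, - 4 * f X * g X * k X / N\<^sup>2, 2 * f X * (N - 2 * (k X)\<^sup>2) / N\<^sup>2]]"
    unfolding sphjac_def Let_def N_def ..
  have comp: "GDERIV (\<lambda>X. sphmap (f X) (g X) (k X) $ i) X
      :> (sphjac (f X) (g X) (k X) ** vector [a, b, c]) $ i" for i
  proof -
    have *: "GDERIV F X :> d" if "GDERIV F X :> e" "\<And>j. N\<^sup>2 * e $ j = N\<^sup>2 * d $ j" for F :: "real^3 \<Rightarrow> real" and d e
      using that N by (metis (no_types, opaque_lifting) GDERIV_subst mult_left_cancel power_eq_0_iff vec_eq_iff)
    consider "i = 1" | "i = 2" | "i = 3" using exhaust_3 by blast
    then show ?thesis
    proof cases
      case 1
      show ?thesis unfolding 1
        by (rule *[OF \<open>GDERIV (\<lambda>X. sphmap (f X) (g X) (k X) $ 1) X :> _\<close>])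
          (use N in \<open>simp add: cols sj power2_eq_square field_simps\<close>)
    next
      case 2
      show ?thesis unfolding 2
        by (rule *[OF \<open>GDERIV (\<lambda>X. sphmap (f X) (g X) (k X) $ 2) X :> _\<close>])
          (use N in \<open>simp add: cols sj power2_eq_square field_simps\<close>)
    next
      case 3
      show ?thesis unfolding 3
        by (rule *[OF \<open>GDERIV (\<lambda>X. sphmap (f X) (g X) (k X) $ 3) X :> _\<close>])
          (use N in \<open>simp add: cols sj power2_eq_square field_simps\<close>)
    qed
  qed
  have comp': "((\<lambda>X. sphmap (f X) (g X) (k X) $ i) has_derivative
     (\<lambda>V. ((sphjac (f X) (g X) (k X) ** vector [a, b, c]) *v V) $ i)) (at X)" for i
    using comp[of i] unfolding gderiv_def matrix_vector_mul_component by (simp only: inner_commute)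
  show ?thesis
    unfolding has_derivative_componentwise_within[of "\<lambda>X. sphmap (f X) (g X) (k X)"]
    using comp' by (auto simp: Basis_vec_def inner_axis)
qed

text \<open>Two rows lie in the plane spanned by a horizontal vector and the vertical axis, and the
  remaining row is horizontal; so the determinant is a product of two minors.\<close>

lemma det_split:
  "det (vector [a1 *\<^sub>R vector [c, d, 0] + a3 *\<^sub>R axis 3 1, vector [u1, u2, 0],
    b1 *\<^sub>R vector [c, d, 0] + b3 *\<^sub>R axis 3 1] :: real^3^3) = (a1 * b3 - a3 * b1) * (c * u2 - d * u1)"
  by (simp add: det_3 axis_def algebra_simps)

text \<open>The Jacobian is the product of three factors: that of \<open>sphmap\<close>, the minor
  of R and v in the w-plane, and the angular derivative of u divided by \<rho>.\<close>

lemma hmap_has_derivative: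
  assumes "X \<notin> slits"
  shows "\<exists>M. (hmap has_derivative (\<lambda>V. M *v V)) (at X) \<and>
     det M = 16 * (zabs X)\<^sup>2 * (norm X)\<^sup>2 / (rad X * hslit X * dslit X * (1 + (ucoord X)\<^sup>2 + (vcoord X)\<^sup>2)\<^sup>2)"
proof -
  note pos = off_slits[OF assms]
  define a1 a3 where "a1 = 2 * rad X * ((norm X)\<^sup>2 - 1) / zabs X" and "a3 = 2 * X$3 * ((norm X)\<^sup>2 + 1) / zabs X"
  define u1 u2 where "u1 = - X$2 / (rad X)^3"
    and "u2 = ((hslit X)\<^sup>2 - rad X * hslit X - (rad X)\<^sup>2) / (hslit X * (rad X)^3)"
  obtain b1 b3 where v: "GDERIV vcoord X :> b1 *\<^sub>R grad_rad X + b3 *\<^sub>R axis 3 1"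
    and ab: "a1 * b3 - a3 * b1 = 4 * (norm X)\<^sup>2 / dslit X"
    using GDERIV_vcoord[OF assms] unfolding a1_def a3_def by blast
  have R: "GDERIV zabs X :> a1 *\<^sub>R grad_rad X + a3 *\<^sub>R axis 3 1"
    using GDERIV_zabs[OF assms] unfolding a1_def a3_def .
  have u: "GDERIV ucoord X :> vector [u1, u2, 0]"
    using GDERIV_ucoord[OF assms] unfolding u1_def u2_def .
  let ?G = "vector [a1 *\<^sub>R grad_rad X + a3 *\<^sub>R axis 3 1, vector [u1, u2, 0],
    b1 *\<^sub>R grad_rad X + b3 *\<^sub>R axis 3 1] :: real^3^3"
  let ?M = "sphjac (zabs X) (ucoord X) (vcoord X) ** ?G"
  \<comment> \<open>This is the derivative of u in \<theta>, namely (1 + tan^2(\<theta>/2)) / (2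
    \<rho>).\<close>
  have "X$1 * u2 - X$2 * u1 = 1 / hslit X"
  proof -
    define r A y where "r = rad X" and "A = hslit X" and "y = X$2"
    have x: "X$1 = A - r" by (simp add: A_def hslit_def r_def)
    have y2: "y * y = A * (2 * r - A)" using hslit_conj[of X] by (simp add: x power2_eq_square flip: r_def A_def y_def)
    have rA: "r > 0" "A > 0" using pos by (auto simp: r_def A_def)
    have "(A - r) * ((A\<^sup>2 - r * A - r\<^sup>2) / (A * r^3)) + (y * y) / r^3 = 1 / A"
      unfolding y2 using rA by (simp add: divide_simps) (simp add: algebra_simps power2_eq_square power3_eq_cube)
    then show ?thesis
      unfolding u1_def u2_def x r_def[symmetric] A_def[symmetric] y_def[symmetric] by simp
  qed
  then have xu: "(X$1 / rad X) * u2 - (X$2 / rad X) * u1 = 1 / (rad X * hslit X)"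
    by (simp add: diff_divide_distrib[symmetric])
  have "det ?G = (a1 * b3 - a3 * b1) * ((X$1 / rad X) * u2 - (X$2 / rad X) * u1)"
    by (rule det_split)
  then have dG: "det ?G = 4 * (norm X)\<^sup>2 / dslit X * (1 / (rad X * hslit X))"
    unfolding ab xu .
  have "((\<lambda>X. sphmap (zabs X) (ucoord X) (vcoord X)) has_derivative (\<lambda>V. ?M *v V)) (at X)"
    by (rule has_derivative_sphmap[OF R u v])
  then have "(hmap has_derivative (\<lambda>V. ?M *v V)) (at X)"
    by (rule has_derivative_transform_within_open[where s = "- slits"])
      (use closed_slits assms in \<open>auto simp: hmap_def\<close>)
  moreover have "det ?M = 16 * (zabs X)\<^sup>2 * (norm X)\<^sup>2 / (rad X * hslit X * dslit X * (1 + (ucoord X)\<^sup>2 + (vcoord X)\<^sup>2)\<^sup>2)"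
    unfolding det_mul dG det_sphjac by (simp add: mult_ac)
  ultimately show ?thesis by blast
qed

section \<open>Injectivity and fibers\<close>

lemma bilipschitz_equivalentI:
  assumes im: "f ` S = T" and c: "c > 0"
    and lo: "\<And>x y. x \<in> S \<Longrightarrow> y \<in> S \<Longrightarrow> c * dist x y \<le> dist (f x) (f y)"
    and up: "\<And>x y. x \<in> S \<Longrightarrow> y \<in> S \<Longrightarrow> dist (f x) (f y) \<le> C * dist x y"
  shows "bilipschitz_equivalent S T"
proof -
  let ?L = "max 1 (max C (1 / c))"
  have "inj_on f S"
  proof (rule inj_onI)
    fix x y assume "x \<in> S" "y \<in> S" "f x = f y"
    then have "c * dist x y \<le> 0" using lo[of x y] by simp
    then show "x = y" using c by (simp add: mult_le_0_iff)
  qed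
  then have "bij_betw f S T" using im by (simp add: bij_betw_def)
  moreover have "dist x y / ?L \<le> dist (f x) (f y) \<and> dist (f x) (f y) \<le> ?L * dist x y"
    if "x \<in> S" "y \<in> S" for x y
  proof
    have "1 / c \<le> ?L" by simp
    then have "1 \<le> ?L * c" using c by (simp add: divide_le_eq)
    then have "dist x y \<le> ?L * c * dist x y" using mult_right_mono[of 1 "?L * c" "dist x y"] by simp
    also have "\<dots> \<le> ?L * dist (f x) (f y)"
      using lo[OF that] by (simp add: mult.assoc mult_left_mono)
    finally show "dist x y / ?L \<le> dist (f x) (f y)" by (simp add: divide_le_eq mult.commute)
    have "C * dist x y \<le> ?L * dist x y" by (intro mult_right_mono) auto
    then show "dist (f x) (f y) \<le> ?L * dist x y" using up[OF that] by linarith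
  qed
  ultimately show ?thesis unfolding bilipschitz_equivalent_def
    by (intro exI[of _ f] exI[of _ ?L]) auto
qed

lemma bilipschitz_equivalent_sym:
  assumes "bilipschitz_equivalent S T" shows "bilipschitz_equivalent T S"
proof -
  obtain f L where L: "L \<ge> 1" and bij: "bij_betw f S T"
    and b: "\<And>x y. x \<in> S \<Longrightarrow> y \<in> S \<Longrightarrow> dist x y / L \<le> dist (f x) (f y) \<and> dist (f x) (f y) \<le> L * dist x y"
    using assms unfolding bilipschitz_equivalent_def by blast
  define g where "g = inv_into S f"
  have g: "g x \<in> S" "f (g x) = x" if "x \<in> T" for x
    using that bij by (auto simp: g_def bij_betw_def inv_into_into f_inv_into_f)
  have "bij_betw g T S" unfolding g_def using bij by (rule bij_betw_inv_into)
  then have "g ` T = S" by (simp add: bij_betw_def)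
  then show ?thesis
  proof (rule bilipschitz_equivalentI)
    show "1 / L > 0" using L by simp
    fix x y assume xy: "x \<in> T" "y \<in> T"
    show "1 / L * dist x y \<le> dist (g x) (g y)" "dist (g x) (g y) \<le> L * dist x y"
      using b[of "g x" "g y"] g xy L by (auto simp: divide_le_eq mult.commute)
  qed
qed

lemma bilipschitz_equivalent_trans:
  assumes "bilipschitz_equivalent S T" "bilipschitz_equivalent T U"
  shows "bilipschitz_equivalent S U"
proof -
  obtain f L where L: "L \<ge> 1" and f: "bij_betw f S T"
    and b: "\<And>x y. x \<in> S \<Longrightarrow> y \<in> S \<Longrightarrow> dist x y / L \<le> dist (f x) (f y) \<and> dist (f x) (f y) \<le> L * dist x y"
    using assms(1) unfolding bilipschitz_equivalent_def by blast
  obtain g K where K: "K \<ge> 1" and g: "bij_betw g T U"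
    and d: "\<And>x y. x \<in> T \<Longrightarrow> y \<in> T \<Longrightarrow> dist x y / K \<le> dist (g x) (g y) \<and> dist (g x) (g y) \<le> K * dist x y"
    using assms(2) unfolding bilipschitz_equivalent_def by blast
  show ?thesis
  proof (rule bilipschitz_equivalentI[where f = "\<lambda>x. g (f x)"])
    show "(\<lambda>x. g (f x)) ` S = U" using f g by (metis bij_betw_imp_surj_on image_image)
    show "1 / (L * K) > 0" using L K by simp
    fix x y assume xy: "x \<in> S" "y \<in> S"
    then have fT: "f x \<in> T" "f y \<in> T" using f by (auto simp: bij_betw_def)
    have "1 / (L * K) * dist x y = (dist x y / L) / K" by simp
    also have "\<dots> \<le> dist (f x) (f y) / K" using b[OF xy] K by (intro divide_right_mono) auto
    finally show "1 / (L * K) * dist x y \<le> dist (g (f x)) (g (f y))" using d[OF fT] by linarith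
    have "K * dist (f x) (f y) \<le> K * (L * dist x y)" using b[OF xy] K by (intro mult_left_mono) auto
    then show "dist (g (f x)) (g (f y)) \<le> (K * L) * dist x y" using d[OF fT] by (simp add: mult.assoc)
  qed
qed

lemma bilipschitz_equivalent_isometry:
  assumes "\<And>x y. x \<in> S \<Longrightarrow> y \<in> S \<Longrightarrow> dist (f x) (f y) = dist x y"
  shows "bilipschitz_equivalent (f ` S) S"
  by (rule bilipschitz_equivalent_sym, rule bilipschitz_equivalentI[where f = f and c = 1 and C = 1])
    (use assms in auto)

lemma bilipschitz_equivalent_connected:
  assumes "bilipschitz_equivalent S T" "connected T"
  shows "connected S"
proof -
  obtain f L where L: "L \<ge> 1" and f: "bij_betw f T S"
    and b: "\<And>x y. x \<in> T \<Longrightarrow> y \<in> T \<Longrightarrow> dist (f x) (f y) \<le> L * dist x y"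
    using bilipschitz_equivalent_sym[OF assms(1)] unfolding bilipschitz_equivalent_def by blast
  have "L-lipschitz_on T f" using b L by (intro lipschitz_onI) auto
  then have "connected (f ` T)"
    by (intro connected_continuous_image assms(2)) (rule lipschitz_on_continuous_on)
  then show ?thesis using f by (simp add: bij_betw_def)
qed

section \<open>Injectivity off the cuts and values off the ray\<close>

lemma norm_sphmap: "norm (sphmap R u v) = \<bar>R\<bar>"
proof (rule power2_eq_imp_eq)
  define N where "N = 1 + u\<^sup>2 + v\<^sup>2"
  have N: "N > 0" unfolding N_def by (smt (verit) zero_le_power2)
  have "(norm (sphmap R u v))\<^sup>2 = (R / N)\<^sup>2 * ((1 - u\<^sup>2 - v\<^sup>2)\<^sup>2 + (2 * u)\<^sup>2 + (2 * v)\<^sup>2)"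
    by (simp add: sphmap_def N_def[symmetric] power_mult_distrib norm_real3_sq power_divide)
  also have "(1 - u\<^sup>2 - v\<^sup>2)\<^sup>2 + (2 * u)\<^sup>2 + (2 * v)\<^sup>2 = N\<^sup>2"
    by (simp add: N_def power2_eq_square algebra_simps)
  also have "(R / N)\<^sup>2 * N\<^sup>2 = \<bar>R\<bar>\<^sup>2" using N by (simp add: power_divide)
  finally show "(norm (sphmap R u v))\<^sup>2 = \<bar>R\<bar>\<^sup>2" .
qed auto

lemma norm_e_x: "norm e_x = 1"
  by (rule power2_eq_imp_eq) (simp_all add: norm_real3_sq)

lemma norm_hmap: "norm (hmap X) = zabs X"
  by (simp add: hmap_def norm_sphmap norm_e_x)

lemma offmap_nz: "X \<notin> slits \<Longrightarrow> offmap X \<noteq> 0"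
  using invmap_nz[of X] by (simp add: offmap_inversion inversion_def)

lemma hmap_in_ray_iff: "hmap X = - (t *\<^sub>R e_x) \<and> t \<ge> 0 \<longleftrightarrow> X \<in> slits \<and> zabs X = t"
proof
  assume h: "hmap X = - (t *\<^sub>R e_x) \<and> t \<ge> 0"
  then have z: "zabs X = t" using norm_hmap[of X] by (simp add: norm_e_x)
  with h have "offmap X = 0" by (simp add: offmap_def)
  with z show "X \<in> slits \<and> zabs X = t" using offmap_nz by blast
qed (auto simp: hmap_def)

lemma hmap_inj_off_slits:
  assumes "X \<notin> slits" "X' \<notin> slits" "hmap X = hmap X'"
  shows "X = X'"
proof -
  note p = off_slits[OF assms(1)] and p' = off_slits[OF assms(2)]
  have R: "zabs X = zabs X'" using assms(3) norm_hmap by metis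
  then have "offmap X = offmap X'" using assms(3) by (simp add: offmap_def)
  then have "inversion (invmap X) = inversion (invmap X')"
    by (simp add: offmap_inversion assms)
  then have "invmap X = invmap X'" by (metis inversion_inversion)
  then have uv: "ucoord X = ucoord X'" "vcoord X = vcoord X'"
    using p p' R by (simp_all add: invmap_def vec_eq_iff forall_3)
  then have "inverse (dfold X) = inverse (dfold X')"
    by (simp add: inverse_dfold assms R)
  then have "dfold X = dfold X'" by simp
  then have q: "zre X = zre X'" "zim X = zim X'"
    using R by (simp_all add: dfold_def dslit_def)
  \<comment> \<open>Both are square roots of the same \<zeta> + 1; positivity of \<open>rad\<close>
    off the cuts fixes the sign.\<close>
  let ?w = "Complex (rad X) (X$3)" and ?w' = "Complex (rad X') (X'$3)"
  have "?w\<^sup>2 = ?w'\<^sup>2"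
    using q by (simp add: complex_eq_iff power2_eq_square zre_rad zim_def mult.commute)
  then have "?w = ?w' \<or> ?w = - ?w'" by (simp add: power2_eq_iff)
  then have r: "rad X = rad X'" "X$3 = X'$3" using p p' by (auto simp: complex_eq_iff)
  have "inverse (hfold X) = inverse (hfold X')"
    by (simp add: inverse_hfold assms R uv r)
  then have "hfold X = hfold X'" by simp
  then have "hslit X = hslit X'" "X$2 = X'$2"
    using p p' R by (simp_all add: hfold_def)
  then show ?thesis using r by (simp add: vec_eq_iff forall_3 hslit_def)
qed

text \<open>The coordinates are inverted in turn: v gives \<zeta> on the circle of radius R, the
  principal root of \<zeta> + 1 gives w, and \<rho> u = tan(\<theta>/2) gives the position on the
  circle of radius \<rho>.\<close>

lemma coords_surj:
  assumes R: "R > 0"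
  shows "\<exists>X. X \<notin> slits \<and> zabs X = R \<and> ucoord X = u \<and> vcoord X = v"
proof -
  define V where "V = 1 + v\<^sup>2"
  have V: "V > 0" unfolding V_def by (simp add: add_pos_nonneg)
  define q s where "q = R * (1 - v\<^sup>2) / V" and "s = 2 * R * v / V"
  have qs: "q\<^sup>2 + s\<^sup>2 = R\<^sup>2"
  proof -
    have "(1 - v\<^sup>2)\<^sup>2 + (2 * v)\<^sup>2 = V\<^sup>2" by (simp add: V_def power2_eq_square algebra_simps)
    then have "R\<^sup>2 * (1 - v\<^sup>2)\<^sup>2 + R\<^sup>2 * (2 * v)\<^sup>2 = R\<^sup>2 * V\<^sup>2" by (metis distrib_left)
    then have "(R * (1 - v\<^sup>2))\<^sup>2 + (2 * R * v)\<^sup>2 = R\<^sup>2 * V\<^sup>2" by (simp add: power_mult_distrib mult_ac)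
    then show ?thesis
      using V unfolding q_def s_def power_divide add_divide_distrib[symmetric] by simp
  qed
  have "R + q = R * (V + (1 - v\<^sup>2)) / V" using V by (simp add: q_def field_simps)
  then have Rq: "R + q = 2 * R / V" by (simp add: V_def)
  define w where "w = csqrt (Complex (q + 1) s)"
  define \<rho> z where "\<rho> = Re w" and "z = Im w"
  have "w\<^sup>2 = Complex (q + 1) s" by (simp add: w_def)
  then have w: "\<rho>\<^sup>2 - z\<^sup>2 = q + 1" "2 * \<rho> * z = s"
    by (auto simp: complex_eq_iff power2_eq_square \<rho>_def z_def)
  \<comment> \<open>The principal root has real part 0 only if \<zeta> + 1 is real and at most 0.
    But \<zeta> is real only for v = 0, and then \<zeta> = R > 0.\<close>
  have \<rho>: "\<rho> > 0"
  proof (rule ccontr)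
    assume "\<not> \<rho> > 0"
    then have "\<rho> = 0" using csqrt_principal[of "Complex (q + 1) s"] by (auto simp: \<rho>_def w_def)
    then have "s = 0" "q + 1 \<le> 0" using w zero_le_power2[of z] by (simp_all, linarith)
    then have "v = 0" using R V by (simp add: s_def)
    then have "q = R" by (simp add: q_def V_def)
    then show False using R \<open>q + 1 \<le> 0\<close> by simp
  qed
  define T where "T = \<rho> * u"
  define c where "c = 1 + T\<^sup>2"
  have c: "c > 0" unfolding c_def by (simp add: add_pos_nonneg)
  define X :: "real^3" where "X = vector [\<rho> * (1 - T\<^sup>2) / c, \<rho> * (2 * T) / c, z]"
  have xy: "(X$1)\<^sup>2 + (X$2)\<^sup>2 = \<rho>\<^sup>2"
  proof -
    have "(1 - T\<^sup>2)\<^sup>2 + (2 * T)\<^sup>2 = c\<^sup>2" by (simp add: c_def power2_eq_square algebra_simps)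
    then have "\<rho>\<^sup>2 * (1 - T\<^sup>2)\<^sup>2 + \<rho>\<^sup>2 * (2 * T)\<^sup>2 = \<rho>\<^sup>2 * c\<^sup>2" by (metis distrib_left)
    then have e: "(\<rho> * (1 - T\<^sup>2))\<^sup>2 + (\<rho> * (2 * T))\<^sup>2 = \<rho>\<^sup>2 * c\<^sup>2" by (simp add: power_mult_distrib mult_ac)
    have X: "X$1 = \<rho> * (1 - T\<^sup>2) / c" "X$2 = \<rho> * (2 * T) / c" by (simp_all add: X_def)
    show ?thesis
      using c unfolding X power_divide add_divide_distrib[symmetric] e by simp
  qed
  then have rad: "rad X = \<rho>" using \<rho> by (simp add: rad_def)
  have zre: "zre X = q" using w by (simp add: zre_rad rad) (simp add: X_def)
  have zim: "zim X = s" using w by (simp add: zim_def rad) (simp add: X_def)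
  have zabs: "zabs X = R" using R by (simp add: zabs_def zre zim qs)
  have "\<rho> + \<rho> * (1 - T\<^sup>2) / c = \<rho> * (c + (1 - T\<^sup>2)) / c" using c by (simp add: field_simps)
  then have hs: "hslit X = 2 * \<rho> / c" by (simp add: hslit_def rad) (simp add: X_def c_def)
  have ds: "dslit X = 2 * R / V" by (simp add: dslit_def zabs zre Rq)
  have "X \<notin> slits" using hs ds R \<rho> c V by (simp add: slits_def)
  moreover have "ucoord X = u" using \<rho> c by (simp add: ucoord_def hs rad) (simp add: X_def T_def)
  moreover have "vcoord X = v" using R V by (simp add: vcoord_def ds zim s_def)
  ultimately show ?thesis using zabs by blast
qed

lemma hmap_off_ray:
  assumes "y \<notin> {- (t *\<^sub>R e_x) |t. t \<ge> 0}"
  shows "\<exists>X. hmap -` {y} = {X}"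
proof -
  define R where "R = norm y"
  have R0: "R > 0"
  proof -
    have "y \<noteq> 0"
    proof
      assume "y = 0"
      then have "y = - (0 *\<^sub>R e_x)" by simp
      then show False using assms by blast
    qed
    then show ?thesis by (simp add: R_def)
  qed
  have n: "R\<^sup>2 = (y$1)\<^sup>2 + (y$2)\<^sup>2 + (y$3)\<^sup>2" by (simp add: R_def norm_real3_sq)
  have "\<bar>y$1\<bar> \<le> R" unfolding R_def by (rule component_le_norm_cart)
  moreover have "R + y$1 \<noteq> 0"
  proof
    assume "R + y$1 = 0"
    then have "y$1 = - R" by linarith
    moreover from this n have "(y$2)\<^sup>2 + (y$3)\<^sup>2 = 0" by simp
    then have "y$2 = 0" "y$3 = 0" by (auto simp: sum_power2_eq_zero_iff)
    ultimately have "y = - (R *\<^sub>R e_x)" by (simp add: vec_eq_iff forall_3)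
    then show False using assms R0 by auto
  qed
  ultimately have s: "R + y$1 > 0" by linarith
  \<comment> \<open>Stereographic projection of \<open>y\<close> from
    \<open>- (R *\<^sub>R e_x)\<close>: the vector (1, u, v) is parallel to
    \<open>y + R *\<^sub>R e_x\<close>.\<close>
  obtain X where X: "X \<notin> slits" "zabs X = R" "ucoord X = y$2 / (R + y$1)" "vcoord X = y$3 / (R + y$1)"
    using coords_surj[OF R0] by blast
  have "(y$2)\<^sup>2 + (y$3)\<^sup>2 = (R - y$1) * (R + y$1)" using n by (simp add: power2_eq_square algebra_simps)
  then have "(y$2 / (R + y$1))\<^sup>2 + (y$3 / (R + y$1))\<^sup>2 = (R - y$1) / (R + y$1)"
    using s by (simp add: power_divide add_divide_distrib[symmetric]) (simp add: power2_eq_square)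
  moreover have "1 + (R - y$1) / (R + y$1) = 2 * R / (R + y$1)"
    "1 - (R - y$1) / (R + y$1) = 2 * y$1 / (R + y$1)" using s by (simp_all add: field_simps)
  ultimately have 1: "1 + (y$2 / (R + y$1))\<^sup>2 + (y$3 / (R + y$1))\<^sup>2 = 2 * R / (R + y$1)"
    and 2: "1 - (y$2 / (R + y$1))\<^sup>2 - (y$3 / (R + y$1))\<^sup>2 = 2 * y$1 / (R + y$1)" by linarith+
  have "hmap X = y"
    using X(1) unfolding hmap_def sphmap_def X(2-4) 1 2
    using s R0 by (simp add: vec_eq_iff forall_3)
  moreover have "X' = X" if "hmap X' = y" for X'
  proof (rule hmap_inj_off_slits)
    show "X' \<notin> slits" using that assms by (force simp: hmap_def)
  qed (use X that \<open>hmap X = y\<close> in auto)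
  ultimately have "hmap -` {y} = {X}" by blast
  then show ?thesis by blast
qed

section \<open>The cuts as plane sets, and the fibers over the ray\<close>

lemma hslit_eq_0_iff: "hslit X = 0 \<longleftrightarrow> X$1 \<le> 0 \<and> X$2 = 0"
proof
  assume h: "hslit X = 0"
  then have "X$2 = 0" using hslit_conj[of X] by simp
  then show "X$1 \<le> 0 \<and> X$2 = 0" using h rad_nonneg[of X] unfolding hslit_def by linarith
qed (simp add: hslit_def rad_def)

lemma dslit_eq_0_iff: "dslit X = 0 \<longleftrightarrow> rad X = 0 \<or> X$3 = 0 \<and> rad X \<le> 1"
proof
  assume d: "dslit X = 0"
  then have "zim X = 0" using dslit_conj[of X] by simp
  then have "rad X = 0 \<or> X$3 = 0" by (simp add: zim_def)
  moreover have "zre X \<le> 0" using d zabs_nonneg[of X] unfolding dslit_def by linarith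
  moreover have "rad X \<le> 1" if "X$3 = 0" "zre X \<le> 0"
    using that by (simp add: zre_rad abs_square_le_1)
  ultimately show "rad X = 0 \<or> X$3 = 0 \<and> rad X \<le> 1" by blast
next
  assume r: "rad X = 0 \<or> X$3 = 0 \<and> rad X \<le> 1"
  then have "zim X = 0" by (auto simp: zim_def)
  moreover have "- 1 \<le> (X$3)\<^sup>2" by (rule order_trans[OF _ zero_le_power2]) simp
  then have "zre X \<le> 0" using r by (auto simp: zre_rad abs_square_le_1)
  ultimately show "dslit X = 0" by (simp add: dslit_def zabs_def)
qed

text \<open>Isometric copies of the complex plane in the planes y = 0 and z = 0. The minus signs
  carry Re w \<ge> 0 to the half-plane x \<le> 0, and the two maps agree on the reals, where the
  pieces of a fiber meet.\<close>

definition hembed :: "complex \<Rightarrow> real^3" where "hembed w = vector [- Re w, 0, Im w]"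
definition dembed :: "complex \<Rightarrow> real^3" where "dembed c = vector [- Re c, Im c, 0]"

lemma dist_hembed: "dist (hembed w) (hembed w') = dist w w'"
  unfolding dist_norm
  by (rule power2_eq_imp_eq) (simp_all add: norm_real3_sq hembed_def cmod_power2 power2_commute)

lemma dist_dembed: "dist (dembed w) (dembed w') = dist w w'"
  unfolding dist_norm
  by (rule power2_eq_imp_eq) (simp_all add: norm_real3_sq dembed_def cmod_power2 power2_commute)

text \<open>The right half of the Cassini oval with foci 1 and -1: a full loop for 0 < t < 1, one
  loop of the lemniscate for t = 1, and an arc with endpoints on the imaginary axis for t >
  1.\<close>

definition cassini :: "real \<Rightarrow> complex set" where
  "cassini t = {w. Re w \<ge> 0 \<and> norm (w\<^sup>2 - 1) = t}"

lemma zabs_eq_norm: "zabs X = norm ((Complex (rad X) (X$3))\<^sup>2 - 1)"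
  by (simp add: zabs_def cmod_def zre_rad zim_def power2_eq_square)

lemma fiber_ray:
  assumes t: "t \<ge> 0"
  shows "hmap -` {- (t *\<^sub>R e_x)} = hembed ` cassini t \<union> dembed ` {c. (norm c)\<^sup>2 = 1 - t}"
proof -
  have fib: "hmap -` {- (t *\<^sub>R e_x)} = {X. X \<in> slits \<and> zabs X = t}"
    using hmap_in_ray_iff[of _ t] t by auto
  have 1: "X \<in> hembed ` cassini t" if "hslit X = 0" "zabs X = t" for X
  proof
    have "X$1 \<le> 0" "X$2 = 0" using that(1) hslit_eq_0_iff by auto
    moreover from this have "rad X = - X$1" by (simp add: rad_def)
    ultimately show "X = hembed (Complex (- X$1) (X$3))" "Complex (- X$1) (X$3) \<in> cassini t"
      using that(2) by (simp_all add: hembed_def cassini_def zabs_eq_norm vec_eq_iff forall_3)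
  qed
  have 2: "X \<in> dembed ` {c. (norm c)\<^sup>2 = 1 - t}" if "X$3 = 0" "rad X \<le> 1" "zabs X = t" for X
  proof
    show "X = dembed (Complex (- X$1) (X$2))" using that(1) by (simp add: dembed_def vec_eq_iff forall_3)
    have "zre X = (rad X)\<^sup>2 - 1" "zim X = 0" using that(1) by (simp_all add: zre_rad zim_def)
    moreover have "(rad X)\<^sup>2 \<le> 1" using that(2) by (simp add: abs_square_le_1)
    ultimately have "t = 1 - (rad X)\<^sup>2" using that(3) by (simp add: zabs_def)
    then show "Complex (- X$1) (X$2) \<in> {c. (norm c)\<^sup>2 = 1 - t}" by (simp add: cmod_power2 rad_sq)
  qed
  have 3: "hslit X = 0 \<and> zabs X = t" if h: "X \<in> hembed ` cassini t" for X
  proof -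
    obtain w where w: "X = hembed w" "Re w \<ge> 0" "norm (w\<^sup>2 - 1) = t" using h unfolding cassini_def by blast
    then have "rad X = Re w" by (simp add: rad_def hembed_def)
    then show ?thesis using w by (simp add: hslit_eq_0_iff zabs_eq_norm) (simp add: hembed_def)
  qed
  have 4: "dslit X = 0 \<and> zabs X = t" if h: "X \<in> dembed ` {c. (norm c)\<^sup>2 = 1 - t}" for X
  proof -
    obtain c where c: "X = dembed c" "(norm c)\<^sup>2 = 1 - t" using h by blast
    then have r: "rad X = norm c" "X$3 = 0" by (simp_all add: rad_def dembed_def cmod_def)
    then have "zre X = - t" "zim X = 0" using c(2) by (simp_all add: zre_rad zim_def)
    then have "zabs X = t" using t by (simp add: zabs_def)
    moreover have "(norm c)\<^sup>2 \<le> 1" using c(2) t by simp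
    then have "rad X \<le> 1" using r by (simp add: abs_square_le_1)
    ultimately show ?thesis using r by (simp add: dslit_eq_0_iff)
  qed
  have 5: "X \<in> hembed ` cassini t \<union> dembed ` {c. (norm c)\<^sup>2 = 1 - t}" if "X \<in> slits" "zabs X = t" for X
  proof -
    \<comment> \<open>On the z-axis \<open>hslit\<close> and \<open>dslit\<close> both vanish; its
      points are counted with the half-plane.\<close>
    have "hslit X = 0 \<or> (X$3 = 0 \<and> rad X \<le> 1)"
    proof (cases "rad X = 0")
      case True
      then show ?thesis using hslit_le[of X] hslit_nonneg[of X] by simp
    next
      case False
      then show ?thesis using that(1) dslit_eq_0_iff[of X] by (simp add: slits_def)
    qed
    then show ?thesis using 1 2 that(2) by blast
  qed
  have "X \<in> slits \<and> zabs X = t" if "X \<in> hembed ` cassini t \<union> dembed ` {c. (norm c)\<^sup>2 = 1 - t}" for X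
    using 3[of X] 4[of X] that unfolding slits_def by blast
  with 5 show ?thesis unfolding fib by blast
qed

section \<open>Bilipschitz types of the fibers\<close>

lemma fiber_0: "bilipschitz_equivalent (hmap -` {0}) unit_circle"
proof -
  have "cassini 0 \<subseteq> {1}"
  proof
    fix w assume "w \<in> cassini 0"
    then have "w\<^sup>2 = 1" "Re w \<ge> 0" by (simp_all add: cassini_def)
    then show "w \<in> {1}" by (auto simp: power2_eq_1_iff)
  qed
  moreover have "{c::complex. (norm c)\<^sup>2 = 1 - 0} = sphere 0 1"
    by (auto simp: power2_eq_1_iff) (smt (verit) norm_ge_zero)
  \<comment> \<open>The half-plane contributes the single point w = 1, which already lies on the
    circle.\<close>
  moreover have "hembed 1 = dembed 1" by (simp add: hembed_def dembed_def)
  ultimately have "hmap -` {- (0 *\<^sub>R e_x)} = dembed ` sphere 0 1"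
    using fiber_ray[of 0] by force
  then show ?thesis
    using bilipschitz_equivalent_isometry[of "sphere 0 1" dembed] dist_dembed by simp
qed

lemma cassini_norm_bounds:
  assumes "w \<in> cassini t"
  shows "(norm w)\<^sup>2 \<le> 1 + t" "1 - t \<le> Re (w\<^sup>2)"
proof -
  have t: "norm (w\<^sup>2 - 1) = t" using assms by (simp add: cassini_def)
  show "(norm w)\<^sup>2 \<le> 1 + t"
    using norm_triangle_ineq2[of "w\<^sup>2" 1] t by (simp add: norm_power)
  show "1 - t \<le> Re (w\<^sup>2)" using abs_Re_le_cmod[of "w\<^sup>2 - 1"] t by simp
qed

text \<open>The circle is rescaled, and the Cassini loop is mapped to the unit circle by w -> (1 -
  w^2)/t, which is bilipschitz because the loop keeps away from 0. The two curves lie in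
  perpendicular planes on opposite sides of their common point, so the distance between them is
  comparable to that in the product.\<close>

lemma fiber_figure_eight:
  assumes t: "0 < t" "t < 1"
  shows "bilipschitz_equivalent (hmap -` {- (t *\<^sub>R e_x)}) figure_eight"
proof -
  define r where "r = sqrt (1 - t)"
  have r: "0 < r" "r\<^sup>2 = 1 - t" using t by (auto simp: r_def)
  have r1: "r < 1" using r t by (smt (verit) one_le_power)
  define S1 S2 where "S1 = dembed ` {c. norm c = r}" and "S2 = hembed ` cassini t"
  have fib: "hmap -` {- (t *\<^sub>R e_x)} = S1 \<union> S2"
  proof -
    have "(norm c)\<^sup>2 = 1 - t \<longleftrightarrow> norm c = r" for c :: complex
      using r by (metis norm_ge_zero power2_eq_iff_nonneg less_imp_le)
    then show ?thesis using fiber_ray[of t] t by (auto simp: S1_def S2_def)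
  qed
  \<comment> \<open>(Re w)^2 \<ge> Re(w^2) \<ge> 1 - t. This keeps |w + w'| away from 0 and puts the
    loop beyond the circle.\<close>
  have Re_ge: "r \<le> Re w" if "w \<in> cassini t" for w
  proof (rule power2_le_imp_le)
    show "r\<^sup>2 \<le> (Re w)\<^sup>2" using cassini_norm_bounds(2)[OF that] r
      by (simp add: power2_eq_square) (smt (verit) zero_le_square)
    show "0 \<le> Re w" using that by (simp add: cassini_def)
  qed
  \<comment> \<open>The common point lies in \<open>S1\<close> and is sent to (1, 1);
    \<open>fh\<close> checks that the other formula gives the same value there.\<close>
  define f where "f X = (if X \<in> S1 then (Complex (- X$1) (X$2) / r, 1) else (1, (1 - (Complex (- X$1) (X$3))\<^sup>2) / t))"
    for X :: "real^3"
  have fd: "f (dembed c) = (c / r, 1)" if "norm c = r" for c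
    using that by (simp add: f_def S1_def) (simp add: dembed_def)
  have fh: "f (hembed w) = (1, (1 - w\<^sup>2) / t)" if w: "w \<in> cassini t" for w
  proof (cases "hembed w \<in> S1")
    case True
    then obtain c where c: "norm c = r" "hembed w = dembed c" unfolding S1_def by blast
    then have e: "Re w = Re c" "Im c = 0" "Im w = 0" by (simp_all add: hembed_def dembed_def vec_eq_iff forall_3)
    then have "\<bar>Re c\<bar> = r" using c(1) by (simp add: cmod_def)
    then have "Re c = r" using e w by (simp add: cassini_def)
    then have "c = r" "w = r" using e by (simp_all add: complex_eq_iff)
    moreover from this have "(1 - w\<^sup>2) / t = 1" using r t by (simp add: power2_eq_square flip: of_real_mult)
    ultimately show ?thesis using c fd[OF c(1)] r by simp
  qed (simp add: f_def, simp add: hembed_def)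
  have im: "f ` (S1 \<union> S2) = figure_eight"
  proof
    show "f ` (S1 \<union> S2) \<subseteq> figure_eight"
    proof (intro image_subsetI)
      fix X assume "X \<in> S1 \<union> S2"
      then consider c where "norm c = r" "X = dembed c" | w where "w \<in> cassini t" "X = hembed w"
        unfolding S1_def S2_def by blast
      then show "f X \<in> figure_eight"
      proof cases
        case 1
        then show ?thesis using r by (simp add: fd figure_eight_def norm_divide)
      next
        case 2
        then have "norm (1 - w\<^sup>2) = t" by (simp add: cassini_def norm_minus_commute)
        then show ?thesis using 2 t by (simp add: fh figure_eight_def norm_divide)
      qed
    qed
    show "figure_eight \<subseteq> f ` (S1 \<union> S2)"
    proof
      fix p assume "p \<in> figure_eight"
      then consider e where "norm e = 1" "p = (e, 1)" | e where "norm e = 1" "p = (1, e)"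
        unfolding figure_eight_def by auto
      then show "p \<in> f ` (S1 \<union> S2)"
      proof cases
        case 1
        then have "norm (r * e) = r" using r by (simp add: norm_mult)
        moreover from this have "f (dembed (r * e)) = p" using fd[of "r * e"] 1 r by simp
        ultimately show ?thesis unfolding S1_def by blast
      next
        case 2
        define w where "w = csqrt (1 - t * e)"
        have "w \<in> cassini t" using 2 t csqrt_principal[of "1 - t * e"]
          by (auto simp: cassini_def w_def norm_mult)
        moreover from this have "f (hembed w) = p" using fh[of w] 2 t by (simp add: w_def)
        ultimately show ?thesis unfolding S2_def by blast
      qed
    qed
  qed
  \<comment> \<open>1/r is the scale factor on the circle. On the loop the factor is |w + w'|/t,
    where |w + w'| is at least r and at most 4.\<close>
  define m M where "m = min (1 / r) (r / t)" and "M = max (1 / r) (4 / t)"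
  have m: "0 < m" "m \<le> 1 / r" "m \<le> r / t" using r t by (auto simp: m_def)
  have M: "1 / r \<le> M" "4 / t \<le> M" by (auto simp: M_def)
  have M0: "0 < M" using M(2) t by (smt (verit) divide_pos_pos)
  have w2: "norm w \<le> 2" if "w \<in> cassini t" for w
  proof (rule power2_le_imp_le)
    show "(norm w)\<^sup>2 \<le> 2\<^sup>2" using cassini_norm_bounds(1)[OF that] t by simp
  qed simp
  have sq: "m * norm (w - w') \<le> norm (w\<^sup>2 - w'\<^sup>2) / t" "norm (w\<^sup>2 - w'\<^sup>2) / t \<le> M * norm (w - w')"
    if "r \<le> Re w" "r \<le> Re w'" "norm w \<le> 2" "norm w' \<le> 2" for w w' :: complex
  proof -
    have e: "norm (w\<^sup>2 - w'\<^sup>2) / t = (norm (w + w') / t) * norm (w - w')"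
      by (simp add: norm_mult[symmetric] square_diff_square_factored power2_eq_square mult.commute)
    have "r \<le> norm (w + w')" using complex_Re_le_cmod[of "w + w'"] that r by simp
    then have "r / t \<le> norm (w + w') / t" using t by (intro divide_right_mono) auto
    then have "m \<le> norm (w + w') / t" using m by linarith
    then show "m * norm (w - w') \<le> norm (w\<^sup>2 - w'\<^sup>2) / t" unfolding e by (intro mult_right_mono) auto
    have "norm (w + w') \<le> 4" using norm_triangle_ineq[of w w'] that by linarith
    then have "norm (w + w') / t \<le> 4 / t" using t by (intro divide_right_mono) auto
    then have "norm (w + w') / t \<le> M" using M by linarith
    then show "norm (w\<^sup>2 - w'\<^sup>2) / t \<le> M * norm (w - w')" unfolding e by (intro mult_right_mono) auto
  qed
  \<comment> \<open>The offsets x and y from the common point are both nonnegative, so they add up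
    without cancellation: d^2 lies between P^2 + Q^2 and four times this sum. The factor 4 is why m
    is halved.\<close>
  have mixed: "(m / 2) * dist (dembed c) (hembed w) \<le> dist (f (dembed c)) (f (hembed w)) \<and>
      dist (f (dembed c)) (f (hembed w)) \<le> M * dist (dembed c) (hembed w)"
    if c: "norm c = r" and w: "w \<in> cassini t" for c w
  proof -
    let ?P = "norm (c - r)" and ?Q = "norm (w - r)"
    define d where "d = dist (dembed c) (hembed w)"
    define x y where "x = Re w - r" and "y = r - Re c"
    have xy: "x \<ge> 0" "y \<ge> 0" using Re_ge[OF w] complex_Re_le_cmod[of c] c by (auto simp: x_def y_def)
    have d2: "d\<^sup>2 = (x + y)\<^sup>2 + (Im c)\<^sup>2 + (Im w)\<^sup>2"
      unfolding d_def dist_norm norm_real3_sq by (simp add: dembed_def hembed_def x_def y_def)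
    have P: "?P\<^sup>2 = y\<^sup>2 + (Im c)\<^sup>2" and Q: "?Q\<^sup>2 = x\<^sup>2 + (Im w)\<^sup>2"
      by (simp_all add: cmod_power2 x_def y_def power2_commute)
    have "0 \<le> x * y" using xy by simp
    then have lo: "?P\<^sup>2 + ?Q\<^sup>2 \<le> d\<^sup>2" unfolding d2 P Q by (simp add: power2_sum)
    have aux: "a + b + e + p + q \<le> 4 * (b + p + (a + q))"
      if "e \<le> a + b" "0 \<le> a" "0 \<le> b" "0 \<le> p" "0 \<le> q" for a b e p q :: real
      using that by argo
    have up: "d\<^sup>2 \<le> 4 * (?P\<^sup>2 + ?Q\<^sup>2)"
      unfolding d2 P Q power2_sum by (intro aux sum_squares_bound zero_le_power2)
    define D where "D = dist (f (dembed c)) (f (hembed w))"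
    have D2: "D\<^sup>2 = (?P / r)\<^sup>2 + (norm (w\<^sup>2 - (of_real r)\<^sup>2) / t)\<^sup>2"
    proof -
      have "c / r - 1 = (c - r) / r" using r by (simp add: diff_divide_distrib)
      then have 1: "dist (c / r) 1 = ?P / r" using r by (simp add: dist_norm norm_divide)
      have "1 - (1 - w\<^sup>2) / t = (w\<^sup>2 - (of_real r)\<^sup>2) / t"
      proof -
        have "(of_real r :: complex)\<^sup>2 = 1 - of_real t" using r(2) by (metis of_real_1 of_real_diff of_real_power)
        then show ?thesis using t by (simp add: field_simps)
      qed
      then have 2: "dist 1 ((1 - w\<^sup>2) / t) = norm (w\<^sup>2 - (of_real r)\<^sup>2) / t" using t by (simp add: dist_norm norm_divide)
      show ?thesis by (simp add: D_def fd[OF c] fh[OF w] dist_Pair_Pair 1 2)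
    qed
    note s = sq[of w "of_real r", OF Re_ge[OF w] _ w2[OF w]]
    have s1: "m * ?Q \<le> norm (w\<^sup>2 - (of_real r)\<^sup>2) / t" "norm (w\<^sup>2 - (of_real r)\<^sup>2) / t \<le> M * ?Q"
      using s r r1 by auto
    have p1: "m * ?P \<le> ?P / r" "?P / r \<le> M * ?P"
      using mult_right_mono[OF m(2), of ?P] mult_right_mono[OF M(1), of ?P] by auto
    have "m * ?P \<ge> 0" "m * ?Q \<ge> 0" using m by auto
    then have "(m * ?P)\<^sup>2 + (m * ?Q)\<^sup>2 \<le> D\<^sup>2" unfolding D2
      using s1 p1 by (intro add_mono power_mono) auto
    moreover have "m\<^sup>2 * d\<^sup>2 \<le> m\<^sup>2 * (4 * (?P\<^sup>2 + ?Q\<^sup>2))" using up by (intro mult_left_mono) auto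
    ultimately have "((m / 2) * d)\<^sup>2 \<le> D\<^sup>2" by (simp add: power_mult_distrib power_divide distrib_left)
    then have 1: "(m / 2) * d \<le> D" by (rule power2_le_imp_le) (simp add: D_def)
    have "D\<^sup>2 \<le> (M * ?P)\<^sup>2 + (M * ?Q)\<^sup>2" unfolding D2
      using s1 p1 r t by (intro add_mono power_mono) auto
    also have "\<dots> = M\<^sup>2 * (?P\<^sup>2 + ?Q\<^sup>2)" by (simp add: power_mult_distrib distrib_left)
    also have "\<dots> \<le> M\<^sup>2 * d\<^sup>2" using lo by (intro mult_left_mono) auto
    finally have "D\<^sup>2 \<le> (M * d)\<^sup>2" by (simp add: power_mult_distrib)
    then have "D \<le> M * d" by (rule power2_le_imp_le) (use M0 in \<open>simp add: d_def\<close>)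
    with 1 show ?thesis by (simp add: D_def d_def)
  qed
  show ?thesis unfolding fib
  proof (rule bilipschitz_equivalentI[OF im, of "m / 2" M])
    show "m / 2 > 0" using m by simp
    fix X Y assume XY: "X \<in> S1 \<union> S2" "Y \<in> S1 \<union> S2"
    have "(m / 2) * dist X Y \<le> dist (f X) (f Y) \<and> dist (f X) (f Y) \<le> M * dist X Y"
    proof -
      consider (dd) c c' where "norm c = r" "X = dembed c" "norm c' = r" "Y = dembed c'"
        | (dh) c w where "norm c = r" "X = dembed c" "w \<in> cassini t" "Y = hembed w"
        | (hd) c w where "norm c = r" "Y = dembed c" "w \<in> cassini t" "X = hembed w"
        | (hh) w w' where "w \<in> cassini t" "X = hembed w" "w' \<in> cassini t" "Y = hembed w'"
        using XY unfolding S1_def S2_def by blast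
      then show ?thesis
      proof cases
        case dd
        have D: "dist (f X) (f Y) = (1 / r) * dist X Y"
          using dd r by (simp add: fd dist_dembed dist_Pair_Pair)
            (simp add: dist_norm diff_divide_distrib[symmetric] norm_divide)
        have "m / 2 \<le> 1 / r" using m by linarith
        then show ?thesis unfolding D using M(1) by (intro conjI mult_right_mono) auto
      next
        case dh
        then show ?thesis using mixed by blast
      next
        case hd
        then show ?thesis using mixed by (simp add: dist_commute)
      next
        case hh
        have "(1 - w\<^sup>2) / t - (1 - w'\<^sup>2) / t = (w'\<^sup>2 - w\<^sup>2) / t" by (simp add: diff_divide_distrib)
        then have D: "dist (f X) (f Y) = norm (w\<^sup>2 - w'\<^sup>2) / t"
          using hh t by (simp add: fh dist_Pair_Pair) (simp add: dist_norm norm_divide norm_minus_commute)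
        have X: "dist X Y = norm (w - w')" using hh by (simp add: dist_hembed) (simp add: dist_norm)
        have "m / 2 * norm (w - w') \<le> m * norm (w - w')" using m by (intro mult_right_mono) auto
        then show ?thesis unfolding D X
          using sq[OF Re_ge[OF hh(1)] Re_ge[OF hh(3)] w2[OF hh(1)] w2[OF hh(3)]] by linarith
      qed
    qed
    then show "m / 2 * dist X Y \<le> dist (f X) (f Y)" "dist (f X) (f Y) \<le> M * dist X Y" by auto
  qed
qed

lemma norm_complex_inverse_diff:
  fixes a b :: complex assumes "a \<noteq> 0" "b \<noteq> 0"
  shows "norm (inverse a - inverse b) = norm (a - b) / (norm a * norm b)"
  using norm_inverse_diff_complex[OF assms] by (simp add: divide_inverse)

text \<open>For m = 1/w the equation |w^2 - 1| = 1 becomes |1 - m^2| = |m^2|: the point m^2 is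
  equidistant from 0 and 1, so Re(m^2) = 1/2, a rectangular hyperbola.\<close>

lemma cassini_1_inverse:
  assumes "w \<noteq> 0"
  shows "w \<in> cassini 1 \<longleftrightarrow> Re (inverse w) > 0 \<and> (Re (inverse w))\<^sup>2 = 1/2 + (Im (inverse w))\<^sup>2"
proof -
  define m where "m = inverse w"
  have half: "(norm (1 - M))\<^sup>2 = (norm M)\<^sup>2 \<longleftrightarrow> Re M = 1/2" for M :: complex
    unfolding cmod_power2 by (auto simp: power2_eq_square algebra_simps)
  have m: "m \<noteq> 0" "w = inverse m" using assms by (auto simp: m_def)
  have "w\<^sup>2 - 1 = (1 - m\<^sup>2) / m\<^sup>2" unfolding m(2) power_inverse using m(1) by (simp add: field_simps)
  then have "norm (w\<^sup>2 - 1) = 1 \<longleftrightarrow> norm (1 - m\<^sup>2) = norm (m\<^sup>2)"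
    using m(1) by (auto simp: norm_divide)
  also have "\<dots> \<longleftrightarrow> (norm (1 - m\<^sup>2))\<^sup>2 = (norm (m\<^sup>2))\<^sup>2" by (simp add: power2_eq_iff_nonneg)
  also have "\<dots> \<longleftrightarrow> Re (m\<^sup>2) = 1/2"
    by (rule half)
  also have "\<dots> \<longleftrightarrow> (Re m)\<^sup>2 = 1/2 + (Im m)\<^sup>2" by (auto simp: power2_eq_square)
  finally have 1: "norm (w\<^sup>2 - 1) = 1 \<longleftrightarrow> (Re m)\<^sup>2 = 1/2 + (Im m)\<^sup>2" .
  have "(norm m)\<^sup>2 > 0" using m by simp
  moreover have "Re w = Re m / (norm m)\<^sup>2" by (simp add: m(2) Re_inverse cmod_power2)
  ultimately have 2: "Re w \<ge> 0 \<longleftrightarrow> Re m \<ge> 0" by (simp add: zero_le_divide_iff)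
  have 3: "Re m \<noteq> 0" if "(Re m)\<^sup>2 = 1/2 + (Im m)\<^sup>2"
  proof
    assume "Re m = 0"
    then have "1/2 + (Im m)\<^sup>2 = 0" using that by simp
    then show False using zero_le_power2[of "Im m"] by linarith
  qed
  show ?thesis unfolding cassini_def m_def[symmetric] using 1 2 3 by auto
qed

text \<open>Inversion turns the half lemniscate into a hyperbola branch, which is a graph over the
  vertical axis, and the circle minus a point into a vertical line.\<close>

lemma cassini_1: "bilipschitz_equivalent (cassini 1) unit_circle"
proof -
  define k where "k w = Complex (1/2) (Im (inverse w))" for w
  \<comment> \<open>Inversion maps the line Re = 1/2 to the circle |a - 1| = 1 without 0. The point
    w = 0 corresponds to infinity on the hyperbola and is sent to the missing point.\<close>
  define g where "g w = (if w = 0 then -1 else inverse (k w) - 1)" for w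
  have k0: "k w \<noteq> 0" for w by (simp add: k_def complex_eq_iff)
  \<comment> \<open>On the hyperbola |m|^2 = 1/2 + 2 (Im m)^2, exactly twice 1/4 + (Im m)^2. So
    inverting the hyperbola and inverting the line scale distances by the same factor up to
    2.\<close>
  have k: "(norm (k w))\<^sup>2 = (norm (inverse w))\<^sup>2 / 2" if "w \<in> cassini 1" "w \<noteq> 0" for w
    unfolding cmod_power2 k_def using that cassini_1_inverse[of w] by (simp add: power_divide del: inverse_complex.sel)
  have k': "norm (k w) = norm (inverse w) / sqrt 2" if "w \<in> cassini 1" "w \<noteq> 0" for w
    by (rule power2_eq_imp_eq) (simp_all only: k[OF that], simp_all add: power_divide)
  have circ: "norm (inverse a - 1) = 1" if "Re a = 1/2" for a :: complex
  proof -
    have a: "a \<noteq> 0" using that by auto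
    then have "inverse a - 1 = (1 - a) / a" by (simp add: field_simps)
    moreover have "norm (1 - a) = norm a" by (rule power2_eq_imp_eq) (simp_all add: cmod_power2 that)
    ultimately show ?thesis using a by (simp add: norm_divide)
  qed
  have im: "g ` cassini 1 = unit_circle"
  proof
    show "g ` cassini 1 \<subseteq> unit_circle"
      using circ by (auto simp: g_def k_def)
    show "unit_circle \<subseteq> g ` cassini 1"
    proof
      fix e :: complex assume e: "e \<in> unit_circle"
      show "e \<in> g ` cassini 1"
      proof (cases "e = -1")
        case True
        have "0 \<in> cassini 1" by (simp add: cassini_def)
        then show ?thesis using True by (force simp: g_def)
      next
        case False
        define a where "a = inverse (1 + e)"
        have e1: "1 + e \<noteq> 0" using False by (metis add.commute add_eq_0_iff)
        have "(Re e)\<^sup>2 + (Im e)\<^sup>2 = 1" using e by (simp add: cmod_power2[symmetric])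
        then have "(1 + Re e)\<^sup>2 + (Im e)\<^sup>2 = 2 * (1 + Re e)" by (simp add: power2_sum)
        moreover have "(norm (1 + e))\<^sup>2 = (1 + Re e)\<^sup>2 + (Im e)\<^sup>2" by (simp add: cmod_power2)
        ultimately have n: "(norm (1 + e))\<^sup>2 = 2 * (1 + Re e)" by simp
        have "Re a = (1 + Re e) / (norm (1 + e))\<^sup>2" by (simp add: a_def Re_inverse cmod_power2)
        moreover have "(norm (1 + e))\<^sup>2 \<noteq> 0" using e1 by simp
        ultimately have "Re a = (1 + Re e) / (2 * (1 + Re e))" "1 + Re e \<noteq> 0" unfolding n by simp_all
        moreover have "x / (2 * x) = 1/2" if "x \<noteq> 0" for x :: real using that by simp
        ultimately have a: "Re a = 1/2" by metis
        \<comment> \<open>The point of the hyperbola branch at the height of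
          \<open>a\<close>.\<close>
        define m where "m = Complex (sqrt (1/2 + (Im a)\<^sup>2)) (Im a)"
        have p: "1/2 + (Im a)\<^sup>2 > 0" by (simp add: add_pos_nonneg)
        then have "m \<noteq> 0" by (simp add: m_def complex_eq_iff)
        then have w: "inverse m \<noteq> 0" by simp
        have "inverse m \<in> cassini 1"
          unfolding cassini_1_inverse[OF w] using p by (simp add: m_def del: inverse_complex.sel)
        moreover have "k (inverse m) = a" using a by (simp add: k_def m_def complex_eq_iff del: inverse_complex.sel)
        then have "g (inverse m) = e" using w by (simp add: g_def a_def)
        ultimately show ?thesis by blast
      qed
    qed
  qed
  have both: "1 * dist w w' \<le> dist (g w) (g w') \<and> dist (g w) (g w') \<le> 2 * dist w w'"
    if w: "w \<in> cassini 1" and w': "w' \<in> cassini 1" for w w'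
  proof -
    have zero: "1 * dist w w' \<le> dist (g w) (g w') \<and> dist (g w) (g w') \<le> 2 * dist w w'"
      if "w \<in> cassini 1" "w \<noteq> 0" "w' = 0" for w w'
    proof -
      have "dist (g w) (g w') = inverse (norm (k w))"
        using that by (simp add: g_def dist_norm norm_inverse)
      also have "\<dots> = sqrt 2 * norm w" by (simp only: k'[OF that(1,2)] norm_inverse) (simp add: divide_inverse mult.commute)
      finally have d: "dist (g w) (g w') = sqrt 2 * dist w w'" using that by simp
      have "1 \<le> sqrt 2" "sqrt 2 \<le> 2" by (auto intro: real_le_lsqrt)
      then show ?thesis unfolding d by (intro conjI mult_right_mono) auto
    qed
    consider "w = 0" "w' = 0" | "w \<noteq> 0" "w' = 0" | "w = 0" "w' \<noteq> 0" | "w \<noteq> 0" "w' \<noteq> 0" by blast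
    then show ?thesis
    proof cases
      case 4
      define m m' where "m = inverse w" and "m' = inverse w'"
      have m0: "m \<noteq> 0" "m' \<noteq> 0" "w = inverse m" "w' = inverse m'" using 4 by (auto simp: m_def m'_def)
      have h: "Re m > 0" "(Re m)\<^sup>2 = 1/2 + (Im m)\<^sup>2" "Re m' > 0" "(Re m')\<^sup>2 = 1/2 + (Im m')\<^sup>2"
        using cassini_1_inverse 4 w w' by (auto simp: m_def m'_def)
      define b where "b = \<bar>Im m - Im m'\<bar>"
      have P: "norm (k w) * norm (k w') = norm m * norm m' / 2"
        using k'[OF w] k'[OF w'] 4 by (simp add: m_def m'_def)
      have b: "norm (k w - k w') = b" by (simp add: k_def b_def cmod_def m_def m'_def del: inverse_complex.sel)
      have "dist (g w) (g w') = norm (k w - k w') / (norm (k w) * norm (k w'))"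
        using 4 by (simp add: g_def dist_norm norm_complex_inverse_diff[OF k0 k0])
      then have dg: "dist (g w) (g w') = 2 * b / (norm m * norm m')" unfolding P b by simp
      have dw: "dist w w' = norm (m - m') / (norm m * norm m')"
        unfolding dist_norm m0(3,4) by (rule norm_complex_inverse_diff[OF m0(1,2)])
      have lo: "b \<le> norm (m - m')" using abs_Im_le_cmod[of "m - m'"] by (simp add: b_def)
      \<comment> \<open>The branch lies between its asymptotes, so as a graph over the imaginary
        axis it has slope at most 1.\<close>
      have "\<bar>Im m\<bar> \<le> Re m" "\<bar>Im m'\<bar> \<le> Re m'"
        using h by (auto intro!: power2_le_imp_le[of "\<bar>_\<bar>"])
      then have s: "\<bar>Im m + Im m'\<bar> \<le> Re m + Re m'" by linarith
      have sq: "\<bar>x\<^sup>2 - y\<^sup>2\<bar> = \<bar>x - y\<bar> * \<bar>x + y\<bar>" for x y :: real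
        by (simp add: power2_eq_square square_diff_square_factored abs_mult mult.commute)
      have "\<bar>Re m - Re m'\<bar> * (Re m + Re m') = \<bar>(Re m)\<^sup>2 - (Re m')\<^sup>2\<bar>"
        unfolding sq using h by simp
      also have "\<dots> = \<bar>(Im m)\<^sup>2 - (Im m')\<^sup>2\<bar>" using h by simp
      also have "\<dots> = b * \<bar>Im m + Im m'\<bar>" unfolding sq b_def ..
      also have "\<dots> \<le> b * (Re m + Re m')" using s by (intro mult_left_mono) (auto simp: b_def)
      finally have "\<bar>Re m - Re m'\<bar> \<le> b" using h by simp
      then have up: "norm (m - m') \<le> 2 * b"
        using cmod_le[of "m - m'"] by (simp add: b_def)
      have "norm m * norm m' > 0" using m0 by simp
      then have "norm (m - m') / (norm m * norm m') \<le> 2 * b / (norm m * norm m')"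
        "2 * b / (norm m * norm m') \<le> 2 * norm (m - m') / (norm m * norm m')"
        using lo up by (auto intro!: divide_right_mono)
      then show ?thesis unfolding dg dw by simp
    qed (use zero[OF w, of w'] zero[OF w', of w] in \<open>auto simp: dist_commute\<close>)
  qed
  show ?thesis by (rule bilipschitz_equivalentI[OF im, of 1 2]) (use both in auto)
qed

lemma fiber_1: "bilipschitz_equivalent (hmap -` {- e_x}) unit_circle"
proof -
  have "dembed ` {c. (norm c)\<^sup>2 = 1 - (1::real)} \<subseteq> hembed ` cassini 1"
  proof -
    have "dembed 0 = hembed 0" "0 \<in> cassini 1" by (simp_all add: dembed_def hembed_def cassini_def)
    then show ?thesis by force
  qed
  then have "hmap -` {- e_x} = hembed ` cassini 1" using fiber_ray[of 1] by auto
  then show ?thesis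
    using bilipschitz_equivalent_trans[OF bilipschitz_equivalent_isometry[of "cassini 1" hembed] cassini_1]
      dist_hembed by simp
qed

text \<open>The point e^(i\<alpha>) with \<tau> = tan(\<alpha>/2); the interval |\<tau>| \<le> 1
  gives the right half of the unit circle.\<close>

definition cayley :: "real \<Rightarrow> complex" where
  "cayley \<tau> = Complex (1 - \<tau>\<^sup>2) (2 * \<tau>) / of_real (1 + \<tau>\<^sup>2)"

lemma cayley_eq: "cayley \<tau> = Complex 1 \<tau> / Complex 1 (- \<tau>)"
proof -
  have "1 + \<tau>\<^sup>2 > 0" by (simp add: add_pos_nonneg)
  moreover have "Complex 1 (- \<tau>) \<noteq> 0" by (simp add: complex_eq_iff)
  moreover have "Complex (1 - \<tau>\<^sup>2) (2 * \<tau>) * Complex 1 (- \<tau>) = Complex 1 \<tau> * of_real (1 + \<tau>\<^sup>2)"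
    by (simp add: complex_eq_iff power2_eq_square algebra_simps)
  ultimately show ?thesis unfolding cayley_def
    by (subst frac_eq_eq) (auto simp: complex_eq_iff)
qed

text \<open>The difference is 2i (\<tau> - \<sigma>) / ((1 - i \<tau>)(1 - i \<sigma>)), and both
  factors of the denominator have modulus between 1 and sqrt 2.\<close>

lemma dist_cayley:
  assumes "\<bar>\<tau>\<bar> \<le> 1" "\<bar>\<sigma>\<bar> \<le> 1"
  shows "\<bar>\<tau> - \<sigma>\<bar> \<le> norm (cayley \<tau> - cayley \<sigma>)" "norm (cayley \<tau> - cayley \<sigma>) \<le> 2 * \<bar>\<tau> - \<sigma>\<bar>"
proof -
  let ?a = "Complex 1 (- \<tau>)" and ?b = "Complex 1 (- \<sigma>)"
  have nz: "?a \<noteq> 0" "?b \<noteq> 0" by (simp_all add: complex_eq_iff)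
  have "cayley \<tau> - cayley \<sigma> = (Complex 1 \<tau> * ?b - Complex 1 \<sigma> * ?a) / (?a * ?b)"
    unfolding cayley_eq using nz by (simp add: diff_frac_eq mult.commute)
  also have "Complex 1 \<tau> * ?b - Complex 1 \<sigma> * ?a = Complex 0 (2 * (\<tau> - \<sigma>))"
    by (simp add: complex_eq_iff algebra_simps)
  finally have d: "cayley \<tau> - cayley \<sigma> = Complex 0 (2 * (\<tau> - \<sigma>)) / (?a * ?b)" .
  have "norm (Complex 0 (2 * (\<tau> - \<sigma>))) = 2 * \<bar>\<tau> - \<sigma>\<bar>"
    by (simp add: cmod_def power_mult_distrib real_sqrt_mult del: right_diff_distrib_numeral)
  then have e: "norm (cayley \<tau> - cayley \<sigma>) = 2 * \<bar>\<tau> - \<sigma>\<bar> / (norm ?a * norm ?b)"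
    unfolding d norm_divide norm_mult by simp
  have bd: "1 \<le> norm (Complex 1 (- \<rho>))" "norm (Complex 1 (- \<rho>)) \<le> sqrt 2" if "\<bar>\<rho>\<bar> \<le> 1" for \<rho>
    using that by (auto simp: cmod_def abs_square_le_1)
  have "1 * 1 \<le> norm ?a * norm ?b" using bd assms by (intro mult_mono) auto
  moreover have "norm ?a * norm ?b \<le> sqrt 2 * sqrt 2" using bd assms by (intro mult_mono) auto
  ultimately have p: "1 \<le> norm ?a * norm ?b" "norm ?a * norm ?b \<le> 2" by auto
  have "2 * \<bar>\<tau> - \<sigma>\<bar> / (norm ?a * norm ?b) \<ge> 2 * \<bar>\<tau> - \<sigma>\<bar> / 2"
    using p by (intro divide_left_mono) auto
  then show "\<bar>\<tau> - \<sigma>\<bar> \<le> norm (cayley \<tau> - cayley \<sigma>)" unfolding e by simp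
  have "2 * \<bar>\<tau> - \<sigma>\<bar> / (norm ?a * norm ?b) \<le> 2 * \<bar>\<tau> - \<sigma>\<bar> / 1"
    using p by (intro divide_left_mono) auto
  then show "norm (cayley \<tau> - cayley \<sigma>) \<le> 2 * \<bar>\<tau> - \<sigma>\<bar>" unfolding e by simp
qed

lemma norm_cayley: "norm (cayley \<tau>) = 1"
proof -
  have "norm (Complex 1 \<tau>) = norm (Complex 1 (- \<tau>))" by (simp add: cmod_def)
  moreover have "Complex 1 (- \<tau>) \<noteq> 0" by (simp add: complex_eq_iff)
  ultimately show ?thesis unfolding cayley_eq by (simp add: norm_divide)
qed

text \<open>The polar equation of the oval: a point at distance n in direction e satisfies n^4 - 2
  n^2 Re(e^2) + 1 = t^2. For t > 1 it has exactly one positive solution n.\<close>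

definition cas_radius :: "real \<Rightarrow> complex \<Rightarrow> real" where
  "cas_radius t e = sqrt (Re (e\<^sup>2) + sqrt ((Re (e\<^sup>2))\<^sup>2 + (t\<^sup>2 - 1)))"

lemma cas_radius:
  assumes t: "t > 1" and e: "norm e = 1"
  shows "t - 1 \<le> (cas_radius t e)\<^sup>2" "0 < cas_radius t e" "norm ((cas_radius t e *\<^sub>R e)\<^sup>2 - 1) = t"
proof -
  define C where "C = Re (e\<^sup>2)"
  have s: "t\<^sup>2 - 1 > 0" using t by (simp add: one_less_power)
  have "\<bar>C\<bar> < sqrt (C\<^sup>2 + (t\<^sup>2 - 1))" using s by (intro real_less_rsqrt) simp
  then have p: "C + sqrt (C\<^sup>2 + (t\<^sup>2 - 1)) > 0" by linarith
  then have n2: "(cas_radius t e)\<^sup>2 = C + sqrt (C\<^sup>2 + (t\<^sup>2 - 1))" by (simp add: cas_radius_def C_def)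
  show n0: "0 < cas_radius t e" using p by (simp add: cas_radius_def C_def)
  define n where "n = cas_radius t e"
  have "(n\<^sup>2 - C)\<^sup>2 = C\<^sup>2 + (t\<^sup>2 - 1)" using n2 s by (simp add: n_def)
  then have q: "(n\<^sup>2)\<^sup>2 - 2 * n\<^sup>2 * C + 1 = t\<^sup>2" by (simp add: power2_diff)
  have "(norm ((n *\<^sub>R e)\<^sup>2 - 1))\<^sup>2 = (norm (n\<^sup>2 *\<^sub>R e\<^sup>2))\<^sup>2 - 2 * Re (n\<^sup>2 *\<^sub>R e\<^sup>2) + 1"
  proof -
    have "(norm (M - 1))\<^sup>2 = (norm M)\<^sup>2 - 2 * Re M + 1" for M :: complex
      unfolding cmod_power2 by (simp add: power2_diff)
    then show ?thesis by (simp add: power_mult_distrib scaleR_conv_of_real)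
  qed
  also have "\<dots> = t\<^sup>2" using q e by (simp add: norm_power C_def)
  finally show nt: "norm ((cas_radius t e *\<^sub>R e)\<^sup>2 - 1) = t"
    unfolding n_def using t by (metis norm_ge_zero power2_eq_iff_nonneg less_imp_le order_trans zero_le_one)
  have a: "norm ((n *\<^sub>R e)\<^sup>2) = n\<^sup>2" using e by (simp add: norm_power)
  have "t \<le> n\<^sup>2 + norm (1::complex)"
    using norm_triangle_ineq4[of "(n *\<^sub>R e)\<^sup>2" 1] unfolding nt[folded n_def] a .
  then show "t - 1 \<le> (cas_radius t e)\<^sup>2" by (simp add: n_def)
qed

text \<open>For t > 1 the half oval is a radial graph over the right half circle, with a Lipschitz
  radius that is at least sqrt(t - 1).\<close>

lemma fiber_arc:
  assumes t: "t > 1"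
  shows "bilipschitz_equivalent (hmap -` {- (t *\<^sub>R e_x)}) {0..1::real}"
proof -
  have fib: "hmap -` {- (t *\<^sub>R e_x)} = hembed ` cassini t"
  proof -
    have "{c::complex. (norm c)\<^sup>2 = 1 - t} = {}" using t zero_le_power2 by (smt (verit) Collect_empty_eq)
    then show ?thesis using fiber_ray[of t] t by simp
  qed
  define f where "f x = (let e = cayley (2 * x - 1) in cas_radius t e *\<^sub>R e)" for x
  define r where "r = sqrt (t - 1)"
  have r: "r > 0" "r\<^sup>2 = t - 1" using t by (auto simp: r_def)
  have n: "r \<le> cas_radius t e" if "norm e = 1" for e
    using cas_radius(1,2)[OF t that] unfolding r_def by (simp add: real_le_lsqrt)
  have im: "f ` {0..1} = cassini t"
  proof
    show "f ` {0..1} \<subseteq> cassini t"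
    proof (intro image_subsetI)
      fix x :: real assume x: "x \<in> {0..1}"
      have "\<bar>2 * x - 1\<bar> \<le> 1" using x by auto
      then have "(2 * x - 1)\<^sup>2 \<le> 1" by (simp add: abs_square_le_1)
      moreover have "1 + (2 * x - 1)\<^sup>2 > 0" by (simp add: add_pos_nonneg)
      ultimately have "Re (cayley (2 * x - 1)) \<ge> 0" by (simp add: cayley_def Re_divide_of_real)
      then show "f x \<in> cassini t"
        using cas_radius(2,3)[OF t norm_cayley[of "2 * x - 1"]]
        by (simp add: f_def Let_def cassini_def)
    qed
    show "cassini t \<subseteq> f ` {0..1}"
    proof
      fix w assume w: "w \<in> cassini t"
      define m where "m = norm w"
      have m0: "m > 0" using w t by (auto simp: m_def cassini_def)
      define e where "e = w /\<^sub>R m"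
      have we: "w = m *\<^sub>R e" using m0 by (simp add: e_def)
      have e1: "norm e = 1" using m0 by (simp add: e_def m_def)
      have eR: "Re e \<ge> 0" using w m0 by (simp add: e_def cassini_def)
      have e2: "(Re e)\<^sup>2 + (Im e)\<^sup>2 = 1" using e1 by (simp flip: cmod_power2)
      define \<tau> where "\<tau> = Im e / (1 + Re e)"
      have "(Im e)\<^sup>2 = (1 - Re e) * (1 + Re e)" using e2 by (simp add: power2_eq_square algebra_simps)
      then have \<tau>2: "\<tau>\<^sup>2 = (1 - Re e) / (1 + Re e)"
        using eR by (simp add: \<tau>_def power_divide) (simp add: power2_eq_square)
      then have a: "1 + \<tau>\<^sup>2 = 2 / (1 + Re e)" "1 - \<tau>\<^sup>2 = 2 * Re e / (1 + Re e)" using eR by (simp_all add: field_simps)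
      have ce: "cayley \<tau> = e"
        unfolding cayley_def a using eR
        by (simp add: complex_eq_iff Re_divide_of_real Im_divide_of_real \<tau>_def)
      have "\<tau>\<^sup>2 \<le> 1" unfolding \<tau>2 using eR by (simp add: divide_le_eq)
      then have \<tau>1: "\<bar>\<tau>\<bar> \<le> 1" by (simp add: abs_square_le_1)
      define C where "C = Re (e\<^sup>2)"
      have "(norm ((m *\<^sub>R e)\<^sup>2 - 1))\<^sup>2 = (norm (m\<^sup>2 *\<^sub>R e\<^sup>2))\<^sup>2 - 2 * Re (m\<^sup>2 *\<^sub>R e\<^sup>2) + 1"
      proof -
        have "(norm (M - 1))\<^sup>2 = (norm M)\<^sup>2 - 2 * Re M + 1" for M :: complex
          unfolding cmod_power2 by (simp add: power2_diff)
        then show ?thesis by (simp add: power_mult_distrib scaleR_conv_of_real)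
      qed
      moreover have "norm ((m *\<^sub>R e)\<^sup>2 - 1) = t" using w we by (simp add: cassini_def)
      ultimately have "t\<^sup>2 = (m\<^sup>2)\<^sup>2 - 2 * (m\<^sup>2 * C) + 1" using e1 by (simp add: norm_power C_def)
      then have q: "(m\<^sup>2 - C)\<^sup>2 = C\<^sup>2 + (t\<^sup>2 - 1)" by (simp add: power2_diff)
      have "t\<^sup>2 - 1 > 0" using t by (simp add: one_less_power)
      \<comment> \<open>Selects the root used in \<open>cas_radius\<close>: otherwise 0 \<le> m^2 <
        C would give (m^2 - C)^2 \<le> C^2, while this square exceeds C^2.\<close>
      have "m\<^sup>2 - C \<ge> 0"
      proof (rule ccontr)
        assume neg: "\<not> m\<^sup>2 - C \<ge> 0"
        then have "\<bar>m\<^sup>2 - C\<bar> \<le> \<bar>C\<bar>" using zero_le_power2[of m] by linarith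
        then have "(m\<^sup>2 - C)\<^sup>2 \<le> C\<^sup>2" by (simp add: abs_le_square_iff)
        then show False using q \<open>t\<^sup>2 - 1 > 0\<close> by linarith
      qed
      then have "m\<^sup>2 - C = sqrt (C\<^sup>2 + (t\<^sup>2 - 1))" using q by (metis real_sqrt_unique)
      then have "m\<^sup>2 = C + sqrt (C\<^sup>2 + (t\<^sup>2 - 1))" by linarith
      then have "m = cas_radius t e" using m0 unfolding cas_radius_def C_def by (metis real_sqrt_unique less_imp_le)
      moreover have "2 * ((\<tau> + 1) / 2) - 1 = \<tau>" by (simp add: field_simps)
      ultimately have "f ((\<tau> + 1) / 2) = w" using we unfolding f_def by (simp only: Let_def ce)
      moreover have "(\<tau> + 1) / 2 \<in> {0..1}" using \<tau>1 by auto
      ultimately show "w \<in> f ` {0..1}" by blast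
    qed
  qed
  \<comment> \<open>The radius is at most sqrt(1 + t) and is Lipschitz in the direction with
    constant 2/r; the parametrisation of the half circle by [0, 1] has constant 4.\<close>
  define c where "c = 2 * sqrt (1 + t) + 4 / r"
  have "r * dist x y \<le> dist (f x) (f y) \<and> dist (f x) (f y) \<le> (2 * c) * dist x y"
    if x: "x \<in> {0..1}" and y: "y \<in> {0..1}" for x y :: real
  proof -
    define e e' where "e = cayley (2 * x - 1)" and "e' = cayley (2 * y - 1)"
    define m m' where "m = cas_radius t e" and "m' = cas_radius t e'"
    have e1: "norm e = 1" "norm e' = 1" by (simp_all add: e_def e'_def norm_cayley)
    have m: "r \<le> m" "r \<le> m'" using n e1 by (auto simp: m_def m'_def)
    have f: "f x = m *\<^sub>R e" "f y = m' *\<^sub>R e'" by (simp_all add: f_def Let_def e_def e'_def m_def m'_def)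
    have ab: "\<bar>2 * x - 1 - (2 * y - 1)\<bar> = 2 * \<bar>x - y\<bar>" by (auto simp: abs_if)
    have xy: "\<bar>2 * x - 1\<bar> \<le> 1" "\<bar>2 * y - 1\<bar> \<le> 1" using x y by auto
    have de: "2 * dist x y \<le> norm (e - e')" "norm (e - e') \<le> 4 * dist x y"
      using dist_cayley[OF xy] unfolding ab e_def e'_def dist_real_def by auto
    \<comment> \<open>The radial discrepancy is itself at most |f x - f y| by the reverse triangle
      inequality, which costs a factor 2.\<close>
    have "norm (m *\<^sub>R (e - e')) \<le> norm (m *\<^sub>R e - m' *\<^sub>R e') + norm ((m' - m) *\<^sub>R e')"
      using norm_triangle_ineq[of "m *\<^sub>R e - m' *\<^sub>R e'" "(m' - m) *\<^sub>R e'"] by (simp add: algebra_simps)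
    moreover have "norm ((m' - m) *\<^sub>R e') = \<bar>norm (m *\<^sub>R e) - norm (m' *\<^sub>R e')\<bar>"
      using e1 m r by simp
    moreover have "\<bar>norm (m *\<^sub>R e) - norm (m' *\<^sub>R e')\<bar> \<le> norm (m *\<^sub>R e - m' *\<^sub>R e')"
      by (rule norm_triangle_ineq3)
    ultimately have "m * norm (e - e') \<le> 2 * norm (f x - f y)" using m r unfolding f by simp
    moreover have "r * (2 * dist x y) \<le> m * norm (e - e')" using m r de by (intro mult_mono) auto
    ultimately have lo: "r * dist x y \<le> dist (f x) (f y)" by (simp add: dist_norm)
    define C C' where "C = Re (e\<^sup>2)" and "C' = Re (e'\<^sup>2)"
    define s where "s = sqrt (t\<^sup>2 - 1)"
    have s2: "s\<^sup>2 = t\<^sup>2 - 1" using t by (simp add: s_def one_le_power)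
    \<comment> \<open>m^2 is C plus the modulus of C + i s, hence Lipschitz in C with constant
      2.\<close>
    have m2: "m\<^sup>2 = C + norm (Complex C s)" "m'\<^sup>2 = C' + norm (Complex C' s)"
    proof -
      have p: "0 \<le> D + sqrt (D\<^sup>2 + s\<^sup>2)" for D
      proof -
        have "\<bar>D\<bar> \<le> sqrt (D\<^sup>2 + s\<^sup>2)" by (intro real_le_rsqrt) simp
        then show ?thesis by linarith
      qed
      then show "m\<^sup>2 = C + norm (Complex C s)" "m'\<^sup>2 = C' + norm (Complex C' s)"
        by (simp_all add: m_def m'_def cas_radius_def C_def C'_def cmod_def s2)
    qed
    have "\<bar>norm (Complex C s) - norm (Complex C' s)\<bar> \<le> norm (Complex C s - Complex C' s)"
      by (rule norm_triangle_ineq3)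
    also have "\<dots> = \<bar>C - C'\<bar>" by (simp add: cmod_def)
    finally have "\<bar>m\<^sup>2 - m'\<^sup>2\<bar> \<le> 2 * \<bar>C - C'\<bar>" unfolding m2 by (smt (verit))
    also have "\<bar>C - C'\<bar> \<le> norm (e\<^sup>2 - e'\<^sup>2)"
      using abs_Re_le_cmod[of "e\<^sup>2 - e'\<^sup>2"] by (simp add: C_def C'_def)
    also have "norm (e\<^sup>2 - e'\<^sup>2) = norm (e + e') * norm (e - e')"
      by (simp add: norm_mult[symmetric] power2_eq_square square_diff_square_factored)
    also have "\<dots> \<le> 2 * norm (e - e')"
      using norm_triangle_ineq[of e e'] e1 by (intro mult_right_mono) auto
    finally have "\<bar>m\<^sup>2 - m'\<^sup>2\<bar> \<le> 4 * norm (e - e')" by simp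
    moreover have "\<bar>m\<^sup>2 - m'\<^sup>2\<bar> = \<bar>m - m'\<bar> * (m + m')"
      using m r by (simp add: power2_eq_square square_diff_square_factored abs_mult mult.commute)
    moreover have "\<bar>m - m'\<bar> * (2 * r) \<le> \<bar>m - m'\<bar> * (m + m')" using m by (intro mult_left_mono) auto
    ultimately have "\<bar>m - m'\<bar> * (2 * r) \<le> 4 * norm (e - e')" by linarith
    then have mm: "\<bar>m - m'\<bar> \<le> (2 / r) * norm (e - e')" using r by (simp add: field_simps)
    have "f x \<in> cassini t" using im x by blast
    then have "m\<^sup>2 \<le> 1 + t" using cassini_norm_bounds(1)[of "f x" t] e1 by (simp add: f)
    then have mu: "m \<le> sqrt (1 + t)" by (rule real_le_rsqrt)
    have "f x - f y = m *\<^sub>R (e - e') + (m - m') *\<^sub>R e'" unfolding f by (simp add: algebra_simps)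
    then have "norm (f x - f y) \<le> m * norm (e - e') + \<bar>m - m'\<bar>"
      using norm_triangle_ineq[of "m *\<^sub>R (e - e')" "(m - m') *\<^sub>R e'"] e1 m r by simp
    also have "\<dots> \<le> sqrt (1 + t) * norm (e - e') + (2 / r) * norm (e - e')"
      using mu mm by (intro add_mono mult_right_mono) auto
    also have "\<dots> = (sqrt (1 + t) + 2 / r) * norm (e - e')" by (simp add: distrib_right)
    also have "\<dots> \<le> (sqrt (1 + t) + 2 / r) * (4 * dist x y)"
      using r t de by (intro mult_left_mono) auto
    also have "\<dots> = (2 * c) * dist x y" by (simp add: c_def algebra_simps)
    finally show ?thesis using lo by (simp add: dist_norm)
  qed
  then have "bilipschitz_equivalent {0..1::real} (cassini t)"
    using r by (intro bilipschitz_equivalentI[OF im, of r "2 * c"]) auto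
  then show ?thesis unfolding fib
    using bilipschitz_equivalent_trans[OF bilipschitz_equivalent_isometry[of "cassini t" hembed]]
      bilipschitz_equivalent_sym dist_hembed by blast
qed

section \<open>Monotonicity, surjectivity and properness\<close>

lemma connected_figure_eight: "connected figure_eight"
proof -
  have "connected unit_circle" by (intro connected_sphere) simp
  moreover have "(1, 1) \<in> unit_circle \<times> {1}" "(1, 1) \<in> {1} \<times> unit_circle" by simp_all
  then have "(unit_circle \<times> {1}) \<inter> ({1} \<times> unit_circle) \<noteq> {}" by blast
  ultimately show ?thesis unfolding figure_eight_def
    by (intro connected_Un connected_Times connected_sing)
qed

lemma topologically_monotone_hmap: "topologically_monotone hmap"
  unfolding topologically_monotone_def
proof (intro conjI allI)
  show "continuous_on UNIV hmap"
    by (rule boundedly_lipschitz_imp_continuous[OF boundedly_lipschitz_hmap])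
  fix y
  have circle: "connected unit_circle" by (intro connected_sphere) simp
  show "connected (hmap -` {y})"
  proof (cases "y \<in> {- (t *\<^sub>R e_x) |t. t \<ge> 0}")
    case False
    then show ?thesis using hmap_off_ray[of y] connected_sing by metis
  next
    case True
    then obtain t where t: "t \<ge> 0" "y = - (t *\<^sub>R e_x)" by blast
    consider "t = 0" | "0 < t" "t < 1" | "t = 1" | "t > 1" using t(1) by linarith
    then show ?thesis
    proof cases
      case 1
      then show ?thesis using t(2) bilipschitz_equivalent_connected[OF fiber_0 circle] by simp
    next
      case 2
      then show ?thesis using t(2) bilipschitz_equivalent_connected[OF fiber_figure_eight connected_figure_eight] by blast
    next
      case 3
      then show ?thesis using t(2) bilipschitz_equivalent_connected[OF fiber_1 circle] by simp
    next
      case 4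
      then show ?thesis using t(2) bilipschitz_equivalent_connected[OF fiber_arc connected_Icc] by blast
    qed
  qed
qed

lemma surj_hmap: "surj hmap"
proof -
  have "\<exists>X. hmap X = y" for y
  proof (cases "y \<in> {- (t *\<^sub>R e_x) |t. t \<ge> 0}")
    case False
    then show ?thesis using hmap_off_ray[of y] by blast
  next
    case True
    then obtain t where t: "t \<ge> 0" "y = - (t *\<^sub>R e_x)" by blast
    \<comment> \<open>The witness is the point of the oval farthest from the axis, w = sqrt(1 +
      t).\<close>
    have "(csqrt (of_real (1 + t)))\<^sup>2 - 1 = of_real t" by (simp only: power2_csqrt) simp
    then have "csqrt (of_real (1 + t)) \<in> cassini t"
      using t(1) csqrt_principal[of "of_real (1 + t)"] unfolding cassini_def by (auto simp del: csqrt_of_real)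
    then have "hembed (csqrt (of_real (1 + t))) \<in> hmap -` {y}" using fiber_ray[OF t(1)] t(2) by blast
    then show ?thesis by blast
  qed
  then show ?thesis by (metis surjI)
qed

lemma compact_preimages_hmap: "compact_preimages hmap"
  unfolding compact_preimages_def
proof (intro allI impI)
  fix C :: "(real^3) set" assume C: "compact C"
  then obtain b where b: "\<And>y. y \<in> C \<Longrightarrow> norm y \<le> b" using compact_imp_bounded[OF C] unfolding bounded_iff by blast
  have "norm X \<le> sqrt (1 + b)" if "X \<in> hmap -` C" for X
  proof (rule real_le_rsqrt)
    have "zabs X \<le> b" using b[of "hmap X"] that by (simp add: norm_hmap)
    then show "(norm X)\<^sup>2 \<le> 1 + b" using zabs_ge[of X] by linarith
  qed
  then have "bounded (hmap -` C)" unfolding bounded_iff by blast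
  moreover have "closed (hmap -` C)"
    using C by (intro closed_vimage compact_imp_closed boundedly_lipschitz_imp_continuous boundedly_lipschitz_hmap)
  ultimately show "compact (hmap -` C)" by (simp add: compact_eq_bounded_closed)
qed

section \<open>The distortion function\<close>

definition Dhmap :: "real^3 \<Rightarrow> real^3^3" where
  "Dhmap X = (if X \<in> slits then 0 else matrix (frechet_derivative hmap (at X)))"

lemma hmap_Dhmap:
  assumes "X \<notin> slits"
  shows "(hmap has_derivative (\<lambda>v. Dhmap X *v v)) (at X)"
    and "det (Dhmap X) = 16 * (zabs X)\<^sup>2 * (norm X)\<^sup>2
      / (rad X * hslit X * dslit X * (1 + (ucoord X)\<^sup>2 + (vcoord X)\<^sup>2)\<^sup>2)"
proof -
  obtain M where M: "(hmap has_derivative (\<lambda>v. M *v v)) (at X)"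
    and d: "det M = 16 * (zabs X)\<^sup>2 * (norm X)\<^sup>2
      / (rad X * hslit X * dslit X * (1 + (ucoord X)\<^sup>2 + (vcoord X)\<^sup>2)\<^sup>2)"
    using hmap_has_derivative[OF assms] by blast
  have "frechet_derivative hmap (at X) = (\<lambda>v. M *v v)"
    using frechet_derivative_at[OF M] by simp
  then have "Dhmap X = M" using assms by (simp add: Dhmap_def)
  with M d show "(hmap has_derivative (\<lambda>v. Dhmap X *v v)) (at X)"
    "det (Dhmap X) = 16 * (zabs X)\<^sup>2 * (norm X)\<^sup>2
      / (rad X * hslit X * dslit X * (1 + (ucoord X)\<^sup>2 + (vcoord X)\<^sup>2)\<^sup>2)" by auto
qed

interpretation hmap: boundedly_lipschitz_ae_differentiable hmap Dhmap slits
proof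
  show "(hmap has_derivative (\<lambda>v. Dhmap X *v v)) (at X)" if "X \<notin> slits" for X
    using that by (rule hmap_Dhmap(1))
qed (simp_all add: boundedly_lipschitz_hmap closed_slits negligible_slits Dhmap_def)

lemma zero_notin_off_slits: "X \<notin> slits \<Longrightarrow> X \<noteq> 0"
  using off_slits(3)[of X] by (auto simp: rad_def)

lemma det_Dhmap_pos:
  assumes "X \<notin> slits" shows "0 < det (Dhmap X)"
proof -
  have "1 + (ucoord X)\<^sup>2 + (vcoord X)\<^sup>2 > 0" by (simp add: add_pos_nonneg)
  then show ?thesis
    unfolding hmap_Dhmap(2)[OF assms] using off_slits[OF assms] zero_notin_off_slits[OF assms] by simp
qed

lemma AE_not_slits: "AE X in lebesgue. X \<notin> slits"
  using hmap.AE_not_S by (rule AE_completion)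

section \<open>Measurability of the distortion quotient\<close>

lemma op_norm_diff_le:
  fixes A B :: "real^'n^'m"
  shows "\<bar>op_norm A - op_norm B\<bar> \<le> (\<Sum>i\<in>UNIV. \<Sum>j\<in>UNIV. \<bar>A $ i $ j - B $ i $ j\<bar>)"
proof -
  have one: "op_norm A \<le> op_norm B + op_norm (A - B)" for A B :: "real^'n^'m"
  proof -
    have "(\<lambda>v. A *v v) = (\<lambda>v. B *v v + (A - B) *v v)" by (simp add: matrix_vector_mult_diff_rdistrib)
    then show ?thesis
      using onorm_triangle[OF matrix_vector_mul_bounded_linear[of B] matrix_vector_mul_bounded_linear[of "A - B"]] by simp
  qed
  have "op_norm (A - B) \<le> (\<Sum>i\<in>UNIV. \<Sum>j\<in>UNIV. \<bar>A $ i $ j - B $ i $ j\<bar>)"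
    "op_norm (B - A) \<le> (\<Sum>i\<in>UNIV. \<Sum>j\<in>UNIV. \<bar>A $ i $ j - B $ i $ j\<bar>)"
    using onorm_le_matrix_component_sum[of "A - B"] onorm_le_matrix_component_sum[of "B - A"]
    by (simp_all add: abs_minus_commute)
  then show ?thesis using one[of A B] one[of B A] by linarith
qed

lemma continuous_op_norm: "continuous_on UNIV (op_norm :: real^'n^'m \<Rightarrow> real)"
  unfolding continuous_on_def
proof (intro ballI)
  fix A :: "real^'n^'m"
  have "((\<lambda>B. \<Sum>i\<in>UNIV. \<Sum>j\<in>UNIV. \<bar>B $ i $ j - A $ i $ j\<bar>)
      \<longlongrightarrow> (\<Sum>i\<in>UNIV. \<Sum>j\<in>UNIV. \<bar>A $ i $ j - A $ i $ j\<bar>)) (at A)"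
    by (intro tendsto_intros)
  then have z: "((\<lambda>B. \<Sum>i\<in>UNIV. \<Sum>j\<in>UNIV. \<bar>B $ i $ j - A $ i $ j\<bar>) \<longlongrightarrow> 0) (at A)" by simp
  have "((\<lambda>B. op_norm B - op_norm A) \<longlongrightarrow> 0) (at A)"
    using op_norm_diff_le by (intro Lim_null_comparison[OF always_eventually z] allI) (simp only: real_norm_def)
  then show "(op_norm \<longlongrightarrow> op_norm A) (at A)" by (rule Lim_null[THEN iffD2])
qed

lemma op_norm_Dhmap_measurable: "(\<lambda>X. op_norm (Dhmap X)) \<in> borel_measurable borel"
  using measurable_compose[OF hmap.D_measurable borel_measurable_continuous_onI[OF continuous_op_norm]] .

lemma det_Dhmap_measurable: "(\<lambda>X. det (Dhmap X)) \<in> borel_measurable borel"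
proof -
  have "continuous_on UNIV (det :: real^3^3 \<Rightarrow> real)"
    unfolding det_3[abs_def] by (intro continuous_intros)
  from measurable_compose[OF hmap.D_measurable borel_measurable_continuous_onI[OF this]]
  show ?thesis .
qed

text \<open>On the cuts \<open>Dhmap\<close> is 0, the quotient is 0 / 0 = 0, and the value is 1, so
  \<open>Kmap\<close> is at least 1 everywhere.\<close>

definition Kmap :: "real^3 \<Rightarrow> real" where
  "Kmap X = max 1 (op_norm (Dhmap X) ^ 3 / det (Dhmap X))"

lemma Kmap_measurable: "Kmap \<in> borel_measurable borel"
  unfolding Kmap_def[abs_def]
  by (intro borel_measurable_max borel_measurable_divide borel_measurable_power
      op_norm_Dhmap_measurable det_Dhmap_measurable) simp

lemma distortion_function_Kmap: "distortion_function Dhmap Kmap"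
  unfolding distortion_function_def
proof (intro conjI allI impI)
  show "distortion_bound Dhmap Kmap"
    unfolding distortion_bound_def
  proof (intro conjI allI borel_measurable_imp_lebesgue[OF Kmap_measurable])
    show "AE X in lebesgue. op_norm (Dhmap X) ^ 3 \<le> Kmap X * det (Dhmap X)"
      using AE_not_slits
    proof eventually_elim
      case (elim X)
      have "op_norm (Dhmap X) ^ 3 / det (Dhmap X) \<le> Kmap X" by (simp add: Kmap_def)
      then show ?case using det_Dhmap_pos[OF elim] by (simp add: divide_le_eq)
    qed
  qed (simp add: Kmap_def)
  fix K' assume "distortion_bound Dhmap K'"
  then have 1: "\<And>X. 1 \<le> K' X" and "AE X in lebesgue. op_norm (Dhmap X) ^ 3 \<le> K' X * det (Dhmap X)"
    unfolding distortion_bound_def by blast+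
  from this(2) AE_not_slits show "AE X in lebesgue. Kmap X \<le> K' X"
  proof eventually_elim
    case (elim X)
    then show ?case using det_Dhmap_pos[OF elim(2)] 1[of X] by (simp add: Kmap_def divide_le_eq)
  qed
qed

text \<open>1 + u^2 + v^2 is split into a part from v, singular at the disc, and a part from u,
  singular at the half-plane. Squaring the sum leaves one term of order 1/z^2 and one of order
  1/y^2.\<close>

lemma inverse_det_Dhmap_le:
  assumes y: "X$2 \<noteq> 0" and z: "X$3 \<noteq> 0"
  shows "1 / det (Dhmap X) \<le> zabs X / (2 * (X$3)\<^sup>2 * (norm X)\<^sup>2) + 2 / (zabs X * (X$2)\<^sup>2 * (norm X)\<^sup>2)"
proof -
  have X: "X \<notin> slits" using y z slits_subset by blast
  note pos = off_slits[OF X]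
  define r A B R N n where "r = rad X" and "A = hslit X" and "B = dslit X" and "R = zabs X"
    and "N = 1 + (ucoord X)\<^sup>2 + (vcoord X)\<^sup>2" and "n = (norm X)\<^sup>2"
  have p: "r > 0" "A > 0" "B > 0" "R > 0" "n > 0"
    using pos zero_notin_off_slits[OF X] by (auto simp: r_def A_def B_def R_def n_def)
  \<comment> \<open>P equals 1 + v^2, and Q bounds u^2 by the half-angle identity for
    \<theta>.\<close>
  define P Q where "P = 2 * R / B" and "Q = 2 / (r * A)"
  have "(r * ucoord X)\<^sup>2 \<le> 2 * r / A"
    using one_plus_ucoord_sq[OF X] by (simp add: r_def A_def)
  moreover have "r\<^sup>2 * Q = 2 * r / A" using p by (simp add: Q_def power2_eq_square)
  ultimately have "r\<^sup>2 * (ucoord X)\<^sup>2 \<le> r\<^sup>2 * Q" by (simp add: power_mult_distrib)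
  then have "(ucoord X)\<^sup>2 \<le> Q" using p by simp
  then have NPQ: "N \<le> P + Q" using one_plus_vcoord_sq[OF X] by (simp add: N_def P_def R_def B_def)
  have N0: "N > 0" unfolding N_def by (simp add: add_pos_nonneg)
  have "N\<^sup>2 \<le> (P + Q)\<^sup>2" using NPQ N0 by (intro power_mono) auto
  also have "\<dots> \<le> 2 * P\<^sup>2 + 2 * Q\<^sup>2" using sum_squares_bound[of P Q] by (simp add: power2_sum)
  finally have N2: "N\<^sup>2 \<le> 2 * P\<^sup>2 + 2 * Q\<^sup>2" .
  have "1 / det (Dhmap X) = (r * A) * B * N\<^sup>2 / (16 * R\<^sup>2 * n)"
    unfolding hmap_Dhmap(2)[OF X] by (simp add: r_def A_def B_def R_def N_def n_def)
  also have "\<dots> \<le> (r * A) * B * (2 * P\<^sup>2 + 2 * Q\<^sup>2) / (16 * R\<^sup>2 * n)"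
    using N2 p by (intro divide_right_mono mult_left_mono) auto
  also have "\<dots> = (r * A) / (2 * B * n) + B / (2 * R\<^sup>2 * (r * A) * n)"
    using p by (simp add: P_def Q_def field_simps power2_eq_square)
  also have "\<dots> \<le> R / (2 * (X$3)\<^sup>2 * n) + 2 / (R * (X$2)\<^sup>2 * n)"
  \<comment> \<open>The first term uses 2 r^2 z^2 \<le> B R, the second y^2 \<le> 2 r A; both come
    from the conjugate identities.\<close>
  proof (rule add_mono)
    have "A \<le> 2 * r" using hslit_le[of X] by (simp add: A_def r_def)
    then have rA: "r * A \<le> 2 * r\<^sup>2" using p by (simp add: power2_eq_square)
    have "4 * r\<^sup>2 * (X$3)\<^sup>2 = B * (R - zre X)"
      using dslit_conj[of X] by (simp add: zim_def power_mult_distrib B_def R_def r_def)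
    also have "\<dots> \<le> B * (2 * R)"
      using abs_le_zabs(1)[of X] p by (intro mult_left_mono) (auto simp: R_def)
    finally have B: "2 * r\<^sup>2 * (X$3)\<^sup>2 \<le> B * R" by simp
    have "(r * A) * (X$3)\<^sup>2 \<le> 2 * r\<^sup>2 * (X$3)\<^sup>2" using rA by (intro mult_right_mono) auto
    with B have "(r * A) * (X$3)\<^sup>2 \<le> B * R" by linarith
    then have "(r * A) / B \<le> R / (X$3)\<^sup>2" using p z by (simp add: field_simps)
    then have "(r * A) / B / (2 * n) \<le> R / (X$3)\<^sup>2 / (2 * n)" using p by (intro divide_right_mono) auto
    then show "(r * A) / (2 * B * n) \<le> R / (2 * (X$3)\<^sup>2 * n)" by (simp add: mult_ac)
    have "(X$2)\<^sup>2 = A * (r - X$1)" using hslit_conj[of X] by (simp add: A_def r_def)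
    also have "\<dots> \<le> A * (2 * r)" using abs_le_rad(1)[of X] p by (intro mult_left_mono) (auto simp: r_def)
    finally have y2: "(X$2)\<^sup>2 \<le> 2 * (r * A)" by (simp add: mult_ac)
    have "B * (X$2)\<^sup>2 \<le> (2 * R) * (2 * (r * A))"
      using y2 dslit_le[of X] p by (intro mult_mono) (auto simp: B_def R_def)
    then have "B * (R * (X$2)\<^sup>2) \<le> 2 * (2 * R\<^sup>2 * (r * A))"
      using p by (simp add: power2_eq_square mult_ac)
    then have "B / (2 * R\<^sup>2 * (r * A)) \<le> 2 / (R * (X$2)\<^sup>2)"
      using p y by (subst frac_le_eq) (auto simp: divide_le_0_iff mult_ac)
    then have "B / (2 * R\<^sup>2 * (r * A)) / n \<le> 2 / (R * (X$2)\<^sup>2) / n" using p by (intro divide_right_mono) auto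
    then show "B / (2 * R\<^sup>2 * (r * A) * n) \<le> 2 / (R * (X$2)\<^sup>2 * n)" by simp
  qed
  finally show ?thesis by (simp add: R_def n_def)
qed

text \<open>The operator norm is bounded on the ball. In the inverse Jacobian the remaining singular
  factors are absorbed by x^2 \<le> |X|^2 and z^2 \<le> M R, so that only powers of the coordinates
  are left.\<close>

lemma Kmap_upper_bound:
  obtains c where "c > 0"
    "\<And>X. norm X \<le> M \<Longrightarrow> X$1 \<noteq> 0 \<Longrightarrow> X$2 \<noteq> 0 \<Longrightarrow> X$3 \<noteq> 0 \<Longrightarrow>
       Kmap X \<le> c / ((X$1)\<^sup>2 * (X$2)\<^sup>2 * (X$3)\<^sup>2)"
proof -
  obtain L where L: "L \<ge> 0" "\<And>X v. norm X < M + 1 \<Longrightarrow> norm (Dhmap X *v v) \<le> L * norm v"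
    using hmap.D_bounded by blast
  obtain Rm where Rm: "Rm \<ge> 0" "\<And>X. norm X \<le> M \<Longrightarrow> zabs X \<le> Rm"
    using boundedly_lipschitz_bounded[OF boundedly_lipschitz_zabs, of M] by (auto simp: real_norm_def)
  define C where "C = Rm * M\<^sup>2 / 2 + 2 * \<bar>M\<bar>"
  \<comment> \<open>M^6 bounds (xyz)^2 on the ball, so the bound also exceeds the 1 in
    \<open>Kmap\<close>; the other term is the cube of the operator norm times the bound for the
    inverse Jacobian.\<close>
  define c where "c = 1 + M^6 + L^3 * C"
  have C0: "C \<ge> 0" using Rm by (simp add: C_def)
  have M6: "M^6 \<ge> 0" by (simp add: zero_le_even_power)
  have "Kmap X \<le> c / ((X$1)\<^sup>2 * (X$2)\<^sup>2 * (X$3)\<^sup>2)"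
    if X: "norm X \<le> M" and nz: "X$1 \<noteq> 0" "X$2 \<noteq> 0" "X$3 \<noteq> 0" for X
  proof -
    have sl: "X \<notin> slits" using nz slits_subset by blast
    note pos = off_slits[OF sl]
    define x y z R n where "x = (X$1)\<^sup>2" and "y = (X$2)\<^sup>2" and "z = (X$3)\<^sup>2" and "R = zabs X" and "n = (norm X)\<^sup>2"
    have p: "x > 0" "y > 0" "z > 0" "R > 0" using nz pos by (auto simp: x_def y_def z_def R_def)
    have n: "n = x + y + z" by (simp add: n_def norm_real3_sq x_def y_def z_def)
    have M0: "M \<ge> 0" using X norm_ge_zero order_trans by blast
    have nM: "n \<le> M\<^sup>2" unfolding n_def using X by (intro power_mono) auto
    have xyz: "x \<le> n" "y \<le> M\<^sup>2" "x \<le> M\<^sup>2" "z \<le> M\<^sup>2" using n p nM by linarith+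
    have "\<bar>X$3\<bar> \<le> R"
    proof (rule power2_le_imp_le)
      show "\<bar>X$3\<bar>\<^sup>2 \<le> R\<^sup>2" using zabs_ge_third[of X] zero_le_power2[of "X$3"] unfolding R_def power2_abs by linarith
    qed (use p in simp)
    then have "\<bar>X$3\<bar> * \<bar>X$3\<bar> \<le> M * R" using component_le_norm_cart[of X 3] X M0 by (intro mult_mono) auto
    then have zR: "z \<le> M * R" by (simp add: z_def power2_eq_square abs_mult_self_eq)
    have 1: "R / (2 * z * n) \<le> (Rm * M\<^sup>2 / 2) / (x * y * z)"
    proof -
      have "R * (x * y) \<le> Rm * (n * M\<^sup>2)" using Rm X xyz p by (intro mult_mono) (auto simp: R_def)
      then have "R * (2 * (x * y * z)) \<le> (Rm * M\<^sup>2) * (2 * z * n)" using p by (simp add: mult_ac)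
      then show ?thesis using p n by (simp add: divide_le_eq le_divide_eq mult_ac pos_divide_le_eq)
    qed
    have 2: "2 / (R * y * n) \<le> (2 * \<bar>M\<bar>) / (x * y * z)"
    proof -
      have "x * z \<le> n * (M * R)" using xyz zR p by (intro mult_mono) auto
      then have "2 * (x * y * z) \<le> (2 * \<bar>M\<bar>) * (R * y * n)" using p M0 by (simp add: mult_ac)
      then show ?thesis using p n by (simp add: divide_le_eq le_divide_eq mult_ac)
    qed
    have "1 / det (Dhmap X) \<le> R / (2 * z * n) + 2 / (R * y * n)"
      using inverse_det_Dhmap_le[OF nz(2,3)] by (simp add: R_def z_def y_def n_def)
    also have "\<dots> \<le> C / (x * y * z)" using 1 2 unfolding C_def add_divide_distrib by linarith
    finally have J: "1 / det (Dhmap X) \<le> C / (x * y * z)" .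
    have "op_norm (Dhmap X) \<le> L" using L X by (intro onorm_le) auto
    moreover have "0 \<le> op_norm (Dhmap X)" by (rule onorm_pos_le[OF matrix_vector_mul_bounded_linear])
    ultimately have "op_norm (Dhmap X) ^ 3 \<le> L^3" by (intro power_mono)
    then have "op_norm (Dhmap X) ^ 3 * (1 / det (Dhmap X)) \<le> L^3 * (C / (x * y * z))"
      using J L det_Dhmap_pos[OF sl] by (intro mult_mono) auto
    then have a: "op_norm (Dhmap X) ^ 3 / det (Dhmap X) \<le> (L^3 * C) / (x * y * z)" by simp
    also have "\<dots> \<le> c / (x * y * z)"
      using p M6 by (intro divide_right_mono) (auto simp: c_def)
    finally have b: "op_norm (Dhmap X) ^ 3 / det (Dhmap X) \<le> c / (x * y * z)" .
    have "x * y * z \<le> M\<^sup>2 * M\<^sup>2 * M\<^sup>2" using xyz p by (intro mult_mono) auto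
    also have "\<dots> = M^6" by (simp flip: power_add)
    also have "\<dots> \<le> c" using C0 L by (simp add: c_def)
    finally have "1 \<le> c / (x * y * z)" using p by (simp add: le_divide_eq)
    with b show ?thesis by (simp add: Kmap_def x_def y_def z_def)
  qed
  moreover have "c > 0" unfolding c_def using M6 C0 L by (simp add: add_pos_nonneg)
  ultimately show thesis using that by blast
qed

text \<open>Near the disc \<open>u\<close> stays bounded while \<open>v\<close> is of order \<open>1/z\<close>, so \<open>h\<close> moves only at rate
  \<open>z\<^sup>2\<close> along the circles that are collapsed.\<close>

lemma Kmap_lower_bound:
  assumes x: "1/4 \<le> X$1" "X$1 \<le> 1/2" and y: "\<bar>X$2\<bar> \<le> 1/4" and z: "0 < X$3" "X$3 \<le> 1/4"
  shows "1 / (128 * X$3) \<le> Kmap X powr (1/2)"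
proof -
  \<comment> \<open>The box stays above the open unit disc and away from the z-axis and the
    half-plane; this pins \<rho>^2 between 1/16 and 5/16.\<close>
  have sq: "(X$1)\<^sup>2 \<le> (1/2)\<^sup>2" "(1/4)\<^sup>2 \<le> (X$1)\<^sup>2" "(X$2)\<^sup>2 \<le> (1/4)\<^sup>2" "(X$3)\<^sup>2 \<le> (1/4)\<^sup>2"
    using assms by (auto intro!: power_mono simp: abs_le_square_iff[symmetric])
  have "1/16 \<le> (X$1)\<^sup>2" using sq(2) by (simp add: power_divide)
  then have r2: "(rad X)\<^sup>2 \<le> 5/16" "1/16 \<le> (rad X)\<^sup>2"
    unfolding rad_sq using sq by (simp_all add: power_divide add_increasing2)
  have r0: "rad X > 0" using r2(2) by (cases "rad X = 0") (auto simp: less_le)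
  have h0: "hslit X > 0" "rad X \<le> hslit X" using x r0 by (auto simp: hslit_def)
  have sl: "X \<notin> slits"
  proof
    assume "X \<in> slits"
    then have "dslit X = 0" using h0 by (auto simp: slits_def)
    then show False using dslit_eq_0_iff[of X] r0 z by auto
  qed
  note pos = off_slits[OF sl]
  define r A B R N n where "r = rad X" and "A = hslit X" and "B = dslit X" and "R = zabs X"
    and "N = 1 + (ucoord X)\<^sup>2 + (vcoord X)\<^sup>2" and "n = (norm X)\<^sup>2"
  have p: "r > 0" "A > 0" "B > 0" "R > 0" using pos by (auto simp: r_def A_def B_def R_def)
  have n: "n = r\<^sup>2 + (X$3)\<^sup>2" by (simp add: n_def r_def norm_real3_sq rad_sq)
  have n1: "n \<le> 3/8" "0 < n" using r2 sq(4) p unfolding n r_def by (auto simp: power2_eq_square add_pos_nonneg)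
  \<comment> \<open>The part 1 + v^2 alone already makes N so large that the determinant is of the
    order of B, which is at most 4 \<rho>^2 z^2 here.\<close>
  have "2 * R / B = 1 + (vcoord X)\<^sup>2" using one_plus_vcoord_sq[OF sl] by (simp add: R_def B_def)
  then have "2 * R / B \<le> N" by (simp add: N_def)
  then have N: "(2 * R / B)\<^sup>2 \<le> N\<^sup>2" using p by (intro power_mono) auto
  have N0: "N > 0" unfolding N_def by (simp add: add_pos_nonneg)
  have "det (Dhmap X) = 16 * R\<^sup>2 * n / (r * A * B * N\<^sup>2)"
    unfolding hmap_Dhmap(2)[OF sl] by (simp add: r_def A_def B_def R_def N_def n_def)
  also have "\<dots> \<le> 16 * R\<^sup>2 * n / (r * A * B * (2 * R / B)\<^sup>2)"
    using N p n1 N0 by (intro divide_left_mono mult_left_mono mult_pos_pos) auto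
  also have "\<dots> = 4 * n * B / (r * A)" using p by (simp add: field_simps power2_eq_square)
  also have "\<dots> \<le> 4 * n * B / (r * r)"
    using p n1 h0 by (intro divide_left_mono mult_left_mono mult_nonneg_nonneg) (auto simp: A_def r_def)
  also have "\<dots> \<le> 16 * (X$3)\<^sup>2"
  proof -
    have "zre X \<le> - 11/16" unfolding zre_rad using r2 zero_le_power2[of "X$3"] by linarith
    then have q: "1 \<le> R - zre X" using abs_le_zabs(1)[of X] by (simp add: R_def)
    have "B * 1 \<le> B * (R - zre X)" using q p by (intro mult_left_mono) auto
    then have "B \<le> 4 * (r * r) * (X$3)\<^sup>2"
      using dslit_conj[of X] by (simp add: B_def R_def r_def zim_def power2_eq_square mult_ac)
    then have "n * B \<le> 1 * (4 * (r * r) * (X$3)\<^sup>2)" using n1 p by (intro mult_mono) auto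
    then have "4 * n * B \<le> 16 * (X$3)\<^sup>2 * (r * r)" by (simp add: mult_ac)
    then show ?thesis using p by (simp add: divide_le_eq)
  qed
  finally have J: "det (Dhmap X) \<le> 16 * (X$3)\<^sup>2" .
  \<comment> \<open>Since |h| = R, the operator norm dominates the derivative of R in direction x,
    which does not vanish on this box.\<close>
  have op: "1/8 \<le> op_norm (Dhmap X)"
  proof -
    define g where "g = (2 * r * (n - 1) / R) *\<^sub>R grad_rad X + (2 * X$3 * (n + 1) / R) *\<^sub>R axis 3 1"
    have hz: "hmap X \<noteq> 0" using norm_hmap[of X] pos by auto
    have "(zabs has_derivative (\<lambda>v. v \<bullet> g)) (at X)"
      using GDERIV_zabs[OF sl] unfolding gderiv_def g_def r_def n_def R_def .
    moreover have "(zabs has_derivative (\<lambda>v. (Dhmap X *v v) \<bullet> sgn (hmap X))) (at X)"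
    proof -
      have "((\<lambda>X. norm (hmap X)) has_derivative (\<lambda>v. (Dhmap X *v v) \<bullet> sgn (hmap X))) (at X)"
        by (rule has_derivative_compose[OF hmap_Dhmap(1)[OF sl] has_derivative_norm[OF hz]])
      then show ?thesis by (simp add: norm_hmap)
    qed
    ultimately have eq: "(\<lambda>v. v \<bullet> g) = (\<lambda>v. (Dhmap X *v v) \<bullet> sgn (hmap X))"
      by (rule has_derivative_unique)
    have "\<bar>g$1\<bar> = \<bar>axis 1 1 \<bullet> g\<bar>" by (simp add: inner_axis')
    also have "\<dots> = \<bar>(Dhmap X *v axis 1 1) \<bullet> sgn (hmap X)\<bar>" using fun_cong[OF eq] by metis
    also have "\<dots> \<le> norm (Dhmap X *v axis 1 1) * norm (sgn (hmap X))" by (rule Cauchy_Schwarz_ineq2)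
    also have "\<dots> \<le> norm (Dhmap X *v axis 1 1)" using hz by (simp add: norm_sgn)
    also have "\<dots> \<le> op_norm (Dhmap X) * norm (axis 1 1 :: real^3)"
      by (rule onorm[OF matrix_vector_mul_bounded_linear])
    finally have le: "\<bar>g$1\<bar> \<le> op_norm (Dhmap X)" by simp
    have "g$1 = - (2 * X$1 * (1 - n) / R)" using p by (simp add: g_def axis_def r_def[symmetric] field_simps)
    moreover have "1/8 \<le> 2 * X$1 * (1 - n) / R"
    proof -
      have "R\<^sup>2 = n\<^sup>2 - 2 * (r\<^sup>2 - (X$3)\<^sup>2) + 1"
        using zabs_sq_norm[of X] by (simp add: R_def n_def r_def flip: power_mult)
      also have "\<dots> \<le> 2\<^sup>2"
      proof -
        have "n\<^sup>2 \<le> 1\<^sup>2" using n1 by (intro power_mono) auto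
        moreover have "(X$3)\<^sup>2 \<le> 1/16" using sq(4) by (simp add: power2_eq_square)
        ultimately show ?thesis using r2 by (simp add: r_def)
      qed
      finally have "R \<le> 2" by (rule power2_le_imp_le) simp
      moreover have "2 * (1/4) * (5/8) \<le> 2 * X$1 * (1 - n)" using x n1 by (intro mult_mono) auto
      ultimately have "(1/8) * R \<le> 2 * X$1 * (1 - n)" using p by linarith
      then show ?thesis using p by (simp add: le_divide_eq)
    qed
    ultimately show ?thesis using le by linarith
  qed
  \<comment> \<open>(1/8)^3 / 16 = 1/8192 is lowered to 1/16384 = 1/128^2 so that the square root is
    rational.\<close>
  have "(1 / (128 * X$3))\<^sup>2 = (1/16384) / (X$3)\<^sup>2" by (simp add: power_divide power_mult_distrib)
  also have "\<dots> \<le> (1/8)^3 / (16 * (X$3)\<^sup>2)" using z by (simp add: field_simps)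
  also have "\<dots> \<le> op_norm (Dhmap X) ^ 3 / det (Dhmap X)"
    using op J det_Dhmap_pos[OF sl] z by (intro frac_le power_mono) auto
  also have "\<dots> \<le> Kmap X" by (simp add: Kmap_def)
  finally have k: "(1 / (128 * X$3))\<^sup>2 \<le> Kmap X" .
  then have "1 / (128 * X$3) \<le> sqrt (Kmap X)" by (rule real_le_rsqrt)
  moreover have "Kmap X \<ge> 0" by (simp add: Kmap_def)
  ultimately show ?thesis by (simp add: powr_half_sqrt)
qed

section \<open>Integrals of products of one-variable functions\<close>

lemma prod_UNIV_3: "(\<Prod>i\<in>UNIV. f (i :: 3)) = f 1 * f 2 * (f 3 :: 'a::comm_monoid_mult)"
  unfolding UNIV_3 by (simp add: mult.assoc)

lemma nn_integral_prod_components: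
  fixes f :: "'n::finite \<Rightarrow> real \<Rightarrow> ennreal"
  assumes [measurable]: "\<And>i. f i \<in> borel_measurable borel"
  shows "(\<integral>\<^sup>+X. (\<Prod>i\<in>UNIV. f i (X $ i)) \<partial>(lborel :: (real^'n) measure)) = (\<Prod>i\<in>UNIV. \<integral>\<^sup>+s. f i s \<partial>lborel)"
proof -
  \<comment> \<open>Recovers the coordinate index from a basis vector, as the product formula runs
    over \<open>Basis\<close>.\<close>
  define ix where "ix b = (THE i. b = (axis i 1 :: real^'n))" for b
  have ix: "ix (axis i 1) = i" for i by (simp add: ix_def axis_eq_axis)
  have inj: "inj (\<lambda>i. axis i 1 :: real^'n)" by (metis injI ix)
  have B: "(Basis :: (real^'n) set) = range (\<lambda>i. axis i 1)" by (auto simp: Basis_vec_def)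
  have "(\<integral>\<^sup>+X. (\<Prod>b\<in>Basis. f (ix b) (X \<bullet> b)) \<partial>(lborel :: (real^'n) measure)) = (\<Prod>b\<in>(Basis :: (real^'n) set). \<integral>\<^sup>+s. f (ix b) s \<partial>lborel)"
    by (rule nn_integral_lborel_prod) auto
  then show ?thesis
    by (simp add: B prod.reindex[OF inj] ix inner_axis)
qed

lemma nn_integral_powr_abs_finite:
  assumes a: "a > -1"
  shows "(\<integral>\<^sup>+s. ennreal (indicator {-M..M} s * \<bar>s\<bar> powr a) \<partial>lborel) < \<infinity>"
proof (cases "M \<ge> 0")
  case True
  define f where "f s = ennreal (indicator {0..M} s * s powr a)" for s
  have [measurable]: "f \<in> borel_measurable borel" unfolding f_def by measurable
  have fin: "(\<integral>\<^sup>+s. f s \<partial>lborel) < \<infinity>"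
  proof -
    have "(\<integral>\<^sup>+s. f s \<partial>lborel) = ennreal (M powr (a + 1) / (a + 1))"
      unfolding f_def
      by (rule nn_integral_has_integral_lebesgue[OF _ has_integral_powr_from_0[OF a True]]) simp
    then show ?thesis by simp
  qed
  have "(\<integral>\<^sup>+s. ennreal (indicator {-M..M} s * \<bar>s\<bar> powr a) \<partial>lborel) \<le> (\<integral>\<^sup>+s. f s + f (- s) \<partial>lborel)"
    by (intro nn_integral_mono) (auto simp: f_def indicator_def abs_if)
  also have "\<dots> = (\<integral>\<^sup>+s. f s \<partial>lborel) + (\<integral>\<^sup>+s. f (- s) \<partial>lborel)"
    by (rule nn_integral_add) auto
  also have "(\<integral>\<^sup>+s. f (- s) \<partial>lborel) = (\<integral>\<^sup>+s. f s \<partial>lborel)"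
    using nn_integral_real_affine[of f "-1" 0] by simp
  finally show ?thesis using fin by (simp add: order_le_less_trans)
qed (simp add: indicator_def)

text \<open>The coordinate bound raised to the power p separates into factors |s|^(-2p), and p < 1/2
  is the condition -2p > -1.\<close>

lemma Kmap_Lp_loc:
  assumes p: "0 < p" "p < 1/2"
  shows "Lp_loc p Kmap"
  unfolding Lp_loc_def
proof (intro conjI allI impI)
  show Km: "Kmap \<in> borel_measurable lebesgue" by (rule borel_measurable_imp_lebesgue[OF Kmap_measurable])
  fix C :: "(real^3) set" assume C: "compact C"
  then obtain M where M: "\<And>X. X \<in> C \<Longrightarrow> norm X \<le> M"
    using compact_imp_bounded[OF C] unfolding bounded_iff by blast
  obtain c where c: "c > 0" "\<And>X. norm X \<le> M \<Longrightarrow> X$1 \<noteq> 0 \<Longrightarrow> X$2 \<noteq> 0 \<Longrightarrow> X$3 \<noteq> 0 \<Longrightarrow>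
       Kmap X \<le> c / ((X$1)\<^sup>2 * (X$2)\<^sup>2 * (X$3)\<^sup>2)"
    using Kmap_upper_bound[of M] by blast
  define \<phi> where "\<phi> s = ennreal (indicator {-M..M} s * \<bar>s\<bar> powr (- 2 * p))" for s :: real
  have [measurable]: "\<phi> \<in> borel_measurable borel" unfolding \<phi>_def by measurable
  have Cm: "C \<in> sets lebesgue" using C by (simp add: compact_imp_closed)
  have K0: "Kmap X \<ge> 0" for X by (simp add: Kmap_def)
  have hyp: "AE X :: real^3 in lebesgue. X$1 \<noteq> 0 \<and> X$2 \<noteq> 0 \<and> X$3 \<noteq> 0"
  proof -
    have "AE X in lebesgue. (X::real^3)$k \<noteq> 0" for k
    proof (rule AE_I'[of "{X. X$k = 0}"])
      show "{X::real^3. X$k = 0} \<in> null_sets lebesgue"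
        using negligible_standard_hyperplane_cart[of k] by (simp add: negligible_iff_null_sets)
    qed auto
    from this[of 1] this[of 2] this[of 3] show ?thesis by eventually_elim auto
  qed
  have bound: "ennreal (norm (indicat_real C X *\<^sub>R norm (Kmap X) powr p)) \<le> ennreal (c powr p) * (\<Prod>i\<in>UNIV. \<phi> (X $ i))"
    if nz: "X$1 \<noteq> 0 \<and> X$2 \<noteq> 0 \<and> X$3 \<noteq> 0" for X :: "real^3"
  proof (cases "X \<in> C")
    case True
    then have XM: "norm X \<le> M" using M by blast
    have in_M: "X $ i \<in> {-M..M}" for i using component_le_norm_cart[of X i] XM by auto
    have \<phi>i: "\<phi> (X $ i) = ennreal (\<bar>X $ i\<bar> powr (- 2 * p))" for i
      using in_M[of i] by (simp add: \<phi>_def)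
    have sq: "((X$i)\<^sup>2) powr (- p) = \<bar>X$i\<bar> powr (- 2 * p)" if "X$i \<noteq> 0" for i
    proof -
      have "(X$i)\<^sup>2 = \<bar>X$i\<bar> powr 2" using that by (simp add: powr_numeral)
      then have "((X$i)\<^sup>2) powr (- p) = (\<bar>X$i\<bar> powr 2) powr (- p)" by (simp only:)
      also have "\<dots> = \<bar>X$i\<bar> powr (2 * - p)" by (rule powr_powr)
      finally show ?thesis by simp
    qed
    have "Kmap X powr p \<le> (c / ((X$1)\<^sup>2 * (X$2)\<^sup>2 * (X$3)\<^sup>2)) powr p"
      using c(2)[OF XM] nz K0 p by (intro powr_mono2) auto
    also have "\<dots> = c powr p * ((X$1)\<^sup>2 powr (- p) * (X$2)\<^sup>2 powr (- p) * (X$3)\<^sup>2 powr (- p))"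
      using c(1) by (simp add: powr_divide powr_mult powr_minus divide_inverse inverse_powr)
    also have "\<dots> = c powr p * (\<bar>X$1\<bar> powr (- 2 * p) * \<bar>X$2\<bar> powr (- 2 * p) * \<bar>X$3\<bar> powr (- 2 * p))"
      using sq[of 1] sq[of 2] sq[of 3] nz by simp
    finally have "ennreal (Kmap X powr p) \<le> ennreal (c powr p * (\<bar>X$1\<bar> powr (- 2 * p) * \<bar>X$2\<bar> powr (- 2 * p) * \<bar>X$3\<bar> powr (- 2 * p)))"
      by (rule ennreal_leI)
    also have "\<dots> = ennreal (c powr p) * (\<Prod>i\<in>UNIV. \<phi> (X $ i))"
      unfolding prod_UNIV_3 \<phi>i by (simp add: mult.assoc flip: ennreal_mult)
    finally show ?thesis using True K0[of X] by simp
  qed simp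
  have "(\<integral>\<^sup>+X. ennreal (norm (indicat_real C X *\<^sub>R norm (Kmap X) powr p)) \<partial>lebesgue)
     \<le> (\<integral>\<^sup>+X. ennreal (c powr p) * (\<Prod>i\<in>UNIV. \<phi> (X $ i)) \<partial>(lebesgue :: (real^3) measure))"
    by (rule nn_integral_mono_AE, rule eventually_mono[OF hyp], rule bound)
  also have "\<dots> = ennreal (c powr p) * (\<integral>\<^sup>+X. (\<Prod>i\<in>UNIV. \<phi> (X $ i)) \<partial>(lborel :: (real^3) measure))"
    unfolding nn_integral_completion
    by (rule nn_integral_cmult) (simp, measurable)
  also have "\<dots> < \<infinity>"
  proof -
    have "(\<integral>\<^sup>+s. \<phi> s \<partial>lborel) < \<infinity>" unfolding \<phi>_def using p by (intro nn_integral_powr_abs_finite) simp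
    then show ?thesis
      by (subst nn_integral_prod_components) (auto simp: power_less_top_ennreal ennreal_mult_less_top)
  qed
  finally show "set_integrable lebesgue C (\<lambda>X. norm (Kmap X) powr p)"
    unfolding set_integrable_def using Km Cm by (intro integrableI_bounded) auto
qed

lemma nn_integral_inverse_infinite:
  fixes c :: real assumes "c > 0"
  shows "(\<integral>\<^sup>+s. ennreal (1 / s) * indicator {0<..c} s \<partial>lborel) = \<infinity>"
proof -
  have le: "ennreal (real k) \<le> (\<integral>\<^sup>+s. ennreal (1 / s) * indicator {0<..c} s \<partial>lborel)" for k
  proof -
    \<comment> \<open>Chosen so that the integral of 1/s over [b, c] is exactly k.\<close>
    define b where "b = c * exp (- real k)"
    have b: "0 < b" "b \<le> c" using assms by (auto simp: b_def)
    have "(\<integral>\<^sup>+s. ennreal (1 / s) * indicator {b..c} s \<partial>lborel) = ennreal (ln c - ln b)"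
      using b by (intro nn_integral_FTC_Icc) (auto intro!: derivative_eq_intros)
    also have "ln c - ln b = real k" using assms by (simp add: b_def ln_mult)
    finally have "ennreal (real k) = (\<integral>\<^sup>+s. ennreal (1 / s) * indicator {b..c} s \<partial>lborel)" ..
    also have "\<dots> \<le> (\<integral>\<^sup>+s. ennreal (1 / s) * indicator {0<..c} s \<partial>lborel)"
      using b by (intro nn_integral_mono mult_left_mono) (auto simp: indicator_def)
    finally show ?thesis .
  qed
  show ?thesis
  proof (rule ccontr)
    assume "(\<integral>\<^sup>+s. ennreal (1 / s) * indicator {0<..c} s \<partial>lborel) \<noteq> \<infinity>"
    then obtain r where r: "r \<ge> 0" "(\<integral>\<^sup>+s. ennreal (1 / s) * indicator {0<..c} s \<partial>lborel) = ennreal r"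
      by (metis ennreal_cases infinity_ennreal_def)
    obtain k where "r < real k" using reals_Archimedean2 by blast
    then show False using le[of k] r by (simp add: ennreal_le_iff)
  qed
qed

text \<open>On a box resting on the disc the square root of K is at least a multiple of 1/z, whose
  integral in z diverges while the other two variables contribute positive lengths.\<close>

lemma Kmap_not_Lp_loc: "\<not> Lp_loc (1/2) Kmap"
proof
  assume Lp: "Lp_loc (1/2) Kmap"
  define lo hi :: "real^3" where "lo = vector [1/4, -1/4, 0]" and "hi = vector [1/2, 1/4, 1/4]"
  have box: "X \<in> cbox lo hi \<longleftrightarrow> (1/4 \<le> X$1 \<and> X$1 \<le> 1/2) \<and> (-1/4 \<le> X$2 \<and> X$2 \<le> 1/4) \<and> (0 \<le> X$3 \<and> X$3 \<le> 1/4)" for X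
    by (auto simp: lo_def hi_def mem_box_cart forall_3)
  have "set_integrable lebesgue (cbox lo hi) (\<lambda>X. norm (Kmap X) powr (1/2))"
    using Lp compact_cbox unfolding Lp_loc_def by blast
  then have fin: "(\<integral>\<^sup>+X. ennreal (norm (indicat_real (cbox lo hi) X *\<^sub>R norm (Kmap X) powr (1/2))) \<partial>lebesgue) < \<infinity>"
    unfolding set_integrable_def integrable_iff_bounded by blast
  define f where "f i s = (if i = (1::3) then indicator {1/4..1/2} s
     else if i = 2 then indicator {-1/4..1/4} s else ennreal (1 / s) * indicator {0<..1/4} s)" for i and s :: real
  have [measurable]: "f i \<in> borel_measurable borel" for i unfolding f_def by measurable
  have "(\<integral>\<^sup>+X. ennreal (1/128) * (\<Prod>i\<in>UNIV. f i (X $ i)) \<partial>lebesgue)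
     \<le> (\<integral>\<^sup>+X. ennreal (norm (indicat_real (cbox lo hi) X *\<^sub>R norm (Kmap X) powr (1/2))) \<partial>lebesgue)"
  proof (rule nn_integral_mono)
    fix X :: "real^3"
    show "ennreal (1/128) * (\<Prod>i\<in>UNIV. f i (X $ i)) \<le> ennreal (norm (indicat_real (cbox lo hi) X *\<^sub>R norm (Kmap X) powr (1/2)))"
    proof (cases "1/4 \<le> X$1 \<and> X$1 \<le> 1/2 \<and> \<bar>X$2\<bar> \<le> 1/4 \<and> 0 < X$3 \<and> X$3 \<le> 1/4")
      case True
      then have "(\<Prod>i\<in>UNIV. f i (X $ i)) = ennreal (1 / X$3)"
        by (auto simp: prod_UNIV_3 f_def indicator_def abs_le_iff)
      then have "ennreal (1/128) * (\<Prod>i\<in>UNIV. f i (X $ i)) = ennreal (1 / (128 * X$3))"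
        using True by (simp add: ennreal_mult'[symmetric])
      also have "\<dots> \<le> ennreal (Kmap X powr (1/2))"
        using True by (intro ennreal_leI Kmap_lower_bound) auto
      finally have "ennreal (1/128) * (\<Prod>i\<in>UNIV. f i (X $ i)) \<le> ennreal (Kmap X powr (1/2))" .
      moreover have "X \<in> cbox lo hi" using True unfolding box by (auto simp: abs_le_iff)
      moreover have "\<bar>Kmap X\<bar> = Kmap X" by (simp add: Kmap_def)
      ultimately show ?thesis by simp
    next
      case False
      then have "(\<Prod>i\<in>UNIV. f i (X $ i)) = 0"
        by (auto simp: prod_UNIV_3 f_def indicator_def abs_le_iff)
      then show ?thesis by (simp only: mult_zero_right zero_le)
    qed
  qed
  moreover have "(\<integral>\<^sup>+X. ennreal (1/128) * (\<Prod>i\<in>UNIV. f i (X $ i)) \<partial>(lebesgue :: (real^3) measure)) = \<infinity>"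
  proof -
    have "(\<integral>\<^sup>+X. ennreal (1/128) * (\<Prod>i\<in>UNIV. f i (X $ i)) \<partial>(lebesgue :: (real^3) measure))
       = ennreal (1/128) * (\<integral>\<^sup>+X. (\<Prod>i\<in>UNIV. f i (X $ i)) \<partial>(lborel :: (real^3) measure))"
      unfolding nn_integral_completion by (rule nn_integral_cmult) (simp, measurable)
    also have "\<dots> = ennreal (1/128) * (\<Prod>i\<in>UNIV. \<integral>\<^sup>+s. f i s \<partial>lborel)"
      by (subst nn_integral_prod_components) auto
    also have "\<dots> = \<infinity>"
      by (simp add: prod_UNIV_3 f_def nn_integral_inverse_infinite[of "1/4"] ennreal_mult_top ennreal_top_mult
          ennreal_mult_eq_top_iff)
    finally show ?thesis .
  qed
  ultimately show False using fin by (simp add: top.extremum_unique)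
qed

theorem theorem1p2:
  shows "\<exists>(h :: real^3 \<Rightarrow> real^3) (Dh :: real^3 \<Rightarrow> real^3^3) (K :: real^3 \<Rightarrow> real).
     W1_loc 3 h Dh \<and> distortion_function Dh K
   \<and> topologically_monotone h \<and> compact_preimages h \<and> surj h
   \<and> locally_lipschitz h \<and> (AE x in lebesgue. 0 < det (Dh x)) \<and> finite_distortion h
   \<and> (\<forall>p. 0 < p \<and> p < 1/2 \<longrightarrow> Lp_loc p K) \<and> \<not> Lp_loc (1/2) K
   \<and> bilipschitz_equivalent (h -` {0}) unit_circle
   \<and> bilipschitz_equivalent (h -` {- e_x}) unit_circle
   \<and> (\<forall>t\<in>{0<..<1}. bilipschitz_equivalent (h -` {- (t *\<^sub>R e_x)}) figure_eight)
   \<and> (\<forall>t\<in>{1<..}. bilipschitz_equivalent (h -` {- (t *\<^sub>R e_x)}) {0..1::real})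
   \<and> (\<forall>y. y \<notin> {- (t *\<^sub>R e_x) |t. t \<ge> 0} \<longrightarrow> (\<exists>x. h -` {y} = {x}))"
proof (rule exI[of _ hmap], rule exI[of _ Dhmap], rule exI[of _ Kmap], intro conjI ballI allI impI)
  show "W1_loc 3 hmap Dhmap" by (rule hmap.W1_loc) simp
  then show "finite_distortion hmap"
    using distortion_function_Kmap unfolding finite_distortion_def distortion_function_def by blast
  show "AE x in lebesgue. 0 < det (Dhmap x)"
    using AE_not_slits by eventually_elim (rule det_Dhmap_pos)
  show "\<exists>x. hmap -` {y} = {x}" if "y \<notin> {- (t *\<^sub>R e_x) |t. t \<ge> 0}" for y
    using that by (rule hmap_off_ray)
  show "surj hmap" by (rule surj_hmap)
qed (auto intro: distortion_function_Kmap topologically_monotone_hmap compact_preimages_hmap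
    boundedly_lipschitz_imp_locally_lipschitz boundedly_lipschitz_hmap Kmap_Lp_loc fiber_0 fiber_1
    fiber_figure_eight fiber_arc simp: Kmap_not_Lp_loc)

end
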